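(* There exist absolute constants $c_1,c_2,c_3>0$ and an assignment $K\mapsto (A_K,B_K,C_K)$, defined on the set of all quintic number fields $K$ (up to isomorphism) whose Galois closure $K^{\mathrm{gal}}$ satisfies $\operatorname{Gal}(K^{\mathrm{gal}}/\mathbb{Q})\simeq D_5$, with the following properties. For every such $K$: $A_K,B_K\in\mathcal{O}_{\mathbb{Q}(\sqrt5)}$, $C_K\in\mathbb{Z}$, \[\operatorname{Nm}^{\mathbb{Q}(\sqrt5)}_{\mathbb{Q}}\left(B_K^2-4\,\overline{A_K}\,A_K^2\right)=5\,C_K^2,\] and under every archimedean absolute value (i.e. under both real embeddings of $\mathbb{Q}(\sqrt5)$) \[|A_K|\le c_1|D_K|^{1/4},\qquad |B_K|\le c_2|D_K|^{3/8},\qquad |C_K|\le c_3|D_K|^{3/4}.\] Moreover, the assignment is injective: the triple $(A_K,B_K,C_K)$ uniquely determines $K$.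
   Context: $D_5$ denotes the dihedral group of order $10$. $D_K$ is the discriminant of $K$. For $z\in\mathbb{Q}(\sqrt5)$, $\bar z$ denotes the image of $z$ under the nontrivial automorphism $\sqrt5\mapsto-\sqrt5$, and $\operatorname{Nm}^{\mathbb{Q}(\sqrt5)}_{\mathbb{Q}}(z)=z\bar z$. $\mathcal{O}_{\mathbb{Q}(\sqrt5)}$ is the ring of integers of $\mathbb{Q}(\sqrt5)$. *)

theory Defs
  imports
    Complex_Main
    "HOL-Algebra.Algebra"
    "HOL-Algebra.Algebraic_Closure_Type"
    "HOL-Computational_Algebra.Computational_Algebra"
    "Jordan_Normal_Form.Determinant"
begin

section \<open>Number fields inside the complex numbers\<close>

text \<open>
  A number field always embeds into the complex numbers, so number fields are represented as
  subfields of \<^typ>\<open>complex\<close> of finite degree over the rationals. Different subfields may be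
  isomorphic; isomorphism is \<^const>\<open>is_ring_iso\<close> between the corresponding ring records.
\<close>

abbreviation cring_on :: "complex set \<Rightarrow> complex ring" where
  "cring_on K \<equiv> ring_of_type_algebra\<lparr>carrier := K\<rparr>"

definition number_field :: "complex set \<Rightarrow> bool" where
  "number_field K \<longleftrightarrow>
     subfield K (ring_of_type_algebra :: complex ring) \<and>
     ring.finite_dimension (ring_of_type_algebra :: complex ring) \<rat> K"

definition field_degree :: "complex set \<Rightarrow> nat" where
  "field_degree K = ring.dim (ring_of_type_algebra :: complex ring) \<rat> K"

definition ring_of_integers :: "complex set \<Rightarrow> complex set" where
  "ring_of_integers K = {x \<in> K. algebraic_int x}"

text \<open>Homomorphisms are taken extensional (undefined outside \<open>K\<close>), so that each embedding
  is represented by exactly one HOL function.\<close>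

definition embeddings :: "complex set \<Rightarrow> (complex \<Rightarrow> complex) set" where
  "embeddings K = Ring.ring_hom (cring_on K) ring_of_type_algebra \<inter> extensional K"

definition field_trace :: "complex set \<Rightarrow> complex \<Rightarrow> complex" where
  "field_trace K x = (\<Sum>\<sigma>\<in>embeddings K. \<sigma> x)"

definition integral_basis :: "complex set \<Rightarrow> complex list \<Rightarrow> bool" where
  "integral_basis K bs \<longleftrightarrow>
     bij_betw (\<lambda>c :: int list. \<Sum>i<length bs. of_int (c ! i) * bs ! i)
       {c. length c = length bs} (ring_of_integers K)"

definition field_discriminant :: "complex set \<Rightarrow> int" where
  "field_discriminant K = (THE d. \<exists>bs. integral_basis K bs \<and>
     of_int d = det (mat (length bs) (length bs) (\<lambda>(i, j). field_trace K (bs ! i * bs ! j))))"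

section \<open>Galois closure and Galois group\<close>

text \<open>Separability is automatic in characteristic 0. As the complex numbers are algebraically
  closed, a polynomial splits over \<open>L\<close> iff all its complex roots lie in \<open>L\<close>.\<close>

definition galois_over_rationals :: "complex set \<Rightarrow> bool" where
  "galois_over_rationals L \<longleftrightarrow> number_field L \<and>
     (\<forall>p :: rat poly. Factorial_Ring.irreducible p \<and> (\<exists>x\<in>L. poly (map_poly of_rat p) x = 0) \<longrightarrow>
        (\<forall>x :: complex. poly (map_poly of_rat p) x = 0 \<longrightarrow> x \<in> L))"

definition galois_closure :: "complex set \<Rightarrow> complex set" where
  "galois_closure K = \<Inter>{L. galois_over_rationals L \<and> K \<subseteq> L}"

definition galois_group :: "complex set \<Rightarrow> (complex \<Rightarrow> complex) monoid" where
  "galois_group L = (BijGroup L)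
     \<lparr>carrier := {\<sigma> \<in> Bij L. \<sigma> \<in> ring_iso (cring_on L) (cring_on L) \<and> (\<forall>q\<in>\<rat>. \<sigma> q = q)}\<rparr>"

text \<open>The pair \<open>(a, e)\<close> stands for \<open>r\<^sup>a s\<^sup>e\<close> with \<open>r\<^sup>n = s\<^sup>2 = 1\<close> and
  \<open>s r s = r\<^sup>-\<^sup>1\<close>; thus \<open>dihedral_group n\<close> has order \<open>2 n\<close>.\<close>

definition dihedral_group :: "nat \<Rightarrow> (int \<times> bool) monoid" where
  "dihedral_group n =
     \<lparr>carrier = {0..<int n} \<times> UNIV,
      monoid.mult = (\<lambda>(a, e) (b, f). ((if e then a - b else a + b) mod int n, e \<noteq> f)),
      monoid.one = (0, False)\<rparr>"

definition D5_quintic_field :: "complex set \<Rightarrow> bool" where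
  "D5_quintic_field K \<longleftrightarrow> number_field K \<and> field_degree K = 5 \<and>
     galois_group (galois_closure K) \<cong> dihedral_group 5"

section \<open>The quadratic field generated by the square root of 5\<close>

text \<open>It is realised inside the reals; its two real embeddings are then the inclusion and
  the conjugation \<open>qsqrt5_conj\<close>.\<close>

definition qsqrt5 :: "real set" where
  "qsqrt5 = {of_rat a + of_rat b * sqrt 5 | a b. True}"

definition qsqrt5_conj :: "real \<Rightarrow> real" where
  "qsqrt5_conj z = (THE w. \<exists>a b. z = of_rat a + of_rat b * sqrt 5 \<and> w = of_rat a - of_rat b * sqrt 5)"

definition qsqrt5_norm :: "real \<Rightarrow> real" where
  "qsqrt5_norm z = z * qsqrt5_conj z"

definition qsqrt5_integers :: "real set" where
  "qsqrt5_integers = {z \<in> qsqrt5. algebraic_int z}"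

lemma sqrt5_irrational: "sqrt 5 \<notin> \<rat>"
proof
  assume rat: "sqrt 5 \<in> \<rat>"
  have "algebraic_int (sqrt 5 :: real)"
    by (rule algebraic_int.intros[of "[:-5, 0, 1:]"]) (auto simp: coeff_pCons split: nat.splits)
  then have "sqrt 5 \<in> \<int>"
    using rat by (rule rational_algebraic_int_is_int)
  then obtain k :: int where k: "sqrt 5 = of_int k"
    by (auto elim: Ints_cases)
  have "2 < sqrt 5" "sqrt 5 < 3"
    by (auto intro: real_less_rsqrt real_less_lsqrt)
  then have "2 < k" "k < 3"
    unfolding k by simp_all
  then show False
    by linarith
qed

lemma qsqrt5_conj_eq: "qsqrt5_conj (of_rat a + of_rat b * sqrt 5) = of_rat a - of_rat b * sqrt 5"
  unfolding qsqrt5_conj_def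
proof (rule the_equality)
  fix w :: real
  assume "\<exists>c d. of_rat a + of_rat b * sqrt 5 = of_rat c + of_rat d * sqrt 5 \<and>
    w = of_rat c - of_rat d * sqrt 5"
  then obtain c d where eq: "of_rat a + of_rat b * sqrt 5 = of_rat c + of_rat d * sqrt 5"
    and w: "w = of_rat c - of_rat d * sqrt 5"
    by blast
  have *: "of_rat (b - d) * sqrt 5 = of_rat (c - a)"
    using eq by (simp add: of_rat_diff algebra_simps)
  have "b = d"
  proof (rule ccontr)
    assume "b \<noteq> d"
    then have "sqrt 5 = of_rat ((c - a) / (b - d))"
      using * by (simp add: of_rat_divide field_simps)
    then show False
      using sqrt5_irrational by (metis Rats_of_rat)
  qed
  then show "w = of_rat a - of_rat b * sqrt 5"
    using eq w by simp
qed auto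

end

theory Submission
  imports Defs "Jordan_Normal_Form.Char_Poly"
begin

text \<open>
  Let \<open>x\<close> be an integral generator of \<open>K\<close> of trace zero whose conjugates are all bounded by a
  multiple of \<open>\<bar>D\<bar>\<^sup>1\<^sup>/\<^sup>8\<close>; it exists because the trace form makes the ring of integers modulo
  \<open>\<int>\<close> a lattice of rank 4 and determinant about \<open>\<bar>D\<bar>\<close>. The Galois group lets us number the
  conjugates \<open>x\<^sub>0, \<dots>, x\<^sub>4\<close> so that it acts by \<open>x\<^sub>i \<mapsto> x\<^sub>i\<^sub>+\<^sub>1\<close> and \<open>x\<^sub>i \<mapsto> x\<^sub>-\<^sub>i\<close>. With the Lagrange
  resolvents \<open>v\<^sub>j = \<Sum>\<^sub>i \<zeta>\<^sup>i\<^sup>j x\<^sub>i\<close> put \<open>A = v\<^sub>1 v\<^sub>4\<close> and \<open>B = v\<^sub>1\<^sup>2 v\<^sub>3 + v\<^sub>4\<^sup>2 v\<^sub>2\<close>; their conjugates are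
  obtained by replacing \<open>\<zeta>\<close> by \<open>\<zeta>\<^sup>2\<close>, and \<open>B\<^sup>2 - 4 A' A\<^sup>2\<close> (with \<open>A'\<close> the conjugate of \<open>A\<close>) is the square of \<open>v\<^sub>1\<^sup>2 v\<^sub>3 - v\<^sub>4\<^sup>2 v\<^sub>2\<close>,
  whose product with its conjugate is an integer \<open>C\<close> times the square root of 5. Conversely \<open>A\<close>, \<open>B\<close>
  and \<open>C\<close> determine \<open>v\<^sub>1\<^sup>2 v\<^sub>3\<close>, \<open>v\<^sub>4\<^sup>2 v\<^sub>2\<close> and their conjugates up to the reflection \<open>j \<mapsto> -j\<close>, hence
  (as \<open>A \<noteq> 0\<close>) the \<open>v\<^sub>j\<close> up to \<open>v\<^sub>j \<mapsto> \<eta>\<^sup>j v\<^sub>j\<close> with \<open>\<eta>\<^sup>5 = 1\<close>, hence the set of the \<open>x\<^sub>i\<close>.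
\<close>

section \<open>Algebraic integers\<close>

text \<open>All three exponents come from 1/8. The Gram determinant of a rank 4 lattice scales like
  the eighth power of a length, so the short generator has size about the eighth root of |D|; A, B
  and C are forms of degree 2, 3 and 6 in its conjugates, which gives 1/4, 3/8 and 3/4.

  The third invariant has one purpose. Put P = v1^2 v3, P' = v4^2 v2, Q = v2^2 v1, Q' = v3^2 v4. As
  P P' = A^2 A', the numbers A and B fix the unordered pairs {P, P'} and {Q, Q'}, but not which
  member of one belongs with which member of the other. Swapping a single pair changes the sign of
  C; only the simultaneous swap, which is the reflection, keeps it.

  Two obstacles shape the rest. Neither the generator nor the numbering of its conjugates is
  canonical, so the triple is chosen on one representative of each isomorphism class. And the
  discriminant is a definite description over integral bases, so existence of such a basis,
  independence of the choice and invariance under isomorphism have to be secured before it can be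
  used.\<close>

interpretation int_mod: Modules.module "\<lambda>(k::int) (x::complex). of_int k * x"
  by unfold_locales (auto simp: algebra_simps)

text \<open>Cayley--Hamilton: the characteristic polynomial of the matrix of multiplication by
  \<open>x\<close> is monic with integer coefficients.\<close>

lemma algebraic_int_if_stable_span:
  assumes fin: "finite S" and s0: "s0 \<in> S" "s0 \<noteq> 0"
    and stable: "\<And>s. s \<in> S \<Longrightarrow> x * s \<in> int_mod.span S"
  shows "algebraic_int x"
proof -
  obtain n and w :: "nat \<Rightarrow> complex" where bij: "bij_betw w {..<n} S"
    using ex_bij_betw_nat_finite[OF fin] unfolding atLeast0LessThan by blast
  have "\<exists>u. x * w i = (\<Sum>j<n. of_int (u j) * w j)" if "i < n" for i
  proof -
    have "x * w i \<in> int_mod.span S"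
      using stable bij that by (auto simp: bij_betw_def)
    then obtain u where "x * w i = (\<Sum>v\<in>S. of_int (u v) * v)"
      unfolding int_mod.span_finite[OF fin] by auto
    also have "\<dots> = (\<Sum>j<n. of_int (u (w j)) * w j)"
      using sum.reindex_bij_betw[OF bij, of "\<lambda>v. of_int (u v) * v"] by simp
    finally show ?thesis by (intro exI[of _ "\<lambda>j. u (w j)"])
  qed
  then obtain U where U: "\<And>i. i < n \<Longrightarrow> x * w i = (\<Sum>j<n. of_int (U i j) * w j)"
    by metis
  define M where "M = mat n n (\<lambda>(i, j). U i j)"
  define v where "v = vec n w"
  have M: "M \<in> carrier_mat n n" by (simp add: M_def)
  have "of_int_hom.mat_hom M *\<^sub>v v = x \<cdot>\<^sub>v v"
    by (intro eq_vecI)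
       (auto simp: M_def v_def scalar_prod_def U atLeast0LessThan row_def intro!: sum.cong)
  moreover have "v \<noteq> 0\<^sub>v n"
  proof
    assume "v = 0\<^sub>v n"
    obtain i where "i < n" "w i = s0" using bij s0(1) by (auto simp: bij_betw_def)
    with \<open>v = 0\<^sub>v n\<close> s0(2) show False
      by (metis index_zero_vec(1) v_def index_vec)
  qed
  ultimately have "eigenvector (of_int_hom.mat_hom M) v x"
    using M by (auto simp: eigenvector_def v_def)
  then have "poly (char_poly (of_int_hom.mat_hom M)) x = 0"
    using eigenvalue_root_char_poly[of "of_int_hom.mat_hom M" n x] M
    by (auto simp: eigenvalue_def)
  moreover have "char_poly (of_int_hom.mat_hom M) = map_poly (of_int :: int \<Rightarrow> complex) (char_poly M)"
    by (rule of_int_hom.char_poly_hom[OF M])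
  ultimately show ?thesis
    unfolding algebraic_int_altdef_ipoly using degree_monic_char_poly[OF M] by auto
qed

lemma algebraic_int_imp_power_span:
  assumes "algebraic_int (x :: complex)"
  obtains n where "n > 0" "x ^ n \<in> int_mod.span ((\<lambda>i. x ^ i) ` {..<n})"
proof -
  obtain p :: "int poly" where p: "poly (map_poly of_int p) x = 0" "lead_coeff p = 1"
    using assms unfolding algebraic_int_altdef_ipoly by blast
  define n where "n = degree p"
  have "(\<Sum>i\<le>n. of_int (coeff p i) * x ^ i) = 0"
    using p(1) by (simp add: poly_altdef n_def degree_map_poly coeff_map_poly)
  then have eq: "x ^ n = - (\<Sum>i<n. of_int (coeff p i) * x ^ i)"
    using p(2) by (simp add: n_def lessThan_Suc_atMost[symmetric] add_eq_0_iff2)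
  have "n > 0"
    using eq by (cases n) auto
  moreover have "x ^ n \<in> int_mod.span ((\<lambda>i. x ^ i) ` {..<n})"
    unfolding eq
    by (intro int_mod.span_neg int_mod.span_sum int_mod.span_scale int_mod.span_base) auto
  ultimately show ?thesis using that by blast
qed

text \<open>The monomials \<open>x ^ i * y ^ j\<close> with \<open>i < m\<close> and
  \<open>j < n\<close> span a module stable under x and under y: a monomial leaving this box is
  brought back by the integral equation of x or of y. Stability under x + y and x * y
  follows.\<close>

lemma algebraic_int_plus_times:
  assumes x: "algebraic_int (x :: complex)" and y: "algebraic_int y"
  shows "algebraic_int (x + y)" "algebraic_int (x * y)"
proof -
  obtain m where m: "m > 0" "x ^ m \<in> int_mod.span ((\<lambda>i. x ^ i) ` {..<m})"
    using algebraic_int_imp_power_span[OF x] by blast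
  obtain n where n: "n > 0" "y ^ n \<in> int_mod.span ((\<lambda>i. y ^ i) ` {..<n})"
    using algebraic_int_imp_power_span[OF y] by blast
  define S where "S = (\<lambda>(i, j). x ^ i * y ^ j) ` ({..<m} \<times> {..<n})"
  have scale: "z * w \<in> int_mod.span S" if "z \<in> int_mod.span T" "\<And>t. t \<in> T \<Longrightarrow> t * w \<in> int_mod.span S"
    for z w T
    using that(1)
    by (induction rule: int_mod.span_induct_alt)
       (auto simp: distrib_right mult.assoc intro!: int_mod.span_add int_mod.span_scale that(2)
             int_mod.span_zero)
  have base: "x ^ i * y ^ j \<in> int_mod.span S" if "i < m" "j < n" for i j
    using that by (intro int_mod.span_base) (auto simp: S_def)
  have xs: "x * s \<in> int_mod.span S" if "s \<in> S" for s
  proof -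
    obtain i j where ij: "i < m" "j < n" "s = x ^ i * y ^ j"
      using \<open>s \<in> S\<close> unfolding S_def by auto
    show ?thesis
    proof (cases "Suc i < m")
      case True
      then show ?thesis using base[of "Suc i" j] ij by (simp add: mult.assoc)
    next
      case False
      then have "x * s = x ^ m * y ^ j" using ij by (metis Suc_lessI mult.assoc power_Suc)
      also have "\<dots> \<in> int_mod.span S" by (rule scale[OF m(2)]) (use ij base in auto)
      finally show ?thesis .
    qed
  qed
  have ys: "y * s \<in> int_mod.span S" if "s \<in> S" for s
  proof -
    obtain i j where ij: "i < m" "j < n" "s = x ^ i * y ^ j"
      using \<open>s \<in> S\<close> unfolding S_def by auto
    show ?thesis
    proof (cases "Suc j < n")
      case True
      then show ?thesis using base[of i "Suc j"] ij by (simp add: mult.left_commute)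
    next
      case False
      then have "Suc j = n" using ij by simp
      then have "y * s = y ^ n * x ^ i" using ij by (simp flip: \<open>Suc j = n\<close> add: mult_ac)
      also have "\<dots> \<in> int_mod.span S"
        by (rule scale[OF n(2)]) (use ij base in \<open>auto simp: mult.commute\<close>)
      finally show ?thesis .
    qed
  qed
  have xspan: "x * z \<in> int_mod.span S" if "z \<in> int_mod.span S" for z
    using scale[OF that, of x] xs by (simp add: mult.commute)
  have S: "finite S" "1 \<in> S" using m(1) n(1) by (auto simp: S_def intro!: image_eqI[of _ _ "(0, 0)"])
  show "algebraic_int (x + y)"
    using S xs ys by (intro algebraic_int_if_stable_span[of S 1]) (auto simp: distrib_right int_mod.span_add)
  show "algebraic_int (x * y)"
    using S xspan ys by (intro algebraic_int_if_stable_span[of S 1]) (auto simp: mult.assoc)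
qed

lemma algebraic_int_diff: "algebraic_int (x :: complex) \<Longrightarrow> algebraic_int y \<Longrightarrow> algebraic_int (x - y)"
  using algebraic_int_plus_times(1)[of x "- y"] by simp

lemma algebraic_int_of_int [simp]: "algebraic_int (of_int k :: complex)"
  by (rule int_imp_algebraic_int) simp

lemma algebraic_int_sum:
  "(\<And>i. i \<in> I \<Longrightarrow> algebraic_int (f i :: complex)) \<Longrightarrow> algebraic_int (\<Sum>i\<in>I. f i)"
  by (induction I rule: infinite_finite_induct) (auto intro: algebraic_int_plus_times)

text \<open>An equation of degree n with leading coefficient a becomes, after multiplication by
  \<open>a ^ (n - 1)\<close>, a monic integral equation for a * x.\<close>

lemma algebraic_imp_int_multiple:
  assumes "algebraic (x :: complex)"
  obtains k :: int where "k \<noteq> 0" "algebraic_int (of_int k * x)"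
proof -
  obtain p :: "int poly" where p: "poly (map_poly of_int p) x = 0" "p \<noteq> 0"
    using algebraicE'[OF assms] by blast
  define n where "n = degree p"
  define a where "a = lead_coeff p"
  have "(\<Sum>i\<le>n. of_int (coeff p i) * x ^ i) = 0"
    using p(1) by (simp add: poly_altdef n_def degree_map_poly coeff_map_poly)
  then have eq: "of_int a * x ^ n = - (\<Sum>i<n. of_int (coeff p i) * x ^ i)"
    by (simp add: n_def a_def lessThan_Suc_atMost[symmetric] add_eq_0_iff2)
  have a: "a \<noteq> 0" using p(2) by (simp add: a_def)
  have n: "n > 0" using eq a by (cases n) auto
  define z where "z = of_int a * x"
  have "z ^ n = of_int a ^ (n - 1) * (of_int a * x ^ n)"
    using n by (cases n) (simp_all add: z_def power_mult_distrib mult_ac)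
  also have "\<dots> = - (\<Sum>i<n. of_int (a ^ (n - 1 - i) * coeff p i) * z ^ i)"
  proof -
    have "of_int a ^ (n - 1) * (of_int (coeff p i) * x ^ i) =
        of_int (a ^ (n - 1 - i) * coeff p i) * z ^ i" if "i < n" for i
    proof -
      have "(of_int a :: complex) ^ (n - 1) = of_int a ^ (n - 1 - i) * of_int a ^ i"
        using that by (simp flip: power_add)
      then show ?thesis by (simp add: z_def power_mult_distrib mult_ac)
    qed
    then show ?thesis
      unfolding eq by (simp add: sum_distrib_left del: of_int_mult of_int_power cong: sum.cong_simp)
  qed
  finally have zn: "z ^ n = - (\<Sum>i<n. of_int (a ^ (n - 1 - i) * coeff p i) * z ^ i)" .
  have "algebraic_int z"
  proof (rule algebraic_int_if_stable_span[of "(\<lambda>i. z ^ i) ` {..<n}" 1])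
    show "1 \<in> (\<lambda>i. z ^ i) ` {..<n}" using n by (auto intro!: image_eqI[of _ _ 0])
    fix s assume "s \<in> (\<lambda>i. z ^ i) ` {..<n}"
    then obtain i where i: "i < n" "s = z ^ i" by auto
    show "z * s \<in> int_mod.span ((\<lambda>i. z ^ i) ` {..<n})"
    proof (cases "Suc i < n")
      case True
      then show ?thesis using i by (intro int_mod.span_base) (auto intro!: image_eqI[of _ _ "Suc i"])
    next
      case False
      then have "z * s = z ^ n" using i by (metis Suc_lessI power_Suc)
      moreover have "z ^ n \<in> int_mod.span ((\<lambda>i. z ^ i) ` {..<n})"
        unfolding zn
        by (intro int_mod.span_neg int_mod.span_sum int_mod.span_scale int_mod.span_base) auto
      ultimately show ?thesis by simp
    qed
  qed auto
  with a show ?thesis using that by (simp add: z_def)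
qed

section \<open>Simple extensions of the rational numbers\<close>

definition qev :: "rat poly \<Rightarrow> complex \<Rightarrow> complex" where
  "qev p x = poly (map_poly of_rat p) x"

interpretation rat_poly: map_poly_inj_idom_hom "of_rat :: rat \<Rightarrow> complex" ..

lemma qev_simps [simp]:
  "qev 0 x = 0" "qev 1 x = 1" "qev (p + q) x = qev p x + qev q x"
  "qev (p - q) x = qev p x - qev q x" "qev (- p) x = - qev p x"
  "qev (p * q) x = qev p x * qev q x" "qev (p ^ n) x = qev p x ^ n"
  "qev [:a:] x = of_rat a" "qev (pCons a p) x = of_rat a + x * qev p x"
  "qev (smult a p) x = of_rat a * qev p x"
  by (simp_all add: qev_def hom_distribs)

text \<open>This is the ring \<rat>[x], which is the field \<rat>(x) as soon as x is
  algebraic.\<close>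

definition simple_ext :: "complex \<Rightarrow> complex set" where
  "simple_ext x = range (\<lambda>p. qev p x)"

text \<open>Defined without a minimal polynomial: membership of z is exactly the condition under
  which substituting z for x is well defined on \<open>simple_ext x\<close>. For algebraic x the set
  consists of the roots of the minimal polynomial.\<close>

definition conjugates :: "complex \<Rightarrow> complex set" where
  "conjugates x = {z. \<forall>p. qev p x = 0 \<longrightarrow> qev p z = 0}"

lemma self_conjugate [simp]: "x \<in> conjugates x"
  by (simp add: conjugates_def)

lemma algebraic_iff_qev: "algebraic x \<longleftrightarrow> (\<exists>p. p \<noteq> 0 \<and> qev p x = 0)"
proof
  assume "algebraic x"
  then obtain p :: "int poly" where p: "p \<noteq> 0" "poly (map_poly of_int p) x = 0"
    using algebraicE' by blast
  have "map_poly of_rat (map_poly of_int p) = (map_poly of_int p :: complex poly)"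
    by (simp add: map_poly_map_poly o_def)
  then have "qev (map_poly of_int p) x = 0" using p by (simp add: qev_def)
  moreover have "map_poly of_int p \<noteq> (0 :: rat poly)" using p(1) by simp
  ultimately show "\<exists>p. p \<noteq> 0 \<and> qev p x = 0" by blast
next
  assume "\<exists>p. p \<noteq> 0 \<and> qev p x = 0"
  then obtain p where "p \<noteq> 0" "qev p x = 0" by blast
  then show "algebraic x"
    by (intro algebraicI'[of "map_poly of_rat p"]) (auto simp: qev_def coeff_map_poly)
qed

text \<open>Otherwise p and q are coprime, and a Bezout identity evaluated at x reads 0 = 1.\<close>

lemma irreducible_root_imp_dvd:
  assumes "Factorial_Ring.irreducible p" "qev p x = 0" "qev q x = 0"
  shows "p dvd q"
proof (rule ccontr)
  assume "\<not> p dvd q"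
  with assms(1) have "coprime p q"
    by (intro prime_elem_imp_coprime irreducible_imp_prime_elem_gcd)
  then obtain a b where "a * p + b * q = 1"
    using bezout_coefficients_fst_snd[of p q] coprime_imp_gcd_eq_1 by metis
  then have "qev (a * p + b * q) x = 1" by simp
  with assms(2,3) show False by simp
qed

lemma minimal_polynomial:
  assumes "algebraic x"
  obtains p where "Factorial_Ring.irreducible p" "lead_coeff p = 1" "qev p x = 0"
proof -
  have ex: "\<exists>n p. p \<noteq> 0 \<and> qev p x = 0 \<and> degree p = n"
    using assms algebraic_iff_qev by blast
  define n where "n = (LEAST n. \<exists>p. p \<noteq> 0 \<and> qev p x = 0 \<and> degree p = n)"
  obtain p0 where p0: "p0 \<noteq> 0" "qev p0 x = 0" "degree p0 = n"
    using LeastI_ex[OF ex] unfolding n_def by blast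
  have min: "n \<le> degree q" if "q \<noteq> 0" "qev q x = 0" for q
    unfolding n_def by (rule Least_le) (use that in blast)
  define p where "p = smult (inverse (lead_coeff p0)) p0"
  have p: "p \<noteq> 0" "qev p x = 0" "degree p = n" "lead_coeff p = 1"
    using p0 by (auto simp: p_def)
  have "Factorial_Ring.irreducible p"
  proof (rule Factorial_Ring.irreducibleI)
    show "p \<noteq> 0" by (rule p)
    show "\<not> p dvd 1"
    proof
      assume "p dvd 1"
      then have "qev 1 x = 0" using p(2) by (metis dvd_def qev_simps(6) mult_zero_left)
      then show False by simp
    qed
    fix a b assume ab: "p = a * b"
    then have nz: "a \<noteq> 0" "b \<noteq> 0" using p(1) by auto
    have "qev a x = 0 \<or> qev b x = 0" using p(2) ab by simp
    then have "degree b = 0 \<or> degree a = 0"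
      using min[of a] min[of b] nz p(3) degree_mult_eq[OF nz] ab by auto
    then show "a dvd 1 \<or> b dvd 1" using nz by (auto simp: is_unit_iff_degree)
  qed
  with p that show ?thesis by blast
qed

lemma conjugates_eq_roots:
  assumes "Factorial_Ring.irreducible p" "qev p x = 0"
  shows "conjugates x = {z. qev p z = 0}"
proof (intro equalityI subsetI)
  fix z assume z: "z \<in> {z. qev p z = 0}"
  have "qev q z = 0" if "qev q x = 0" for q
    using irreducible_root_imp_dvd[OF assms that] z by (auto simp: dvd_def)
  then show "z \<in> conjugates x" by (simp add: conjugates_def)
qed (use assms(2) in \<open>auto simp: conjugates_def\<close>)

text \<open>A double root would be a root of the derivative, so p would divide its derivative, which
  is nonzero and of smaller degree.\<close>

lemma rsquarefree_irreducible:
  assumes "Factorial_Ring.irreducible p"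
  shows "rsquarefree (map_poly of_rat p :: complex poly)"
  unfolding rsquarefree_roots
proof (intro allI notI)
  let ?P = "map_poly of_rat p :: complex poly"
  have p0: "p \<noteq> 0" using assms by auto
  have deg: "degree p > 0"
    using assms p0 by (metis irreducible_not_unit is_unit_iff_degree not_gr_zero)
  fix a assume a: "poly ?P a = 0 \<and> poly (pderiv ?P) a = 0"
  then have "qev (pderiv p) a = 0" by (simp add: qev_def of_rat_hom.map_poly_pderiv)
  then have "p dvd pderiv p"
    using a by (intro irreducible_root_imp_dvd[OF assms, of a]) (simp_all add: qev_def)
  moreover have "pderiv p \<noteq> 0" using deg by (simp add: pderiv_eq_0_iff)
  ultimately show False
    using dvd_imp_degree_le[of p "pderiv p"] degree_pderiv[of p] deg by linarith
qed

lemma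
  assumes "Factorial_Ring.irreducible p"
  shows card_roots_irreducible: "card {z. qev p z = 0} = degree p"
    and finite_roots_irreducible: "finite {z. qev p z = 0}"
proof -
  let ?P = "map_poly of_rat p :: complex poly"
  have p0: "p \<noteq> 0" using assms by auto
  have "rsquarefree ?P" by (rule rsquarefree_irreducible[OF assms])
  define Q where "Q = (\<Prod>z|poly ?P z = 0. [:-z, 1:])"
  have "smult (lead_coeff ?P) Q = ?P"
    unfolding Q_def using \<open>rsquarefree ?P\<close> by (rule complex_poly_decompose_rsquarefree)
  then have "degree ?P = degree (smult (lead_coeff ?P) Q)" by simp
  also have "\<dots> = degree Q" unfolding degree_smult_eq using p0 by simp
  also have "\<dots> = card {z. poly ?P z = 0}"
    unfolding Q_def by (subst degree_prod_eq_sum_degree) auto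
  finally show "card {z. qev p z = 0} = degree p" by (simp add: qev_def)
  show "finite {z. qev p z = 0}"
    using p0 poly_roots_finite[of ?P] by (simp add: qev_def)
qed

lemma finite_conjugates: "algebraic x \<Longrightarrow> finite (conjugates x)"
  by (metis minimal_polynomial conjugates_eq_roots finite_roots_irreducible)

lemma conjugates_eq:
  assumes "algebraic x" "z \<in> conjugates x"
  shows "conjugates z = conjugates x"
proof -
  obtain p where p: "Factorial_Ring.irreducible p" "qev p x = 0" using minimal_polynomial[OF assms(1)] by blast
  then have "qev p z = 0" using assms(2) by (auto simp: conjugates_def)
  with p show ?thesis by (simp add: conjugates_eq_roots)
qed

lemma algebraic_conjugate: "algebraic x \<Longrightarrow> z \<in> conjugates x \<Longrightarrow> algebraic z"
  by (auto simp: algebraic_iff_qev conjugates_def)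

lemma algebraic_int_conjugate:
  assumes "algebraic_int x" "z \<in> conjugates x" shows "algebraic_int z"
proof -
  obtain p :: "int poly" where p: "poly (map_poly of_int p) x = 0" "lead_coeff p = 1"
    using assms(1) unfolding algebraic_int_altdef_ipoly by blast
  have "map_poly of_rat (map_poly of_int p) = (map_poly of_int p :: complex poly)"
    by (simp add: map_poly_map_poly o_def)
  then have *: "qev (map_poly of_int p) w = poly (map_poly of_int p) w" for w by (simp add: qev_def)
  have "poly (map_poly of_int p) z = 0"
    using assms(2) p(1) unfolding conjugates_def by (simp flip: *)
  with p(2) show ?thesis unfolding algebraic_int_altdef_ipoly by blast
qed

lemma simple_ext_self [simp]: "x \<in> simple_ext x"
  unfolding simple_ext_def by (rule range_eqI[of _ _ "[:0, 1:]"]) simp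

lemma qev_in_simple_ext [simp]: "qev p x \<in> simple_ext x"
  by (simp add: simple_ext_def)

lemma Rats_simple_ext: "\<rat> \<subseteq> simple_ext x"
proof
  fix q assume "q \<in> (\<rat> :: complex set)"
  then obtain r where "q = of_rat r" by (auto elim: Rats_cases)
  then show "q \<in> simple_ext x" unfolding simple_ext_def by (intro range_eqI[of _ _ "[:r:]"]) simp
qed

text \<open>The working notion of a subfield: closure conditions on a set, free of ring records and
  matched with them in \<open>subfield_iff_csubfield\<close>. As \<open>inverse 0 = 0\<close>,
  closure under inverses carries no side condition.\<close>

definition csubfield :: "complex set \<Rightarrow> bool" where
  "csubfield F \<longleftrightarrow> 1 \<in> F \<and> (\<forall>x\<in>F. \<forall>y\<in>F. x - y \<in> F \<and> x * y \<in> F) \<and> (\<forall>x\<in>F. inverse x \<in> F)"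

lemma csubfieldD:
  assumes "csubfield F"
  shows "1 \<in> F" "0 \<in> F" "x \<in> F \<Longrightarrow> y \<in> F \<Longrightarrow> x + y \<in> F" "x \<in> F \<Longrightarrow> y \<in> F \<Longrightarrow> x - y \<in> F"
    "x \<in> F \<Longrightarrow> y \<in> F \<Longrightarrow> x * y \<in> F" "x \<in> F \<Longrightarrow> - x \<in> F" "x \<in> F \<Longrightarrow> inverse x \<in> F"
    "x \<in> F \<Longrightarrow> y \<in> F \<Longrightarrow> x / y \<in> F"
proof -
  note * = assms[unfolded csubfield_def]
  show 1: "1 \<in> F" using * by blast
  have "1 - 1 \<in> F" using * by blast
  then show 0: "0 \<in> F" by simp
  show m: "- x \<in> F" if "x \<in> F" for x using 0 * that by (metis diff_0)
  show "x + y \<in> F" if "x \<in> F" "y \<in> F" using * that m by (metis diff_minus_eq_add)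
  show "x - y \<in> F" "x * y \<in> F" if "x \<in> F" "y \<in> F" using * that by blast+
  show "inverse x \<in> F" if "x \<in> F" using * that by blast
  show "x / y \<in> F" if "x \<in> F" "y \<in> F" using * that by (simp add: divide_inverse)
qed

lemma csubfield_of_nat: "csubfield F \<Longrightarrow> of_nat n \<in> F"
  by (induction n) (auto intro: csubfieldD)

lemma csubfield_Rats: assumes "csubfield F" shows "\<rat> \<subseteq> F"
proof
  fix q assume "q \<in> (\<rat> :: complex set)"
  then obtain a b where q: "q = of_int a / of_int b" by (auto elim!: Rats_cases')
  have "of_int k \<in> F" for k
    by (cases k rule: int_cases2) (auto intro: csubfield_of_nat csubfieldD(6) assms)
  then show "q \<in> F" unfolding q using csubfieldD(8)[OF assms] by blast
qed

lemma csubfield_of_rat: "csubfield F \<Longrightarrow> of_rat r \<in> F"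
  using csubfield_Rats Rats_of_rat by blast

lemma csubfield_qev:
  assumes "csubfield F" "x \<in> F" shows "qev p x \<in> F"
  by (induction p) (auto intro!: csubfieldD csubfield_of_rat assms)

lemma simple_ext_subset: "csubfield F \<Longrightarrow> x \<in> F \<Longrightarrow> simple_ext x \<subseteq> F"
  by (auto simp: simple_ext_def csubfield_qev)

lemma csubfield_sum: "csubfield F \<Longrightarrow> (\<And>i. i \<in> I \<Longrightarrow> f i \<in> F) \<Longrightarrow> sum f I \<in> F"
  by (induction I rule: infinite_finite_induct) (auto intro: csubfieldD)

text \<open>Inverses come from a Bezout identity between the minimal polynomial and a polynomial
  representing the element.\<close>

lemma csubfield_simple_ext:
  assumes "algebraic x" shows "csubfield (simple_ext x)"
  unfolding csubfield_def
proof (intro conjI ballI)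
  show "1 \<in> simple_ext x" by (rule subsetD[OF Rats_simple_ext Rats_1])
  fix a b assume "a \<in> simple_ext x" "b \<in> simple_ext x"
  then obtain p q where "a = qev p x" "b = qev q x" by (auto simp: simple_ext_def)
  then show "a - b \<in> simple_ext x" "a * b \<in> simple_ext x"
    using qev_in_simple_ext[of "p - q" x] qev_in_simple_ext[of "p * q" x] by simp_all
next
  fix a assume "a \<in> simple_ext x"
  then obtain p where p: "a = qev p x" by (auto simp: simple_ext_def)
  obtain m where m: "Factorial_Ring.irreducible m" "qev m x = 0" using minimal_polynomial[OF assms] by blast
  show "inverse a \<in> simple_ext x"
  proof (cases "m dvd p")
    case True
    then have "a = 0" using m(2) by (auto simp: p dvd_def)
    then show ?thesis using subsetD[OF Rats_simple_ext Rats_0] by simp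
  next
    case False
    with m(1) have "coprime m p"
      by (intro prime_elem_imp_coprime irreducible_imp_prime_elem_gcd)
    then obtain u v where "u * m + v * p = 1"
      using bezout_coefficients_fst_snd[of m p] coprime_imp_gcd_eq_1 by metis
    then have "qev (u * m + v * p) x = 1" by simp
    then have "qev v x * a = 1" using m(2) p by simp
    then have "inverse a = qev v x" by (metis inverse_unique mult.commute)
    then show ?thesis by simp
  qed
qed

section \<open>Conjugation homomorphisms\<close>

text \<open>The homomorphism \<rat>(x) to \<rat>(z) sending x to z. The choice of a representing
  polynomial is harmless for conjugate z: two representatives differ by a polynomial vanishing at x,
  hence at z.\<close>

definition conj_map :: "complex \<Rightarrow> complex \<Rightarrow> complex \<Rightarrow> complex" where
  "conj_map x z = (\<lambda>y. qev (SOME p. y = qev p x) z)"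

lemma conj_map_qev:
  assumes "z \<in> conjugates x" shows "conj_map x z (qev p x) = qev p z"
proof -
  define q where "q = (SOME q. qev p x = qev q x)"
  have "qev p x = qev q x" unfolding q_def by (rule someI) simp
  then have "qev (p - q) x = 0" by simp
  then have "qev (p - q) z = 0" using assms unfolding conjugates_def by blast
  then show ?thesis by (simp add: conj_map_def q_def)
qed

text \<open>A unital ring homomorphism from F into the complex numbers, with no condition outside F;
  extensionality is added only where embeddings are counted.\<close>

definition chom :: "complex set \<Rightarrow> (complex \<Rightarrow> complex) \<Rightarrow> bool" where
  "chom F \<sigma> \<longleftrightarrow> \<sigma> 1 = 1 \<and> (\<forall>x\<in>F. \<forall>y\<in>F. \<sigma> (x + y) = \<sigma> x + \<sigma> y \<and> \<sigma> (x * y) = \<sigma> x * \<sigma> y)"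

lemma chom_conj_map:
  assumes "z \<in> conjugates x" shows "chom (simple_ext x) (conj_map x z)"
  unfolding chom_def
proof (intro conjI ballI)
  show "conj_map x z 1 = 1" using conj_map_qev[OF assms, of 1] by simp
  fix a b assume "a \<in> simple_ext x" "b \<in> simple_ext x"
  then obtain p q where "a = qev p x" "b = qev q x" by (auto simp: simple_ext_def)
  then show "conj_map x z (a + b) = conj_map x z a + conj_map x z b"
    "conj_map x z (a * b) = conj_map x z a * conj_map x z b"
    using conj_map_qev[OF assms, of "p + q"] conj_map_qev[OF assms, of "p * q"]
    by (simp_all add: conj_map_qev[OF assms])
qed

lemma chomD:
  assumes F: "csubfield F" and \<sigma>: "chom F \<sigma>"
  shows "\<sigma> 1 = 1" "\<sigma> 0 = 0" "x \<in> F \<Longrightarrow> y \<in> F \<Longrightarrow> \<sigma> (x + y) = \<sigma> x + \<sigma> y"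
    "x \<in> F \<Longrightarrow> y \<in> F \<Longrightarrow> \<sigma> (x - y) = \<sigma> x - \<sigma> y"
    "x \<in> F \<Longrightarrow> y \<in> F \<Longrightarrow> \<sigma> (x * y) = \<sigma> x * \<sigma> y" "x \<in> F \<Longrightarrow> \<sigma> (- x) = - \<sigma> x"
    "x \<in> F \<Longrightarrow> \<sigma> (inverse x) = inverse (\<sigma> x)" "x \<in> F \<Longrightarrow> y \<in> F \<Longrightarrow> \<sigma> (x / y) = \<sigma> x / \<sigma> y"
    "inj_on \<sigma> F"
proof -
  note F' = csubfieldD[OF F]
  note * = \<sigma>[unfolded chom_def]
  show 1: "\<sigma> 1 = 1" using * by blast
  show add: "\<sigma> (x + y) = \<sigma> x + \<sigma> y" if "x \<in> F" "y \<in> F" for x y using * that by blast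
  show mult: "\<sigma> (x * y) = \<sigma> x * \<sigma> y" if "x \<in> F" "y \<in> F" for x y using * that by blast
  show 0: "\<sigma> 0 = 0" using add[of 0 0] F' by simp
  show minus: "\<sigma> (- x) = - \<sigma> x" if "x \<in> F" for x
    using add[of x "- x"] F' that 0 by (simp add: add_eq_0_iff2)
  show diff: "\<sigma> (x - y) = \<sigma> x - \<sigma> y" if "x \<in> F" "y \<in> F" for x y
    using add[of x "- y"] minus[of y] F' that by simp
  show inv: "\<sigma> (inverse x) = inverse (\<sigma> x)" if "x \<in> F" for x
  proof (cases "x = 0")
    case False
    then have "\<sigma> x * \<sigma> (inverse x) = 1" using mult[of x "inverse x"] F' that 1 by simp
    then show ?thesis by (metis inverse_unique)
  qed (simp add: 0)
  show "\<sigma> (x / y) = \<sigma> x / \<sigma> y" if "x \<in> F" "y \<in> F"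
    using mult[of x "inverse y"] inv[of y] F' that by (simp add: divide_inverse)
  show "inj_on \<sigma> F"
  proof (rule inj_onI)
    fix x y assume xy: "x \<in> F" "y \<in> F" "\<sigma> x = \<sigma> y"
    show "x = y"
    proof (rule ccontr)
      assume "x \<noteq> y"
      then have "(x - y) * inverse (x - y) = 1" by simp
      then have "\<sigma> (x - y) * \<sigma> (inverse (x - y)) = 1"
        using mult[of "x - y" "inverse (x - y)"] F' xy 1 by simp
      then show False using diff xy by simp
    qed
  qed
qed

lemma chom_of_rat:
  assumes F: "csubfield F" and \<sigma>: "chom F \<sigma>" shows "\<sigma> (of_rat r) = of_rat r"
proof -
  have nat: "\<sigma> (of_nat n) = of_nat n" for n
    by (induction n) (auto simp: chomD[OF F \<sigma>] csubfield_of_nat[OF F] csubfieldD[OF F])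
  have int: "\<sigma> (of_int k) = of_int k" for k
    using nat csubfield_of_nat[OF F]
    by (cases k rule: int_cases2) (auto simp: chomD[OF F \<sigma>])
  have "\<sigma> (of_rat (of_int a / of_int b)) = of_rat (of_int a / of_int b)" for a b
    using chomD(8)[OF F \<sigma>] csubfield_of_rat[OF F] int by (metis of_rat_divide of_rat_of_int_eq)
  then show ?thesis by (metis Fract_of_int_quotient Rat_cases)
qed

lemma chom_qev:
  assumes F: "csubfield F" and \<sigma>: "chom F \<sigma>" and "x \<in> F" shows "\<sigma> (qev p x) = qev p (\<sigma> x)"
  by (induction p)
     (auto simp: chomD[OF F \<sigma>] chom_of_rat[OF F \<sigma>] csubfield_of_rat[OF F] csubfieldD[OF F] csubfield_qev[OF F] assms(3))

lemma chom_sum: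
  assumes F: "csubfield F" and \<sigma>: "chom F \<sigma>" and "\<And>i. i \<in> I \<Longrightarrow> f i \<in> F"
  shows "\<sigma> (sum f I) = (\<Sum>i\<in>I. \<sigma> (f i))"
  using assms(3)
  by (induction I rule: infinite_finite_induct)
     (auto simp: chomD[OF F \<sigma>] csubfield_sum[OF F])

lemma chom_conjugate:
  assumes F: "csubfield F" and \<sigma>: "chom F \<sigma>" and "x \<in> F" shows "\<sigma> x \<in> conjugates x"
  using chom_qev[OF assms] chomD(2)[OF F \<sigma>] by (auto simp: conjugates_def) metis

text \<open>The core of the Galois theory used here. Write y = p(x) with p of smaller degree than
  the minimal polynomial m. Then p - y vanishes at all conjugates of x, which are
  \<open>degree m\<close> in number, so it is zero and y is the constant coefficient of p.\<close>

lemma simple_ext_fixed: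
  assumes "algebraic x" "y \<in> simple_ext x" "\<And>z. z \<in> conjugates x \<Longrightarrow> conj_map x z y = y"
  shows "y \<in> \<rat>"
proof -
  obtain m where m: "Factorial_Ring.irreducible m" "qev m x = 0" using minimal_polynomial[OF assms(1)] by blast
  obtain p0 where p0: "y = qev p0 x" using assms(2) by (auto simp: simple_ext_def)
  define p where "p = p0 mod m"
  have "p0 = p0 div m * m + p" by (simp add: p_def)
  then have "qev p0 x = qev (p0 div m * m + p) x" by simp
  then have p: "y = qev p x" using m(2) p0 by simp
  have m0: "m \<noteq> 0" "degree m > 0"
    using m by (metis not_irreducible_zero, metis irreducible_not_unit is_unit_iff_degree not_gr_zero not_irreducible_zero)
  have deg: "degree p < degree m"
    using m0 degree_mod_less[of m p0] by (auto simp: p_def)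
  define P where "P = map_poly of_rat p - [:y:]"
  have "poly P z = 0" if "qev m z = 0" for z
    using assms(3)[of z] conj_map_qev[of z x p] that conjugates_eq_roots[OF m] p
    by (auto simp: P_def qev_def)
  then have sub: "{z. qev m z = 0} \<subseteq> {z. poly P z = 0}" by auto
  have "P = 0"
  proof (rule ccontr)
    assume "P \<noteq> 0"
    then have "degree m \<le> degree P"
      using card_mono[OF poly_roots_finite sub] card_roots_irreducible[OF m(1)] card_poly_roots_bound[of P]
      by simp
    also have "\<dots> \<le> max (degree p) 0" unfolding P_def
      by (metis degree_diff_le_max degree_pCons_0 of_rat_hom.degree_map_poly_hom)
    finally show False using deg by simp
  qed
  then have "coeff (map_poly of_rat p) 0 = coeff [:y:] 0" by (simp add: P_def)
  then have "of_rat (coeff p 0) = y" by (simp add: coeff_map_poly)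
  then show ?thesis using Rats_of_rat by metis
qed

section \<open>Primitive elements and normal extensions\<close>

definition poly_over :: "complex set \<Rightarrow> complex poly \<Rightarrow> bool" where
  "poly_over F p \<longleftrightarrow> (\<forall>i. coeff p i \<in> F)"

lemma poly_over_closed:
  assumes F: "csubfield F"
  shows "poly_over F 0" "a \<in> F \<Longrightarrow> poly_over F p \<Longrightarrow> poly_over F (pCons a p)"
    "poly_over F p \<Longrightarrow> poly_over F q \<Longrightarrow> poly_over F (p + q)"
    "poly_over F p \<Longrightarrow> poly_over F q \<Longrightarrow> poly_over F (p - q)"
    "poly_over F p \<Longrightarrow> poly_over F q \<Longrightarrow> poly_over F (p * q)"
    "a \<in> F \<Longrightarrow> poly_over F p \<Longrightarrow> poly_over F (smult a p)"
    "a \<in> F \<Longrightarrow> poly_over F (monom a n)"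
    "poly_over F (map_poly of_rat r)"
  using csubfieldD[OF F] csubfield_of_rat[OF F]
  by (auto simp: poly_over_def coeff_pCons coeff_mult coeff_map_poly split: nat.splits
      intro!: csubfield_sum[OF F])

lemma poly_over_pcompose:
  assumes F: "csubfield F" and "poly_over F p" "poly_over F q"
  shows "poly_over F (pcompose p q)"
  using assms(2)
proof (induction p)
  case (pCons a p)
  then have "coeff (pCons a p) 0 \<in> F" "\<And>i. coeff (pCons a p) (Suc i) \<in> F"
    unfolding poly_over_def by blast+
  then have "a \<in> F" "poly_over F p" by (auto simp: poly_over_def)
  then show ?case
    using pCons.IH assms(3) by (auto simp: pcompose_pCons intro!: poly_over_closed[OF F])
qed (simp add: poly_over_closed[OF F])

text \<open>Long division by the monic h: cancelling the leading term with a monomial multiple of h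
  keeps the coefficients in F and the root b. By minimality no nonzero polynomial of degree below
  that of h survives.\<close>

lemma minimal_poly_over_dvd:
  assumes F: "csubfield F" and h: "poly_over F h" "lead_coeff h = 1" "poly h b = 0"
    and min: "\<And>g. poly_over F g \<Longrightarrow> poly g b = 0 \<Longrightarrow> g \<noteq> 0 \<Longrightarrow> degree h \<le> degree g"
    and g: "poly_over F g" "poly g b = 0"
  shows "h dvd g"
  using g
proof (induction "degree g" arbitrary: g rule: less_induct)
  case less
  show ?case
  proof (cases "g = 0")
    case False
    with min less.prems have le: "degree h \<le> degree g" by blast
    define m where "m = monom (lead_coeff g) (degree g - degree h)"
    define g' where "g' = g - m * h"
    have over: "poly_over F g'"
      unfolding g'_def m_def using less.prems(1) h(1)
      by (intro poly_over_closed[OF F]) (auto simp: poly_over_def)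
    have root: "poly g' b = 0" using less.prems(2) h(3) by (simp add: g'_def)
    have "degree (m * h) \<le> degree g"
      using degree_mult_le[of m h] degree_monom_le[of "lead_coeff g" "degree g - degree h"] le
      unfolding m_def by linarith
    then have "degree g' \<le> degree g" by (simp add: g'_def degree_diff_le)
    moreover have "coeff g' (degree g) = 0"
      using h(2) le by (simp add: g'_def m_def coeff_monom_mult)
    ultimately have "g' = 0 \<or> degree g' < degree g"
      by (rule eq_zero_or_degree_less)
    then have "h dvd g'" using less.hyps[OF _ over root] by auto
    then show ?thesis by (metis g'_def dvd_triv_right dvd_diffD1 dvd_add_left_iff diff_add_cancel dvd_add)
  qed simp
qed

text \<open>Both numbers are scaled to algebraic integers, where closure is known, and the result is
  scaled back.\<close>

lemma algebraic_add_times: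
  assumes "algebraic (x :: complex)" "algebraic y"
  shows "algebraic (x + y)" "algebraic (x * y)"
proof -
  have descale: "algebraic z" if "k \<noteq> 0" "algebraic_int (of_int k * z)" for k :: int and z :: complex
  proof -
    have "algebraic (of_int k * z)" using that(2) by blast
    then obtain p where p: "p \<noteq> 0" "qev p (of_int k * z) = 0" using algebraic_iff_qev by blast
    define q where "q = pcompose p [:0, of_int k:]"
    have "qev q z = 0"
      using p(2) by (simp add: q_def qev_def of_rat_hom.map_poly_pcompose poly_pcompose hom_distribs mult.commute)
    moreover have "q \<noteq> 0"
      using p(1) that(1) pcompose_eq_0[of p "[:0, of_int k:]"] by (auto simp: q_def)
    ultimately show ?thesis using algebraic_iff_qev by blast
  qed
  obtain k l :: int where k: "k \<noteq> 0" "algebraic_int (of_int k * x)" and l: "l \<noteq> 0" "algebraic_int (of_int l * y)"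
    using algebraic_imp_int_multiple assms by metis
  have "algebraic_int (of_int l * (of_int k * x) + of_int k * (of_int l * y))"
    "algebraic_int (of_int k * x * (of_int l * y))"
    using algebraic_int_plus_times(1)[OF algebraic_int_plus_times(2)[OF algebraic_int_of_int k(2)]
        algebraic_int_plus_times(2)[OF algebraic_int_of_int l(2)]]
      algebraic_int_plus_times(2)[OF k(2) l(2)] .
  moreover have "of_int l * (of_int k * x) + of_int k * (of_int l * y) = of_int (k * l) * (x + y)"
    "of_int k * x * (of_int l * y) = of_int (k * l) * (x * y)"
    by (simp_all add: algebra_simps)
  ultimately show "algebraic (x + y)" "algebraic (x * y)"
    using descale[of "k * l"] k(1) l(1) by auto
qed

lemma algebraic_of_nat: "algebraic (of_nat n :: complex)"
  using algebraic_int_of_int[of "int n"] by auto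

text \<open>The classical argument: over \<rat>(\<theta>) the minimal polynomial h of b divides both
  q and p(\<theta> - t X). For all but finitely many t their only common root is b, and q has simple
  roots, so h = X - b and b lies in \<rat>(\<theta>).\<close>

lemma primitive_element:
  assumes a: "algebraic a" and b: "algebraic b"
  obtains t :: nat where "a \<in> simple_ext (a + of_nat t * b)" "b \<in> simple_ext (a + of_nat t * b)"
proof -
  obtain p where p: "Factorial_Ring.irreducible p" "qev p a = 0" using minimal_polynomial[OF a] by blast
  obtain q where q: "Factorial_Ring.irreducible q" "qev q b = 0" using minimal_polynomial[OF b] by blast
  \<comment> \<open>The slopes to avoid: for b' different from b, a + t b = a' + t b' holds exactly
    when t is this quotient.\<close>
  define f where "f = (\<lambda>(a', b'). (a' - a) / (b - b'))"
  have "finite (f ` (conjugates a \<times> conjugates b))"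
    using finite_conjugates a b by simp
  then have "finite ((of_nat :: nat \<Rightarrow> complex) -` (f ` (conjugates a \<times> conjugates b)))"
    by (rule finite_vimageI) (simp add: inj_on_def)
  then obtain t :: nat where t: "of_nat t \<notin> f ` (conjugates a \<times> conjugates b)"
    using ex_new_if_finite[OF infinite_UNIV_nat] by (metis vimage_eq)
  define \<theta> where "\<theta> = a + of_nat t * b"
  define F where "F = simple_ext \<theta>"
  have "algebraic \<theta>" unfolding \<theta>_def by (intro algebraic_add_times a b algebraic_of_nat)
  then have F: "csubfield F" unfolding F_def by (rule csubfield_simple_ext)
  have \<theta>F: "\<theta> \<in> F" by (simp add: F_def)
  have tF: "of_nat t \<in> F" by (rule csubfield_of_nat[OF F])
  define G1 where "G1 = (map_poly of_rat q :: complex poly)"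
  define G2 where "G2 = pcompose (map_poly of_rat p) [:\<theta>, - of_nat t:]"
  have G1: "poly_over F G1" "poly G1 b = 0" "G1 \<noteq> 0"
    using q poly_over_closed(8)[OF F] by (auto simp: G1_def qev_def)
  have G2: "poly_over F G2"
    unfolding G2_def using \<theta>F tF csubfieldD(6)[OF F]
    by (intro poly_over_pcompose[OF F] poly_over_closed[OF F]) auto
  have G2b: "poly G2 b = 0"
    using p(2) by (simp add: G2_def poly_pcompose qev_def \<theta>_def algebra_simps)
  define P where "P = (\<lambda>n. \<exists>g. poly_over F g \<and> poly g b = 0 \<and> g \<noteq> 0 \<and> degree g = n)"
  have "P (degree G1)" using G1 unfolding P_def by blast
  then have "P (LEAST n. P n)" by (rule LeastI)
  then obtain g where g: "poly_over F g" "poly g b = 0" "g \<noteq> 0" "degree g = (LEAST n. P n)"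
    unfolding P_def by blast
  define h where "h = smult (inverse (lead_coeff g)) g"
  have "lead_coeff g \<in> F" using g(1) by (simp add: poly_over_def)
  then have h: "poly_over F h" "lead_coeff h = 1" "poly h b = 0"
    using g(1-3) csubfieldD(7)[OF F \<open>lead_coeff g \<in> F\<close>]
    by (auto simp: h_def intro: poly_over_closed[OF F])
  have deg_h: "degree h = (LEAST n. P n)"
    using g(3) by (simp add: h_def flip: g(4))
  have min: "degree h \<le> degree k" if "poly_over F k" "poly k b = 0" "k \<noteq> 0" for k
    unfolding deg_h by (rule Least_le) (use that in \<open>auto simp: P_def\<close>)
  have dvd1: "h dvd G1" by (rule minimal_poly_over_dvd[OF F h(1-3) min G1(1,2)])
  have dvd2: "h dvd G2" by (rule minimal_poly_over_dvd[OF F h(1-3) min G2 G2b])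
  have only_root: "c = b" if "poly h c = 0" for c
  proof (rule ccontr)
    assume "c \<noteq> b"
    have "poly G1 c = 0" "poly G2 c = 0" using dvd1 dvd2 that by (auto simp: dvd_def)
    then have "c \<in> conjugates b" "\<theta> - of_nat t * c \<in> conjugates a"
      using conjugates_eq_roots[OF p] conjugates_eq_roots[OF q]
      by (auto simp: G1_def G2_def qev_def poly_pcompose algebra_simps)
    moreover have "f (\<theta> - of_nat t * c, c) = of_nat t"
      using \<open>c \<noteq> b\<close> by (simp add: f_def \<theta>_def field_simps)
    ultimately show False using t by (metis SigmaI image_eqI)
  qed
  have h0: "h \<noteq> 0" using h(2) by auto
  obtain h1 where h1: "h = [:-b, 1:] * h1" using h(3) poly_eq_0_iff_dvd by (auto simp: dvd_def)
  have "h1 \<noteq> 0" using h1 h0 by auto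
  \<comment> \<open>A further linear factor of h could only be X - b again, and b would then be a
    double root of \<open>G1\<close>.\<close>
  have "degree h1 = 0"
  proof (rule ccontr)
    assume "degree h1 \<noteq> 0"
    then have "\<not> constant (poly h1)" by (simp add: constant_degree)
    then obtain c where c: "poly h1 c = 0" using fundamental_theorem_of_algebra by blast
    then have "c = b" using only_root h1 by simp
    then obtain h2 where h2: "h1 = [:-b, 1:] * h2" using c poly_eq_0_iff_dvd by (auto simp: dvd_def)
    obtain k where "G1 = h * k" using dvd1 by (auto simp: dvd_def)
    then have G1_eq: "G1 = [:-b, 1:] * ([:-b, 1:] * h2 * k)" by (simp add: h1 h2 mult_ac)
    have "poly (pderiv G1) b = 0" unfolding G1_eq pderiv_mult by simp
    moreover have "rsquarefree G1" unfolding G1_def by (rule rsquarefree_irreducible[OF q(1)])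
    ultimately show False using G1(2) unfolding rsquarefree_roots by blast
  qed
  then obtain c where "h1 = [:c:]" by (rule degree_eq_zeroE)
  then have "h = [:- b, 1:]" using h1 h(2) by (cases "c = 0") auto
  then have "coeff h 0 = - b" by simp
  then have "- b \<in> F" using h(1) unfolding poly_over_def by metis
  then have bF: "b \<in> F" using csubfieldD(6)[OF F] by fastforce
  have "\<theta> - of_nat t * b \<in> F" using bF \<theta>F tF csubfieldD[OF F] by blast
  then have "a \<in> F" by (simp add: \<theta>_def)
  with bF show ?thesis using that unfolding F_def \<theta>_def by blast
qed

text \<open>The last conclusion says that \<theta> adds nothing: \<open>simple_ext \<theta>\<close>
  is the subfield generated by R, which is what later identifies it with a Galois closure.\<close>

lemma primitive_element_finite:
  assumes "finite R" "\<And>r. r \<in> R \<Longrightarrow> algebraic r"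
  obtains \<theta> where "algebraic \<theta>" "R \<subseteq> simple_ext \<theta>" "\<And>F. csubfield F \<Longrightarrow> R \<subseteq> F \<Longrightarrow> \<theta> \<in> F"
proof -
  have "\<exists>\<theta>. algebraic \<theta> \<and> R \<subseteq> simple_ext \<theta> \<and> (\<forall>F. csubfield F \<longrightarrow> R \<subseteq> F \<longrightarrow> \<theta> \<in> F)"
    using assms
  proof (induction R rule: finite_induct)
    case empty
    then show ?case by (intro exI[of _ 0]) (auto intro: csubfieldD)
  next
    case (insert r R)
    then obtain \<theta> where \<theta>: "algebraic \<theta>" "R \<subseteq> simple_ext \<theta>"
      "\<And>F. csubfield F \<Longrightarrow> R \<subseteq> F \<Longrightarrow> \<theta> \<in> F" by auto
    obtain t :: nat where t: "\<theta> \<in> simple_ext (\<theta> + of_nat t * r)" "r \<in> simple_ext (\<theta> + of_nat t * r)"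
      using primitive_element[OF \<theta>(1)] insert.prems by blast
    have alg: "algebraic (\<theta> + of_nat t * r)"
      using insert.prems by (intro algebraic_add_times \<theta>(1) algebraic_of_nat) auto
    have "simple_ext \<theta> \<subseteq> simple_ext (\<theta> + of_nat t * r)"
      using simple_ext_subset[OF csubfield_simple_ext[OF alg] t(1)] .
    then have "insert r R \<subseteq> simple_ext (\<theta> + of_nat t * r)" using t(2) \<theta>(2) by auto
    moreover have "\<theta> + of_nat t * r \<in> F" if "csubfield F" "insert r R \<subseteq> F" for F
      using that \<theta>(3)[of F] csubfield_of_nat[of F] by (auto intro!: csubfieldD)
    ultimately show ?case using alg by blast
  qed
  then show ?thesis using that by blast
qed

lemma conj_map_self:
  assumes "z \<in> conjugates x" shows "conj_map x z x = z"
  using conj_map_qev[OF assms, of "[:0, 1:]"] by simp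

text \<open>For a substitution map of \<theta>, the elements whose image stays in the field form a
  subfield. It contains the conjugates of x, since these are permuted, and therefore
  \<theta>.\<close>

lemma splitting_field_conjugates:
  assumes x: "algebraic x" and \<theta>: "algebraic \<theta>" "conjugates x \<subseteq> simple_ext \<theta>"
    "\<And>F. csubfield F \<Longrightarrow> conjugates x \<subseteq> F \<Longrightarrow> \<theta> \<in> F"
  shows "conjugates \<theta> \<subseteq> simple_ext \<theta>"
proof
  fix z assume z: "z \<in> conjugates \<theta>"
  define \<sigma> where "\<sigma> = conj_map \<theta> z"
  note F = csubfield_simple_ext[OF \<theta>(1)]
  have \<sigma>: "chom (simple_ext \<theta>) \<sigma>" unfolding \<sigma>_def by (rule chom_conj_map[OF z])
  define E where "E = {y \<in> simple_ext \<theta>. \<sigma> y \<in> simple_ext \<theta>}"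
  have "csubfield E"
    unfolding csubfield_def E_def using csubfieldD[OF F] chomD[OF F \<sigma>] by auto
  moreover have "conjugates x \<subseteq> E"
  proof
    fix r assume r: "r \<in> conjugates x"
    have "\<sigma> r \<in> conjugates r" by (rule chom_conjugate[OF F \<sigma>]) (use r \<theta>(2) in auto)
    then show "r \<in> E" using conjugates_eq[OF x r] \<theta>(2) r by (auto simp: E_def)
  qed
  ultimately have "\<theta> \<in> E" by (rule \<theta>(3))
  then show "z \<in> simple_ext \<theta>" by (simp add: E_def \<sigma>_def conj_map_self[OF z])
qed

lemma chom_coeff_prod_roots:
  assumes F: "csubfield F" and \<sigma>: "chom F \<sigma>" and "finite S" "S \<subseteq> F"
  shows "coeff (\<Prod>s\<in>S. [:- s, 1:]) i \<in> F \<and>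
    \<sigma> (coeff (\<Prod>s\<in>S. [:- s, 1:]) i) = coeff (\<Prod>s\<in>S. [:- \<sigma> s, 1:]) i"
  using assms(3,4)
proof (induction S arbitrary: i rule: finite_induct)
  case empty
  then show ?case by (cases i) (auto simp: csubfieldD[OF F] chomD[OF F \<sigma>])
next
  case (insert s S)
  then show ?case
    by (cases i) (auto simp: chomD[OF F \<sigma>] csubfieldD[OF F])
qed

text \<open>Writing y = g(\<theta>), the product of X - s over the distinct values s = g(z), z
  conjugate to \<theta>, is invariant under all substitution maps. So it has rational coefficients,
  and every conjugate of y is one of its roots.\<close>

lemma normal_simple_ext:
  assumes \<theta>: "algebraic \<theta>" "conjugates \<theta> \<subseteq> simple_ext \<theta>" and y: "y \<in> simple_ext \<theta>"
  shows "conjugates y \<subseteq> simple_ext \<theta>"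
proof -
  note F = csubfield_simple_ext[OF \<theta>(1)]
  obtain g where g: "y = qev g \<theta>" using y by (auto simp: simple_ext_def)
  define S where "S = (\<lambda>z. qev g z) ` conjugates \<theta>"
  have S: "finite S" "S \<subseteq> simple_ext \<theta>"
    using finite_conjugates[OF \<theta>(1)] \<theta>(2) csubfield_qev[OF F] by (auto simp: S_def)
  define P where "P = (\<Prod>s\<in>S. [:- s, 1:])"
  have "coeff P i \<in> \<rat>" for i
  proof (rule simple_ext_fixed[OF \<theta>(1)])
    fix w assume w: "w \<in> conjugates \<theta>"
    note \<sigma> = chom_conj_map[OF w]
    have inj: "inj_on (conj_map \<theta> w) S" using chomD(9)[OF F \<sigma>] S(2) by (rule inj_on_subset)
    have "conj_map \<theta> w ` S \<subseteq> S"
    proof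
      fix c assume "c \<in> conj_map \<theta> w ` S"
      then obtain z where z: "z \<in> conjugates \<theta>" "c = conj_map \<theta> w (qev g z)" by (auto simp: S_def)
      have "c = qev g (conj_map \<theta> w z)" using z \<theta>(2) by (auto simp: chom_qev[OF F \<sigma>])
      moreover have "conj_map \<theta> w z \<in> conjugates z" by (rule chom_conjugate[OF F \<sigma>]) (use z \<theta>(2) in auto)
      ultimately show "c \<in> S" using conjugates_eq[OF \<theta>(1) z(1)] by (auto simp: S_def)
    qed
    then have im: "conj_map \<theta> w ` S = S" using endo_inj_surj[OF S(1) _ inj] by blast
    have "conj_map \<theta> w (coeff P i) = coeff (\<Prod>s\<in>S. [:- conj_map \<theta> w s, 1:]) i"
      unfolding P_def using chom_coeff_prod_roots[OF F \<sigma> S] by blast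
    also have "(\<Prod>s\<in>S. [:- conj_map \<theta> w s, 1:]) = P"
      unfolding P_def using prod.reindex[OF inj, of "\<lambda>s. [:- s, 1:]"] im by simp
    finally show "conj_map \<theta> w (coeff P i) = coeff P i" .
  next
    show "coeff P i \<in> simple_ext \<theta>"
      unfolding P_def using chom_coeff_prod_roots[OF F chom_conj_map[OF self_conjugate] S] by blast
  qed
  define P0 where "P0 = map_poly (inv_into UNIV (of_rat :: rat \<Rightarrow> complex)) P"
  have "inv_into UNIV (of_rat :: rat \<Rightarrow> complex) 0 = 0"
    by (metis inv_f_f of_rat_0 inj_def of_rat_eq_iff)
  moreover have "of_rat (inv_into UNIV (of_rat :: rat \<Rightarrow> complex) c) = c" if "c \<in> \<rat>" for c
    using that by (simp add: Rats_def f_inv_into_f)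
  ultimately have P0: "map_poly of_rat P0 = P"
    using \<open>\<And>i. coeff P i \<in> \<rat>\<close> by (intro poly_eqI) (simp add: P0_def coeff_map_poly)
  have roots: "poly P c = 0 \<longleftrightarrow> c \<in> S" for c
    using S(1) by (auto simp: P_def poly_prod)
  have "y \<in> S" by (simp add: S_def g)
  then have "qev P0 y = 0" using roots by (simp add: qev_def P0)
  show ?thesis
  proof
    fix c assume "c \<in> conjugates y"
    then have "qev P0 c = 0" using \<open>qev P0 y = 0\<close> by (simp add: conjugates_def)
    then show "c \<in> simple_ext \<theta>" using roots S(2) by (auto simp: qev_def P0)
  qed
qed

section \<open>Number fields as rational vector spaces\<close>

abbreviation CR :: "complex ring" where "CR \<equiv> ring_of_type_algebra"

interpretation CR: cring CR
  by (rule cring_from_type_algebra)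

lemma CR_simps [simp]:
  "carrier CR = UNIV" "x \<otimes>\<^bsub>CR\<^esub> y = x * y" "x \<oplus>\<^bsub>CR\<^esub> y = x + y" "\<one>\<^bsub>CR\<^esub> = 1" "\<zero>\<^bsub>CR\<^esub> = 0"
  by (simp_all add: ring_of_type_algebra_def)

lemma CR_minus [simp]: "\<ominus>\<^bsub>CR\<^esub> x = - x"
  by (rule CR.minus_equality) auto

lemma CR_inverse: "x \<noteq> 0 \<Longrightarrow> inv\<^bsub>CR\<^esub> x = inverse x"
  by (rule CR.comm_inv_char) auto

lemma subfield_iff_csubfield: "subfield F CR \<longleftrightarrow> csubfield F"
proof
  assume F: "subfield F CR"
  note sub = subringE[OF subfieldE(1)[OF F]]
  have inv: "inverse x \<in> F" if "x \<in> F" for x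
    using CR.subfield_m_inv(1)[OF F, of x] that sub(2) CR_inverse[of x] by (cases "x = 0") auto
  have "x - y \<in> F" if "x \<in> F" "y \<in> F" for x y
    using sub(7)[OF that(1) sub(5)[OF that(2)]] by simp
  then show "csubfield F"
    using sub(3,6) inv unfolding csubfield_def by simp
next
  assume F: "csubfield F"
  show "subfield F CR"
  proof (rule field.subfieldI'[OF field_from_type_algebra])
    show "subring F CR"
      by (rule CR.subringI) (auto simp: csubfieldD[OF F])
    show "inv\<^bsub>CR\<^esub> k \<in> F" if "k \<in> F - {\<zero>\<^bsub>CR\<^esub>}" for k
      using that CR_inverse[of k] csubfieldD(7)[OF F] by simp
  qed
qed

lemma csubfield_Rats_self: "csubfield \<rat>"
  by (auto simp: csubfield_def)

lemma subfield_Rats: "subfield \<rat> CR"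
  by (simp add: subfield_iff_csubfield csubfield_Rats_self)

text \<open>\<open>number_field\<close> and \<open>field_degree\<close> are phrased with the
  record-based \<open>Span\<close>, \<open>independent\<close> and \<open>dimension\<close>. The
  next lemmas translate these to this vector space, where exchange arguments are carried
  out.\<close>

interpretation qv: Vector_Spaces.vector_space "\<lambda>(q::rat) (x::complex). of_rat q * x"
  by unfold_locales (auto simp: algebra_simps of_rat_add of_rat_mult)

lemma Span_Rats: "CR.Span \<rat> us = qv.span (set us)"
proof (induction us)
  case (Cons u us)
  have "CR.Span \<rat> (u # us) = {x. \<exists>k\<in>\<rat>. \<exists>v\<in>qv.span (set us). x = k * u + v}"
    by (simp add: set_eq_iff CR.line_extension_mem_iff flip: Cons)
  also have "\<dots> = qv.span (set (u # us))"
  proof -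
    have "(\<exists>k\<in>\<rat>. \<exists>v\<in>qv.span (set us). x = k * u + v) \<longleftrightarrow> (\<exists>k. x - of_rat k * u \<in> qv.span (set us))" for x
    proof
      assume "\<exists>k\<in>\<rat>. \<exists>v\<in>qv.span (set us). x = k * u + v"
      then obtain k v where k: "k \<in> \<rat>" "v \<in> qv.span (set us)" "x = k * u + v" by blast
      then obtain r where "k = of_rat r" by (auto elim: Rats_cases)
      then have "x - of_rat r * u = v" using k by simp
      then show "\<exists>k. x - of_rat k * u \<in> qv.span (set us)" using k(2) by metis
    next
      assume "\<exists>k. x - of_rat k * u \<in> qv.span (set us)"
      then obtain k where "x - of_rat k * u \<in> qv.span (set us)" by blast
      then show "\<exists>k\<in>\<rat>. \<exists>v\<in>qv.span (set us). x = k * u + v"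
        by (intro bexI[of _ "of_rat k"] bexI[of _ "x - of_rat k * u"]) auto
    qed
    then show ?thesis by (simp add: qv.span_insert)
  qed
  finally show ?case .
qed simp

lemma independent_Rats: "CR.independent \<rat> us \<longleftrightarrow> distinct us \<and> qv.independent (set us)"
proof (induction us)
  case (Cons u us)
  have "CR.independent \<rat> (u # us) \<longleftrightarrow> u \<notin> CR.Span \<rat> us \<and> CR.independent \<rat> us"
    using CR.independent_backwards[of \<rat> u us] CR.li_Cons[of u \<rat> us] by auto
  also have "\<dots> \<longleftrightarrow> distinct (u # us) \<and> qv.independent (set (u # us))"
    using qv.span_base[of u "set us"] unfolding Cons Span_Rats by (auto simp: qv.independent_insert)
  finally show ?case .
qed (simp add: qv.independent_empty)

lemma dimension_Rats_iff:
  "CR.dimension n \<rat> E \<longleftrightarrow> (\<exists>B. finite B \<and> card B = n \<and> qv.independent B \<and> qv.span B = E)"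
proof
  assume "CR.dimension n \<rat> E"
  then obtain us where "CR.independent \<rat> us" "length us = n" "CR.Span \<rat> us = E"
    using CR.exists_base[OF subfield_Rats] by blast
  then show "\<exists>B. finite B \<and> card B = n \<and> qv.independent B \<and> qv.span B = E"
    by (intro exI[of _ "set us"]) (auto simp: independent_Rats distinct_card simp flip: Span_Rats simp del: CR.Span.simps)
next
  assume "\<exists>B. finite B \<and> card B = n \<and> qv.independent B \<and> qv.span B = E"
  then obtain B where B: "finite B" "card B = n" "qv.independent B" "qv.span B = E" by blast
  obtain us where us: "set us = B" "distinct us" using finite_distinct_list[OF B(1)] by blast
  have "CR.dimension (length us) \<rat> E"
    by (rule CR.dimensionI[OF subfield_Rats]) (use B us in \<open>simp_all add: independent_Rats Span_Rats del: CR.Span.simps\<close>)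
  then show "CR.dimension n \<rat> E" using us B(2) distinct_card by metis
qed

lemma number_field_iff:
  "number_field K \<longleftrightarrow> csubfield K \<and> (\<exists>B. finite B \<and> qv.independent B \<and> qv.span B = K)"
  unfolding number_field_def subfield_iff_csubfield CR.finite_dimension_def dimension_Rats_iff by blast

lemma field_degree_eq:
  assumes "finite B" "qv.independent B" "qv.span B = K"
  shows "field_degree K = card B"
proof -
  have "CR.dimension (card B) \<rat> K" using assms by (auto simp: dimension_Rats_iff)
  then have "(CR.dim over \<rat>) K = card B" by (rule CR.dimI[OF subfield_Rats])
  then show ?thesis by (simp add: field_degree_def over_def)
qed

lemma powers_independent:
  assumes "\<And>p. p \<noteq> 0 \<Longrightarrow> degree p < n \<Longrightarrow> qev p x \<noteq> 0"
  shows "inj_on (\<lambda>i. x ^ i) {..<n}" "qv.independent ((\<lambda>i. x ^ i) ` {..<n})"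
proof -
  have qev_monom: "qev (monom a i) x = of_rat a * x ^ i" for a i
    by (simp add: qev_def poly_monom)
  show inj: "inj_on (\<lambda>i. x ^ i) {..<n}"
  proof (rule inj_onI, rule ccontr)
    fix i j assume ij: "i \<in> {..<n}" "j \<in> {..<n}" "x ^ i = x ^ j" "i \<noteq> j"
    let ?p = "monom 1 i - monom 1 j :: rat poly"
    have "coeff ?p i \<noteq> 0" using ij(4) by simp
    then have "?p \<noteq> 0" by (metis coeff_0)
    moreover have "degree ?p < n"
      using ij(1,2) degree_diff_le_max[of "monom (1::rat) i" "monom 1 j"]
      by (simp add: degree_monom_eq)
    moreover have "qev ?p x = 0" using ij(3) by (simp add: qev_monom)
    ultimately show False using assms by blast
  qed
  show "qv.independent ((\<lambda>i. x ^ i) ` {..<n})"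
  proof (rule ccontr)
    assume "\<not> ?thesis"
    then obtain u v where uv: "v \<in> (\<lambda>i. x ^ i) ` {..<n}" "u v \<noteq> 0"
      "(\<Sum>v\<in>(\<lambda>i. x ^ i) ` {..<n}. of_rat (u v) * v) = 0"
      using qv.dependent_finite[of "(\<lambda>i. x ^ i) ` {..<n}"] by auto
    let ?p = "\<Sum>i<n. monom (u (x ^ i)) i"
    have co: "coeff ?p j = (if j < n then u (x ^ j) else 0)" for j
      by (simp add: coeff_sum)
    have "qev ?p x = (\<Sum>i<n. of_rat (u (x ^ i)) * x ^ i)"
      by (simp add: qev_def rat_poly.hom_sum poly_sum poly_monom)
    also have "\<dots> = 0" using uv(3) by (simp add: sum.reindex[OF inj])
    finally have root: "qev ?p x = 0" .
    obtain j where j: "j < n" "v = x ^ j" using uv(1) by auto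
    then have "coeff ?p j \<noteq> 0" using co uv(2) by simp
    then have "?p \<noteq> 0" by (metis coeff_0)
    moreover have "degree ?p < n"
      using j(1) co by (intro le_less_trans[OF degree_le[of "n - 1"]]) auto
    ultimately show False using assms root by blast
  qed
qed

lemma span_powers:
  assumes "Factorial_Ring.irreducible m" "qev m x = 0"
  shows "qv.span ((\<lambda>i. x ^ i) ` {..<degree m}) = simple_ext x"
proof
  show "qv.span ((\<lambda>i. x ^ i) ` {..<degree m}) \<subseteq> simple_ext x"
  proof (rule qv.span_minimal)
    show "(\<lambda>i. x ^ i) ` {..<degree m} \<subseteq> simple_ext x"
      using qev_in_simple_ext[of "monom 1 _" x] by (auto simp: qev_def poly_monom)
    show "qv.subspace (simple_ext x)"
    proof (rule qv.subspaceI)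
      show "0 \<in> simple_ext x" using qev_in_simple_ext[of 0 x] by simp
      fix a b c assume "a \<in> simple_ext x"
      then obtain p where p: "a = qev p x" by (auto simp: simple_ext_def)
      then show "of_rat c * a \<in> simple_ext x" using qev_in_simple_ext[of "smult c p" x] by simp
      assume "b \<in> simple_ext x"
      then obtain q where "b = qev q x" by (auto simp: simple_ext_def)
      then show "a + b \<in> simple_ext x" using p qev_in_simple_ext[of "p + q" x] by simp
    qed
  qed
  have m0: "m \<noteq> 0" "degree m > 0"
    using assms by (metis not_irreducible_zero, metis irreducible_not_unit is_unit_iff_degree not_gr_zero not_irreducible_zero)
  show "simple_ext x \<subseteq> qv.span ((\<lambda>i. x ^ i) ` {..<degree m})"
  proof
    fix a assume "a \<in> simple_ext x"
    then obtain p where p: "a = qev p x" by (auto simp: simple_ext_def)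
    define r where "r = p mod m"
    have "p = p div m * m + r" by (simp add: r_def)
    then have "qev p x = qev (p div m * m + r) x" by simp
    then have a: "a = qev r x" using assms(2) p by simp
    have deg: "degree r < degree m"
      using m0 degree_mod_less[of m p] by (auto simp: r_def)
    have "a = (\<Sum>i\<le>degree r. of_rat (coeff r i) * x ^ i)"
      unfolding a qev_def poly_altdef by (simp add: coeff_map_poly)
    also have "\<dots> \<in> qv.span ((\<lambda>i. x ^ i) ` {..<degree m})"
      using deg by (intro qv.span_sum qv.span_scale qv.span_base) auto
    finally show "a \<in> qv.span ((\<lambda>i. x ^ i) ` {..<degree m})" .
  qed
qed

lemma simple_ext_basis:
  assumes "Factorial_Ring.irreducible m" "qev m x = 0"
  shows "qv.independent ((\<lambda>i. x ^ i) ` {..<degree m})" "card ((\<lambda>i. x ^ i) ` {..<degree m}) = degree m"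
proof -
  have *: "qev p x \<noteq> 0" if "p \<noteq> 0" "degree p < degree m" for p
    using irreducible_root_imp_dvd[OF assms, of p] dvd_imp_degree_le[of m p] that by auto
  show "qv.independent ((\<lambda>i. x ^ i) ` {..<degree m})" by (rule powers_independent(2)[OF *])
  show "card ((\<lambda>i. x ^ i) ` {..<degree m}) = degree m"
    using card_image[OF powers_independent(1)[OF *]] by simp
qed

lemma number_field_simple_ext: "algebraic x \<Longrightarrow> number_field (simple_ext x)"
  unfolding number_field_iff
  using csubfield_simple_ext simple_ext_basis(1) span_powers minimal_polynomial
  by (metis finite_imageI finite_lessThan)

lemma field_degree_simple_ext:
  assumes "Factorial_Ring.irreducible m" "qev m x = 0"
  shows "field_degree (simple_ext x) = degree m"
  using field_degree_eq[OF _ simple_ext_basis(1)[OF assms] span_powers[OF assms]] simple_ext_basis(2)[OF assms]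
  by simp

lemma number_field_algebraic:
  assumes "number_field K" "x \<in> K" shows "algebraic x"
proof (rule ccontr)
  assume "\<not> algebraic x"
  then have *: "qev p x \<noteq> 0" if "p \<noteq> 0" for p using that algebraic_iff_qev by blast
  obtain B where B: "finite B" "qv.independent B" "qv.span B = K" and K: "csubfield K"
    using assms(1) number_field_iff by blast
  have pow: "x ^ i \<in> K" for i
    by (induction i) (auto intro: csubfieldD[OF K] assms(2))
  let ?S = "(\<lambda>i. x ^ i) ` {..<Suc (card B)}"
  have "qv.independent ?S" by (rule powers_independent(2)) (use * in auto)
  moreover have "?S \<subseteq> qv.span B" using pow B(3) by auto
  ultimately have "card ?S \<le> card B" using qv.independent_span_bound[OF B(1)] by blast
  moreover have "card ?S = Suc (card B)"
    using card_image[OF powers_independent(1), of "Suc (card B)" x] * by simp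
  ultimately show False by simp
qed

lemma span_subset_if_card_le:
  assumes B: "finite B" and S: "qv.independent S" "S \<subseteq> qv.span B" "card B \<le> card S"
  shows "qv.span B \<subseteq> qv.span S"
proof -
  obtain S' where S': "S \<subseteq> S'" "S' \<subseteq> qv.span B" "qv.independent S'" "qv.span B \<subseteq> qv.span S'"
    using qv.maximal_independent_subset_extend[OF S(2,1)] by blast
  have "finite S'" "card S' \<le> card B"
    using qv.independent_span_bound[OF B S'(3,2)] by auto
  then have "S = S'" using S'(1) S(3) card_seteq[of S' S] by simp
  then show ?thesis using S'(4) by simp
qed

text \<open>By the tower law the degree of \<rat>(x) divides a prime, and it is not 1 because x is
  irrational. In degree 5 this lets irrationality stand in for being a generator.\<close>

lemma simple_ext_eq_if_prime_degree:
  assumes K: "number_field K" and p: "Factorial_Ring.prime (field_degree K)" and x: "x \<in> K" "x \<notin> \<rat>"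
  shows "K = simple_ext x"
proof -
  have alg: "algebraic x" by (rule number_field_algebraic[OF K x(1)])
  obtain m where m: "Factorial_Ring.irreducible m" "qev m x = 0" using minimal_polynomial[OF alg] by blast
  let ?F = "simple_ext x"
  obtain B where B: "finite B" "qv.independent B" "qv.span B = K" and cK: "csubfield K"
    using K number_field_iff by blast
  have F: "csubfield ?F" by (rule csubfield_simple_ext[OF alg])
  have sub: "?F \<subseteq> K" by (rule simple_ext_subset[OF cK x(1)])
  obtain us where us: "set us = B" "distinct us" using finite_distinct_list[OF B(1)] by blast
  \<comment> \<open>The tower law asks for K to be finite-dimensional over the intermediate field; a
    rational basis of K still spans K over it.\<close>
  have "CR.Span ?F us = K"
  proof
    have "subfield ?F CR" using F subfield_iff_csubfield by blast
    show "CR.Span ?F us \<subseteq> K"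
    proof
      fix v assume "v \<in> CR.Span ?F us"
      then obtain ks where ks: "set ks \<subseteq> ?F" "v = CR.combine ks us"
        using CR.Span_eq_combine_set[OF \<open>subfield ?F CR\<close>, of us] by auto
      have "CR.combine ks us \<in> K" if "set ks \<subseteq> K" "set us \<subseteq> K" for ks us
        using that by (induction ks us rule: CR.combine.induct) (auto intro!: csubfieldD[OF cK])
      moreover have "set us \<subseteq> K" using us(1) B(3) qv.span_superset by blast
      ultimately show "v \<in> K" using ks sub by blast
    qed
    have "CR.Span \<rat> us \<subseteq> CR.Span ?F us"
    proof
      fix v assume "v \<in> CR.Span \<rat> us"
      then obtain ks where ks: "set ks \<subseteq> \<rat>" "v = CR.combine ks us"
        using CR.Span_eq_combine_set[OF subfield_Rats, of us] by auto
      then have "set ks \<subseteq> ?F" using csubfield_Rats[OF F] by blast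
      then show "v \<in> CR.Span ?F us"
        using ks(2) CR.Span_eq_combine_set[OF \<open>subfield ?F CR\<close>, of us] by auto
    qed
    then show "K \<subseteq> CR.Span ?F us" using B(3) us(1) Span_Rats by metis
  qed
  moreover have sF: "subfield ?F CR" using F subfield_iff_csubfield by blast
  ultimately have fin: "CR.finite_dimension ?F K"
    using CR.Span_finite_dimension[of ?F us] by (metis CR_simps(1) subset_UNIV)
  have fin2: "CR.finite_dimension \<rat> ?F"
    using number_field_simple_ext[OF alg] by (simp add: number_field_def)
  have "field_degree K = field_degree ?F * (CR.dim over ?F) K"
    using CR.telescopic_base_dim(2)[OF subfield_Rats sF fin2 fin] by (simp add: field_degree_def over_def)
  then have "field_degree ?F dvd field_degree K" by simp
  then have "field_degree ?F = 1 \<or> field_degree ?F = field_degree K"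
    using p by (metis prime_nat_iff)
  moreover have "field_degree ?F \<noteq> 1"
  proof
    assume "field_degree ?F = 1"
    then have "degree m = 1" using field_degree_simple_ext[OF m] by simp
    then have "simple_ext x = qv.span {1}"
      using span_powers[OF m] by (simp add: lessThan_Suc)
    then have "x \<in> qv.span {1}" using simple_ext_self by metis
    then show False using x(2) by (auto simp: qv.span_singleton)
  qed
  ultimately have "card B = degree m"
    using field_degree_simple_ext[OF m] field_degree_eq[OF B] by simp
  let ?S = "(\<lambda>i. x ^ i) ` {..<degree m}"
  have S: "qv.independent ?S" "card ?S = card B" "?S \<subseteq> qv.span B"
    using simple_ext_basis[OF m] \<open>card B = degree m\<close> sub B(3) span_powers[OF m]
      qv.span_superset[of ?S] by auto
  then have "qv.span B \<subseteq> qv.span ?S"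
    by (intro span_subset_if_card_le B(1)) simp_all
  then show ?thesis using B(3) span_powers[OF m] sub by blast
qed

section \<open>Short vectors of positive definite quadratic forms\<close>

text \<open>Lagrange reduction (an LDL decomposition): completing the square in the last variable
  leaves a positive definite form in the others. The value of \<open>u (n - 1)\<close> is recorded
  because the last basis vector will be 1, whose squared length is the degree of the field.\<close>

lemma gram_decomposition:
  fixes g :: "nat \<Rightarrow> nat \<Rightarrow> real"
  assumes sym: "\<And>i j. g i j = g j i"
    and pos: "\<And>c. \<exists>i<n. c i \<noteq> 0 \<Longrightarrow> (\<Sum>i<n. \<Sum>j<n. g i j * c i * c j) > 0"
  shows "\<exists>u T. (\<forall>k<n. u k > 0 \<and> T k k = 1 \<and> (\<forall>j>k. T k j = 0)) \<and>
    (\<forall>i<n. \<forall>j<n. g i j = (\<Sum>k<n. u k * T k i * T k j)) \<and> (n > 0 \<longrightarrow> u (n - 1) = g (n - 1) (n - 1))"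
  using assms
proof (induction n arbitrary: g)
  case (Suc n)
  define a where "a = g n n"
  have "(\<Sum>i<Suc n. \<Sum>j<Suc n. g i j * of_bool (i = n) * of_bool (j = n)) > 0"
    by (rule Suc.prems(2)) (auto intro!: exI[of _ n])
  also have "(\<Sum>i<Suc n. \<Sum>j<Suc n. g i j * of_bool (i = n) * of_bool (j = n)) = a"
    by (simp add: a_def)
  finally have a: "a > 0" .
  define w where "w = (\<lambda>j. if j > n then 0 else g n j / a)"
  have wn: "w n = 1" using a by (simp add: w_def a_def)
  have aw: "a * w j = g n j" if "j \<le> n" for j using a that by (simp add: w_def)
  define g' where "g' = (\<lambda>i j. g i j - a * w i * w j)"
  have g'0: "g' n j = 0" "g' j n = 0" if "j \<le> n" for j
    using that aw[of j] wn Suc.prems(1)[of n j] by (auto simp: g'_def mult.commute mult.left_commute)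
  have expand: "(\<Sum>i<Suc n. \<Sum>j<Suc n. g i j * c i * c j) =
      (\<Sum>i<n. \<Sum>j<n. g' i j * c i * c j) + a * (\<Sum>i<Suc n. w i * c i)\<^sup>2" for c
  proof -
    have "(\<Sum>i<Suc n. \<Sum>j<Suc n. g i j * c i * c j) =
        (\<Sum>i<Suc n. \<Sum>j<Suc n. g' i j * c i * c j) + (\<Sum>i<Suc n. \<Sum>j<Suc n. a * ((w i * c i) * (w j * c j)))"
      unfolding sum.distrib[symmetric] by (intro sum.cong refl) (simp add: g'_def algebra_simps)
    also have "(\<Sum>i<Suc n. \<Sum>j<Suc n. g' i j * c i * c j) = (\<Sum>i<n. \<Sum>j<n. g' i j * c i * c j)"
      by (simp add: g'0)
    also have "(\<Sum>i<Suc n. \<Sum>j<Suc n. a * ((w i * c i) * (w j * c j))) = a * (\<Sum>i<Suc n. w i * c i)\<^sup>2"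
      unfolding power2_eq_square sum_product by (simp only: sum_distrib_left)
    finally show ?thesis .
  qed
  have g'pos: "(\<Sum>i<n. \<Sum>j<n. g' i j * c i * c j) > 0" if c: "\<exists>i<n. c i \<noteq> 0" for c
  proof -
    \<comment> \<open>This value of the last variable makes the completed square vanish, so
      positivity of g at c' is positivity of g' at c.\<close>
    define c' where "c' = c(n := - (\<Sum>i<n. w i * c i))"
    have "(\<Sum>i<Suc n. \<Sum>j<Suc n. g i j * c' i * c' j) > 0"
      by (rule Suc.prems(2)) (use c in \<open>auto simp: c'_def intro: less_SucI\<close>)
    moreover have "(\<Sum>i<Suc n. w i * c' i) = 0" by (simp add: c'_def wn)
    moreover have "(\<Sum>i<n. \<Sum>j<n. g' i j * c' i * c' j) = (\<Sum>i<n. \<Sum>j<n. g' i j * c i * c j)"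
      by (intro sum.cong refl) (auto simp: c'_def)
    ultimately show ?thesis using expand[of c'] by simp
  qed
  have g'sym: "g' i j = g' j i" for i j
    using Suc.prems(1)[of i j] by (simp add: g'_def mult_ac)
  obtain u T where *: "\<forall>k<n. u k > 0 \<and> T k k = 1 \<and> (\<forall>j>k. T k j = 0)"
    "\<forall>i<n. \<forall>j<n. g' i j = (\<Sum>k<n. u k * T k i * T k j)"
    using Suc.IH[of g', OF g'sym g'pos] by blast
  have uT: "\<And>k. k < n \<Longrightarrow> u k > 0 \<and> T k k = 1 \<and> (\<forall>j>k. T k j = 0)"
    "\<And>i j. i < n \<Longrightarrow> j < n \<Longrightarrow> g' i j = (\<Sum>k<n. u k * T k i * T k j)"
    using * by blast+
  define u' where "u' = u(n := a)"
  define T' where "T' = T(n := w)"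
  have "g i j = (\<Sum>k<Suc n. u' k * T' k i * T' k j)" if "i < Suc n" "j < Suc n" for i j
  proof -
    have "g' i j = (\<Sum>k<n. u k * T k i * T k j)"
    proof (cases "i = n \<or> j = n")
      case True
      then have "(\<Sum>k<n. u k * T k i * T k j) = 0" using uT(1) by (auto intro!: sum.neutral)
      then show ?thesis using True g'0[of j] g'0[of i] that by auto
    next
      case False
      then show ?thesis using uT(2) that by simp
    qed
    also have "\<dots> = (\<Sum>k<n. u' k * T' k i * T' k j)"
      by (intro sum.cong refl) (auto simp: u'_def T'_def)
    finally show ?thesis by (simp add: u'_def T'_def g'_def)
  qed
  moreover have "u' k > 0 \<and> T' k k = 1 \<and> (\<forall>j>k. T' k j = 0)" if "k < Suc n" for k
    using that uT(1)[of k] a wn by (cases "k = n") (auto simp: u'_def T'_def w_def)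
  moreover have "u' n = g n n" by (simp add: u'_def a_def)
  ultimately have "\<forall>k<Suc n. u' k > 0 \<and> T' k k = 1 \<and> (\<forall>j>k. T' k j = 0)"
    "\<forall>i<Suc n. \<forall>j<Suc n. g i j = (\<Sum>k<Suc n. u' k * T' k i * T' k j)"
    "Suc n > 0 \<longrightarrow> u' (Suc n - 1) = g (Suc n - 1) (Suc n - 1)"
    by (simp_all del: sum.lessThan_Suc)
  then show ?case by blast
qed auto

lemma det_gram_decomposition:
  fixes u :: "nat \<Rightarrow> real"
  assumes T: "\<And>k. k < n \<Longrightarrow> T k k = 1 \<and> (\<forall>j>k. T k j = 0)"
    and g: "\<And>i j. i < n \<Longrightarrow> j < n \<Longrightarrow> g i j = (\<Sum>k<n. u k * T k i * T k j)"
  shows "det (mat n n (\<lambda>(i, j). g i j)) = (\<Prod>k<n. u k)"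
proof -
  define U where "U = mat n n (\<lambda>(i, k). u k * T k i)"
  define L where "L = mat n n (\<lambda>(k, j). T k j)"
  have UL: "U \<in> carrier_mat n n" "L \<in> carrier_mat n n" by (simp_all add: U_def L_def)
  have "mat n n (\<lambda>(i, j). g i j) = U * L"
    by (rule eq_matI)
       (auto simp: U_def L_def scalar_prod_def g atLeast0LessThan intro!: sum.cong)
  then have "det (mat n n (\<lambda>(i, j). g i j)) = det U * det L"
    using det_mult[OF UL] by simp
  also have "det U = (\<Prod>k<n. u k)"
  proof -
    have "upper_triangular U" using T by (auto simp: U_def upper_triangular_def)
    then have "det U = prod_list (diag_mat U)" by (rule det_upper_triangular[OF _ UL(1)])
    also have "\<dots> = (\<Prod>k<n. u k)"
      using T by (simp add: prod_list_diag_prod atLeast0LessThan U_def)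
    finally show ?thesis .
  qed
  also have "det L = 1"
  proof -
    have "det L = prod_list (diag_mat L)"
      by (rule det_lower_triangular[OF _ UL(2)]) (use T in \<open>auto simp: L_def\<close>)
    also have "\<dots> = (\<Prod>k<n. T k k)" by (simp add: prod_list_diag_prod atLeast0LessThan L_def)
    also have "\<dots> = 1" using T by simp
    finally show ?thesis .
  qed
  finally show ?thesis by simp
qed

section \<open>Lattice points of triangular systems of linear forms\<close>

declare sum.cong [fundef_cong]

text \<open>Coordinates chosen one after another so that the i-th triangular form takes the value
  \<open>k i\<close> plus a fractional part in [0, 1). Different k therefore give different lattice
  points. The congruence rule declared above shows \<open>j < i\<close> to the termination
  proof.\<close>

fun tri_coord :: "(nat \<Rightarrow> nat \<Rightarrow> real) \<Rightarrow> (nat \<Rightarrow> nat) \<Rightarrow> nat \<Rightarrow> int" where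
  "tri_coord \<mu> k i = int (k i) - \<lfloor>\<Sum>j\<in>{..<i}. \<mu> i j * of_int (tri_coord \<mu> k j)\<rfloor>"

declare sum.cong [fundef_cong del] tri_coord.simps [simp del]

text \<open>The lattice points whose image lies in the cube \<open>[0, N t)\<^sup>n\<close> are counted coordinate by coordinate; for large \<open>N\<close>
  there are more of them than subcubes of side \<open>t\<close>.\<close>

lemma triangular_minkowski:
  fixes w :: "nat \<Rightarrow> real"
  assumes w: "\<And>i. i < n \<Longrightarrow> w i > 0" and t: "t > 0" and small: "(\<Prod>i<n. w i) < t ^ n"
  shows "\<exists>c :: nat \<Rightarrow> int. (\<exists>i<n. c i \<noteq> 0) \<and>
    (\<forall>i<n. \<bar>w i * (of_int (c i) + (\<Sum>j<i. \<mu> i j * of_int (c j)))\<bar> < t)"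
proof -
  \<comment> \<open>In the i-th direction about N t / w i values of \<open>k i\<close> fit into the
    cube. Since the product of the \<open>t / w i\<close> exceeds 1, rounding down, which costs at
    most 1/N in each factor after division by N, is harmless for large N.\<close>
  have "(\<lambda>N. \<Prod>i<n. (t / w i - 1 / real N)) \<longlonglongrightarrow> (\<Prod>i<n. (t / w i - 0))"
    by (intro tendsto_prod tendsto_diff tendsto_const lim_1_over_n)
  moreover have "(\<Prod>i<n. (t / w i - 0)) > 1"
    using small prod_pos[of "{..<n}" w] w by (simp add: prod_dividef)
  ultimately have ev1: "\<forall>\<^sub>F N in sequentially. (\<Prod>i<n. (t / w i - 1 / real N)) > 1"
    by (rule order_tendstoD(1))
  have ev2: "\<forall>\<^sub>F N in sequentially. t / w i - 1 / real N > 0" if "i < n" for i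
  proof (rule order_tendstoD(1))
    show "(\<lambda>N. t / w i - 1 / real N) \<longlonglongrightarrow> t / w i - 0"
      by (intro tendsto_diff tendsto_const lim_1_over_n)
  qed (use w t that in simp)
  have "\<forall>\<^sub>F N in sequentially. \<forall>i\<in>{..<n}. t / w i - 1 / real N > 0"
    by (rule eventually_ball_finite) (use ev2 in auto)
  then have "\<forall>\<^sub>F N in sequentially. (\<Prod>i<n. (t / w i - 1 / real N)) > 1 \<and>
      (\<forall>i\<in>{..<n}. t / w i - 1 / real N > 0) \<and> N > 0"
    using ev1 eventually_gt_at_top[of 0] by eventually_elim auto
  then obtain N where N: "(\<Prod>i<n. (t / w i - 1 / real N)) > 1"
      "\<And>i. i < n \<Longrightarrow> t / w i - 1 / real N > 0" "N > 0"
    using eventually_happens'[OF sequentially_bot] by (metis (no_types, lifting) lessThan_iff)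
  define m where "m = (\<lambda>i. nat \<lfloor>real N * t / w i\<rfloor>)"
  have m_le: "real (m i) \<le> real N * t / w i" if "i < n" for i
    using w[OF that] t by (simp add: m_def)
  have m_ge: "real (m i) \<ge> real N * (t / w i - 1 / real N)" if "i < n" for i
  proof -
    have "real N * t / w i - 1 \<le> of_int \<lfloor>real N * t / w i\<rfloor>" by linarith
    also have "\<dots> = real (m i)" using w[OF that] t by (simp add: m_def)
    finally show ?thesis using N(3) by (simp add: algebra_simps)
  qed
  have "real (N ^ n) < real N ^ n * (\<Prod>i<n. (t / w i - 1 / real N))"
    using N(1,3) by simp
  also have "\<dots> = (\<Prod>i<n. real N * (t / w i - 1 / real N))"
    by (simp add: prod.distrib)
  also have "\<dots> \<le> (\<Prod>i<n. real (m i))"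
    by (rule prod_mono) (use m_ge N(2,3) in \<open>auto intro!: mult_nonneg_nonneg less_imp_le\<close>)
  finally have card_less: "N ^ n < (\<Prod>i<n. m i)"
    by (simp flip: of_nat_prod of_nat_power)
  define y where "y = (\<lambda>k i. w i * (of_int (tri_coord \<mu> k i) + (\<Sum>j<i. \<mu> i j * of_int (tri_coord \<mu> k j))))"
  have y_eq: "y k i = w i * (real (k i) + frac (\<Sum>j<i. \<mu> i j * of_int (tri_coord \<mu> k j)))" for k i
    unfolding y_def frac_def by (subst tri_coord.simps) simp
  define D where "D = PiE {..<n} (\<lambda>i. {..<m i})"
  define F where "F = (\<lambda>k. \<lambda>i\<in>{..<n}. nat \<lfloor>y k i / t\<rfloor>)"
  have y_bounds: "0 \<le> y k i" "y k i < real N * t" if k: "k \<in> D" and i: "i < n" for k i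
  proof -
    show "0 \<le> y k i" unfolding y_eq using w[OF i] frac_ge_0 by (simp add: add_nonneg_nonneg)
    have "k i < m i" using k i by (auto simp: D_def)
    then have "real (k i) + frac (\<Sum>j<i. \<mu> i j * of_int (tri_coord \<mu> k j)) < real (m i)"
      using frac_lt_1[of "\<Sum>j<i. \<mu> i j * of_int (tri_coord \<mu> k j)"] by linarith
    also have "\<dots> \<le> real N * t / w i" by (rule m_le[OF i])
    finally show "y k i < real N * t"
      unfolding y_eq using w[OF i] by (simp add: field_simps)
  qed
  have F_in: "F k \<in> PiE {..<n} (\<lambda>_. {..<N})" if k: "k \<in> D" for k
  proof -
    have "nat \<lfloor>y k i / t\<rfloor> < N" if i: "i < n" for i
    proof -
      have "y k i / t < real N" using y_bounds[OF k i] t by (simp add: field_simps)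
      moreover have "0 \<le> y k i / t" using y_bounds[OF k i] t by simp
      ultimately show ?thesis by (simp add: floor_less_iff nat_less_iff)
    qed
    then show ?thesis by (auto simp: F_def)
  qed
  have "card (F ` D) \<le> card (PiE {..<n} (\<lambda>_. {..<N}))"
    by (rule card_mono) (use F_in in \<open>auto intro: finite_PiE\<close>)
  also have "\<dots> = N ^ n" by (simp add: card_PiE)
  also have "\<dots> < card D" using card_less by (simp add: D_def card_PiE)
  finally have "\<not> inj_on F D" by (rule pigeonhole)
  then obtain k k' where k: "k \<in> D" "k' \<in> D" "F k = F k'" "k \<noteq> k'"
    by (auto simp: inj_on_def)
  define c where "c = (\<lambda>i. tri_coord \<mu> k i - tri_coord \<mu> k' i)"
  have lin: "w i * (of_int (c i) + (\<Sum>j<i. \<mu> i j * of_int (c j))) = y k i - y k' i" for i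
    by (simp add: y_def c_def algebra_simps sum_subtractf)
  have "\<bar>y k i - y k' i\<bar> < t" if i: "i < n" for i
  proof -
    have "F k i = F k' i" using k(3) by simp
    then have "nat \<lfloor>y k i / t\<rfloor> = nat \<lfloor>y k' i / t\<rfloor>" using i by (simp add: F_def)
    moreover have "0 \<le> y k i / t" "0 \<le> y k' i / t" using y_bounds k i t by simp_all
    ultimately have "\<lfloor>y k i / t\<rfloor> = \<lfloor>y k' i / t\<rfloor>" by (simp add: eq_nat_nat_iff)
    then have "\<bar>y k i / t - y k' i / t\<bar> < 1" by linarith
    then have "\<bar>(y k i - y k' i) / t\<bar> < 1" by (simp add: diff_divide_distrib)
    then show ?thesis using t by (simp add: abs_divide)
  qed
  moreover have "\<exists>i<n. c i \<noteq> 0"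
  proof (rule ccontr)
    assume "\<not> ?thesis"
    then have eq: "tri_coord \<mu> k i = tri_coord \<mu> k' i" if "i < n" for i
      using that by (auto simp: c_def)
    have "k i = k' i" if i: "i < n" for i
    proof -
      have "(\<Sum>j<i. \<mu> i j * of_int (tri_coord \<mu> k j)) = (\<Sum>j<i. \<mu> i j * of_int (tri_coord \<mu> k' j))"
        using i eq by (intro sum.cong refl) auto
      then show ?thesis
        using eq[OF i] tri_coord.simps[of \<mu> k i] tri_coord.simps[of \<mu> k' i] by simp
    qed
    then have "k = k'" using k(1,2) by (intro PiE_ext[of k "{..<n}" _ k']) (auto simp: D_def)
    with k(4) show False by simp
  qed
  ultimately show ?thesis using lin by (intro exI[of _ c]) auto
qed

text \<open>The last basis vector is divided out. In the triangular decomposition n of the forms do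
  not involve its coefficient, and \<open>triangular_minkowski\<close> applies to them; their
  determinant is the full one divided by \<open>g n n\<close>. In the remaining form the coefficient
  is chosen by rounding, at a cost of at most \<open>g n n / 4\<close>.\<close>

lemma short_vector:
  fixes g :: "nat \<Rightarrow> nat \<Rightarrow> real"
  assumes sym: "\<And>i j. g i j = g j i"
    and pos: "\<And>c. \<exists>i<Suc n. c i \<noteq> 0 \<Longrightarrow> (\<Sum>i<Suc n. \<Sum>j<Suc n. g i j * c i * c j) > 0"
    and t: "t > 0" and small: "det (mat (Suc n) (Suc n) (\<lambda>(i, j). g i j)) < g n n * t ^ (2 * n)"
  shows "\<exists>c :: nat \<Rightarrow> int. (\<exists>i<n. c i \<noteq> 0) \<and>
    (\<Sum>i<Suc n. \<Sum>j<Suc n. g i j * of_int (c i) * of_int (c j)) \<le> real n * t\<^sup>2 + g n n / 4"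
proof -
  have ex: "\<exists>u T. (\<forall>k<Suc n. u k > 0 \<and> T k k = 1 \<and> (\<forall>j>k. T k j = 0)) \<and>
    (\<forall>i<Suc n. \<forall>j<Suc n. g i j = (\<Sum>k<Suc n. u k * T k i * T k j)) \<and>
    (Suc n > 0 \<longrightarrow> u (Suc n - 1) = g (Suc n - 1) (Suc n - 1))"
    by (rule gram_decomposition[OF sym pos])
  then obtain u T where *: "\<forall>k<Suc n. u k > 0 \<and> T k k = 1 \<and> (\<forall>j>k. T k j = 0)"
    "\<forall>i<Suc n. \<forall>j<Suc n. g i j = (\<Sum>k<Suc n. u k * T k i * T k j)"
    "Suc n > 0 \<longrightarrow> u (Suc n - 1) = g (Suc n - 1) (Suc n - 1)" by blast
  have uT: "\<And>k. k < Suc n \<Longrightarrow> u k > 0" "\<And>k. k < Suc n \<Longrightarrow> T k k = 1 \<and> (\<forall>j>k. T k j = 0)"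
    "\<And>i j. i < Suc n \<Longrightarrow> j < Suc n \<Longrightarrow> g i j = (\<Sum>k<Suc n. u k * T k i * T k j)"
    using *(1,2) by blast+
  have un: "u n = g n n" using *(3) by simp
  have "det (mat (Suc n) (Suc n) (\<lambda>(i, j). g i j)) = (\<Prod>k<Suc n. u k)"
    by (rule det_gram_decomposition[OF uT(2,3)])
  then have "(\<Prod>k<n. u k) * u n < u n * t ^ (2 * n)" using small un by simp
  then have "(\<Prod>k<n. u k) < t ^ (2 * n)" using uT(1)[of n] by simp
  moreover have "(\<Prod>k<n. sqrt (u k))\<^sup>2 = (\<Prod>k<n. u k)"
    unfolding prod_power_distrib by (intro prod.cong refl) (use uT(1) in \<open>auto intro: less_imp_le\<close>)
  moreover have "(t ^ n)\<^sup>2 = t ^ (2 * n)" by (simp add: mult.commute flip: power_mult)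
  ultimately have "(\<Prod>k<n. sqrt (u k))\<^sup>2 < (t ^ n)\<^sup>2" by simp
  then have "(\<Prod>k<n. sqrt (u k)) < t ^ n"
    by (rule power_less_imp_less_base) (use t in simp)
  then obtain c0 :: "nat \<Rightarrow> int" where c0: "\<exists>i<n. c0 i \<noteq> 0"
    "\<And>i. i < n \<Longrightarrow> \<bar>sqrt (u i) * (of_int (c0 i) + (\<Sum>j<i. T i j * of_int (c0 j)))\<bar> < t"
    using triangular_minkowski[of n "\<lambda>k. sqrt (u k)" t T] uT(1) t by auto
  define c where "c = c0(n := - round (\<Sum>j<n. T n j * of_int (c0 j)))"
  have row: "(\<Sum>i<Suc n. T k i * of_int (c i)) = of_int (c k) + (\<Sum>j<k. T k j * of_int (c0 j))" if "k \<le> n" for k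
  proof -
    have "(\<Sum>i<Suc n. T k i * of_int (c i)) = (\<Sum>i<Suc k. T k i * of_int (c i))"
      by (rule sum.mono_neutral_right) (use that uT(2)[of k] in auto)
    also have "\<dots> = of_int (c k) + (\<Sum>j<k. T k j * of_int (c j))"
      using uT(2)[of k] that by simp
    also have "(\<Sum>j<k. T k j * of_int (c j)) = (\<Sum>j<k. T k j * of_int (c0 j))"
      by (intro sum.cong refl) (use that in \<open>auto simp: c_def\<close>)
    finally show ?thesis .
  qed
  have "(\<Sum>i<Suc n. \<Sum>j<Suc n. g i j * of_int (c i) * of_int (c j)) =
      (\<Sum>i<Suc n. \<Sum>j<Suc n. \<Sum>k<Suc n. u k * ((T k i * of_int (c i)) * (T k j * of_int (c j))))"
    by (intro sum.cong refl) (simp add: uT(3) sum_distrib_left sum_distrib_right mult_ac del: sum.lessThan_Suc)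
  also have "\<dots> = (\<Sum>i<Suc n. \<Sum>k<Suc n. \<Sum>j<Suc n. u k * ((T k i * of_int (c i)) * (T k j * of_int (c j))))"
    by (intro sum.cong refl sum.swap)
  also have "\<dots> = (\<Sum>k<Suc n. \<Sum>i<Suc n. \<Sum>j<Suc n. u k * ((T k i * of_int (c i)) * (T k j * of_int (c j))))"
    by (rule sum.swap)
  also have "\<dots> = (\<Sum>k<Suc n. u k * (\<Sum>i<Suc n. T k i * of_int (c i))\<^sup>2)"
    unfolding power2_eq_square sum_product by (simp only: sum_distrib_left)
  also have "\<dots> = (\<Sum>k<Suc n. u k * (of_int (c k) + (\<Sum>j<k. T k j * of_int (c0 j)))\<^sup>2)"
    by (rule sum.cong[OF refl], subst row) auto
  also have "\<dots> = (\<Sum>k<n. u k * (of_int (c k) + (\<Sum>j<k. T k j * of_int (c0 j)))\<^sup>2) +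
      u n * (of_int (c n) + (\<Sum>j<n. T n j * of_int (c0 j)))\<^sup>2"
    by (rule sum.lessThan_Suc)
  also have "\<dots> \<le> (\<Sum>k<n. t\<^sup>2) + u n * (1 / 4)"
  proof (intro add_mono sum_mono mult_left_mono)
    fix k assume k: "k \<in> {..<n}"
    let ?z = "of_int (c k) + (\<Sum>j<k. T k j * of_int (c0 j)) :: real"
    have "\<bar>sqrt (u k) * ?z\<bar> \<le> t" using c0(2)[of k] k by (simp add: c_def)
    then have "(sqrt (u k) * ?z)\<^sup>2 \<le> t\<^sup>2" by (rule power2_le_iff_abs_le[THEN iffD2, rotated]) (use t in simp)
    then show "u k * ?z\<^sup>2 \<le> t\<^sup>2" using uT(1)[of k] k by (simp add: power_mult_distrib)
  next
    let ?S = "\<Sum>j<n. T n j * of_int (c0 j) :: real"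
    have "\<bar>of_int (c n) + ?S\<bar> \<le> 1 / 2"
      using of_int_round_abs_le[of ?S] by (simp add: c_def abs_minus_commute)
    then have "(of_int (c n) + ?S)\<^sup>2 \<le> (1 / 2)\<^sup>2" by (rule power2_le_iff_abs_le[THEN iffD2, rotated]) simp
    then show "(of_int (c n) + ?S)\<^sup>2 \<le> 1 / 4" by (simp add: power2_eq_square)
  qed (use uT(1)[of n] in simp)
  finally have "(\<Sum>i<Suc n. \<Sum>j<Suc n. g i j * of_int (c i) * of_int (c j)) \<le> real n * t\<^sup>2 + g n n / 4"
    using un by simp
  moreover have "\<exists>i<n. c i \<noteq> 0" using c0(1) by (auto simp: c_def)
  ultimately show ?thesis by blast
qed

section \<open>Embeddings, traces and discriminants\<close>

lemma splitting_field:
  assumes "algebraic x"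
  obtains \<psi> where "algebraic \<psi>" "conjugates x \<subseteq> simple_ext \<psi>" "conjugates \<psi> \<subseteq> simple_ext \<psi>"
    "\<forall>F. csubfield F \<longrightarrow> conjugates x \<subseteq> F \<longrightarrow> \<psi> \<in> F"
proof -
  obtain \<psi> where \<psi>: "algebraic \<psi>" "conjugates x \<subseteq> simple_ext \<psi>"
    "\<And>F. csubfield F \<Longrightarrow> conjugates x \<subseteq> F \<Longrightarrow> \<psi> \<in> F"
    using primitive_element_finite[OF finite_conjugates[OF assms] algebraic_conjugate[OF assms]] by blast
  with splitting_field_conjugates[OF assms \<psi>] that show ?thesis by blast
qed

lemma embeddings_iff:
  assumes "csubfield K"
  shows "\<sigma> \<in> embeddings K \<longleftrightarrow> chom K \<sigma> \<and> \<sigma> \<in> extensional K"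
  using csubfieldD(1)[OF assms] by (auto simp: embeddings_def Ring.ring_hom_def chom_def)

lemma chom_cong:
  assumes "csubfield K" "\<And>x. x \<in> K \<Longrightarrow> \<sigma> x = \<tau> x" shows "chom K \<sigma> \<longleftrightarrow> chom K \<tau>"
  using csubfieldD[OF assms(1)] assms(2) by (simp add: chom_def)

lemma bij_betw_embeddings_conjugates:
  assumes x: "algebraic x"
  shows "bij_betw (\<lambda>\<sigma>. \<sigma> x) (embeddings (simple_ext x)) (conjugates x)"
proof -
  note K = csubfield_simple_ext[OF x]
  show ?thesis
  proof (rule bij_betwI')
    fix \<sigma> \<tau> assume st: "\<sigma> \<in> embeddings (simple_ext x)" "\<tau> \<in> embeddings (simple_ext x)"
    have "\<sigma> = \<tau>" if "\<sigma> x = \<tau> x"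
    proof (rule extensionalityI)
      show "\<sigma> \<in> extensional (simple_ext x)" "\<tau> \<in> extensional (simple_ext x)"
        using st embeddings_iff[OF K] by blast+
      fix y assume "y \<in> simple_ext x"
      then obtain p where "y = qev p x" by (auto simp: simple_ext_def)
      then show "\<sigma> y = \<tau> y"
        using chom_qev[OF K _ simple_ext_self] st that embeddings_iff[OF K] by metis
    qed
    then show "\<sigma> x = \<tau> x \<longleftrightarrow> \<sigma> = \<tau>" by blast
  next
    fix \<sigma> assume "\<sigma> \<in> embeddings (simple_ext x)"
    then show "\<sigma> x \<in> conjugates x" using chom_conjugate[OF K] embeddings_iff[OF K] by simp
  next
    fix z assume z: "z \<in> conjugates x"
    let ?\<sigma> = "restrict (conj_map x z) (simple_ext x)"
    have "chom (simple_ext x) ?\<sigma>" using chom_conj_map[OF z] chom_cong[OF K, of ?\<sigma> "conj_map x z"] by simp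
    then have "?\<sigma> \<in> embeddings (simple_ext x)" using embeddings_iff[OF K] by simp
    moreover have "z = ?\<sigma> x" using conj_map_self[OF z] by simp
    ultimately show "\<exists>\<sigma>\<in>embeddings (simple_ext x). z = \<sigma> x" by blast
  qed
qed

lemma embeddings_apply:
  assumes x: "algebraic x" and \<sigma>: "\<sigma> \<in> embeddings (simple_ext x)"
  shows "\<sigma> (qev p x) = qev p (\<sigma> x)"
  by (rule chom_qev[OF csubfield_simple_ext[OF x] _ simple_ext_self])
     (use \<sigma> embeddings_iff[OF csubfield_simple_ext[OF x]] in blast)

lemma field_trace_simple_ext:
  assumes x: "algebraic x"
  shows "field_trace (simple_ext x) (qev p x) = (\<Sum>z\<in>conjugates x. qev p z)"
proof -
  have "field_trace (simple_ext x) (qev p x) = (\<Sum>\<sigma>\<in>embeddings (simple_ext x). qev p (\<sigma> x))"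
    unfolding field_trace_def by (intro sum.cong refl embeddings_apply[OF x])
  also have "\<dots> = (\<Sum>z\<in>conjugates x. qev p z)"
    by (rule sum.reindex_bij_betw[OF bij_betw_embeddings_conjugates[OF x]])
  finally show ?thesis .
qed

text \<open>The field need not be normal, so rationality is tested in a splitting field, whose
  substitution maps permute the conjugates of x and hence fix the trace.\<close>

lemma field_trace_Rats:
  assumes x: "algebraic x" and y: "y \<in> simple_ext x"
  shows "field_trace (simple_ext x) y \<in> \<rat>"
proof -
  obtain p where p: "y = qev p x" using y by (auto simp: simple_ext_def)
  obtain \<psi> where \<psi>: "algebraic \<psi>" "conjugates x \<subseteq> simple_ext \<psi>" by (rule splitting_field[OF x]) blast
  note L = csubfield_simple_ext[OF \<psi>(1)]
  have in_L: "qev p z \<in> simple_ext \<psi>" if "z \<in> conjugates x" for z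
    using that \<psi>(2) csubfield_qev[OF L] by blast
  have "(\<Sum>z\<in>conjugates x. qev p z) \<in> \<rat>"
  proof (rule simple_ext_fixed[OF \<psi>(1)])
    show "(\<Sum>z\<in>conjugates x. qev p z) \<in> simple_ext \<psi>" by (rule csubfield_sum[OF L in_L])
    fix w assume w: "w \<in> conjugates \<psi>"
    let ?\<sigma> = "conj_map \<psi> w"
    note \<sigma> = chom_conj_map[OF w]
    have inj: "inj_on ?\<sigma> (conjugates x)" using chomD(9)[OF L \<sigma>] \<psi>(2) by (rule inj_on_subset)
    have "?\<sigma> ` conjugates x \<subseteq> conjugates x"
      using chom_conjugate[OF L \<sigma>] \<psi>(2) conjugates_eq[OF x] by blast
    then have im: "?\<sigma> ` conjugates x = conjugates x"
      using endo_inj_surj[OF finite_conjugates[OF x] _ inj] by blast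
    have "?\<sigma> (\<Sum>z\<in>conjugates x. qev p z) = (\<Sum>z\<in>conjugates x. ?\<sigma> (qev p z))"
      by (rule chom_sum[OF L \<sigma> in_L])
    also have "\<dots> = (\<Sum>z\<in>conjugates x. qev p (?\<sigma> z))"
      using \<psi>(2) by (intro sum.cong refl chom_qev[OF L \<sigma>]) auto
    also have "\<dots> = (\<Sum>z\<in>conjugates x. qev p z)"
      using sum.reindex[OF inj, of "qev p"] im by simp
    finally show "?\<sigma> (\<Sum>z\<in>conjugates x. qev p z) = (\<Sum>z\<in>conjugates x. qev p z)" .
  qed
  then show ?thesis using field_trace_simple_ext[OF x] p by simp
qed

lemma csubfield_power: "csubfield K \<Longrightarrow> x \<in> K \<Longrightarrow> x ^ n \<in> K"
  by (induction n) (simp_all add: csubfieldD)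

lemma algebraic_int_power: "algebraic_int (x :: complex) \<Longrightarrow> algebraic_int (x ^ n)"
  using algebraic_int_of_int[of 1]
  by (induction n) (simp_all add: algebraic_int_plus_times(2))

text \<open>Numbering the embeddings turns sums over embeddings into matrix products. K and n are
  parameters tied by equations, so that an interpretation keeps a given name of the field and the
  numeral 5.\<close>

locale enumerated_number_field =
  fixes x :: complex and e :: "nat \<Rightarrow> complex \<Rightarrow> complex" and n :: nat and K :: "complex set"
  assumes alg: "algebraic x" and K_eq: "K = simple_ext x" and n_eq: "n = card (conjugates x)"
    and enum: "bij_betw e {..<n} (embeddings K)"
begin

lemma K: "csubfield K"
  using csubfield_simple_ext[OF alg] by (simp add: K_eq)

lemma e_in: "k < n \<Longrightarrow> e k \<in> embeddings K"
  using enum by (auto simp: bij_betw_def)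

lemma e_chom: "k < n \<Longrightarrow> chom K (e k)"
  using e_in embeddings_iff[OF K] by blast

lemma n_pos: "n > 0"
  using finite_conjugates[OF alg] self_conjugate[of x] unfolding n_eq card_gt_0_iff by blast

lemma trace_eq: "field_trace K y = (\<Sum>k<n. e k y)"
  unfolding field_trace_def by (rule sum.reindex_bij_betw[OF enum, symmetric])

lemma e_conjugate: "k < n \<Longrightarrow> y \<in> K \<Longrightarrow> e k y \<in> conjugates y"
  by (rule chom_conjugate[OF K e_chom])

lemma trace_Ints:
  assumes "y \<in> K" "algebraic_int y" shows "field_trace K y \<in> \<int>"
proof (rule rational_algebraic_int_is_int)
  show "field_trace K y \<in> \<rat>" using field_trace_Rats[OF alg] assms(1) by (simp add: K_eq)
  show "algebraic_int (field_trace K y)"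
    unfolding trace_eq
    by (rule algebraic_int_sum, rule algebraic_int_conjugate[OF assms(2) e_conjugate[OF _ assms(1)]]) simp
qed

section \<open>Discriminants of tuples and coordinates\<close>

definition emb_mat :: "(nat \<Rightarrow> complex) \<Rightarrow> complex mat" where
  "emb_mat b = mat n n (\<lambda>(k, j). e k (b j))"

definition disc :: "(nat \<Rightarrow> complex) \<Rightarrow> complex" where
  "disc b = det (mat n n (\<lambda>(i, j). field_trace K (b i * b j)))"

lemma emb_mat_carrier [simp]: "emb_mat b \<in> carrier_mat n n" "dim_row (emb_mat b) = n" "dim_col (emb_mat b) = n"
  by (simp_all add: emb_mat_def)

text \<open>With M = \<open>emb_mat b\<close>, the trace of \<open>b i * b j\<close> is an entry of
  the product of the transpose of M with M.\<close>

lemma disc_eq: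
  assumes "\<And>i. i < n \<Longrightarrow> b i \<in> K"
  shows "disc b = (det (emb_mat b))\<^sup>2"
proof -
  have "mat n n (\<lambda>(i, j). field_trace K (b i * b j)) = transpose_mat (emb_mat b) * emb_mat b"
    using chomD(5)[OF K e_chom] assms
    by (intro eq_matI) (auto simp: emb_mat_def scalar_prod_def trace_eq atLeast0LessThan intro!: sum.cong)
  then show ?thesis
    unfolding disc_def using det_mult[of "transpose_mat (emb_mat b)" n "emb_mat b"] det_transpose[of "emb_mat b" n]
    by (simp add: power2_eq_square)
qed

lemma disc_Ints:
  assumes "\<And>i. i < n \<Longrightarrow> b i \<in> K" "\<And>i. i < n \<Longrightarrow> algebraic_int (b i)"
  obtains d :: int where "disc b = of_int d"
proof -
  have "\<exists>t :: int. field_trace K (b i * b j) = of_int t" if "i < n" "j < n" for i j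
    using trace_Ints[of "b i * b j"] assms that csubfieldD(5)[OF K] algebraic_int_plus_times(2)
    by (auto elim!: Ints_cases)
  then obtain t :: "nat \<Rightarrow> nat \<Rightarrow> int" where
    t: "\<And>i j. i < n \<Longrightarrow> j < n \<Longrightarrow> field_trace K (b i * b j) = of_int (t i j)" by metis
  have "mat n n (\<lambda>(i, j). field_trace K (b i * b j)) = of_int_hom.mat_hom (mat n n (\<lambda>(i, j). t i j))"
    by (rule eq_matI) (auto simp: t)
  then show ?thesis using that unfolding disc_def by (metis of_int_hom.hom_det)
qed

lemma emb_mat_kernel:
  assumes "det (emb_mat b) \<noteq> 0" "\<And>k. k < n \<Longrightarrow> (\<Sum>j<n. e k (b j) * c j) = 0" "j < n"
  shows "c j = 0"
proof (rule ccontr)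
  assume "c j \<noteq> 0"
  then have "vec n c \<noteq> 0\<^sub>v n" using assms(3) by (metis index_vec index_zero_vec(1))
  moreover have "emb_mat b *\<^sub>v vec n c = 0\<^sub>v n"
    by (rule eq_vecI) (auto simp: emb_mat_def scalar_prod_def atLeast0LessThan assms(2))
  ultimately show False
    using assms(1) det_0_iff_vec_prod_zero_field[OF emb_mat_carrier(1), of b] vec_carrier[of n c] by blast
qed

lemma rat_combination:
  fixes c :: "nat \<Rightarrow> rat"
  assumes "\<And>i. i < n \<Longrightarrow> b i \<in> K" "k < n"
  shows "e k (\<Sum>i<n. of_rat (c i) * b i) = (\<Sum>i<n. e k (b i) * of_rat (c i))"
proof -
  have "e k (\<Sum>i<n. of_rat (c i) * b i) = (\<Sum>i<n. e k (of_rat (c i) * b i))"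
    by (rule chom_sum[OF K e_chom[OF assms(2)]]) (auto intro!: csubfieldD(5)[OF K] csubfield_of_rat[OF K] assms)
  also have "\<dots> = (\<Sum>i<n. e k (b i) * of_rat (c i))"
    by (intro sum.cong refl)
       (auto simp: chomD(5)[OF K e_chom[OF assms(2)]] csubfield_of_rat[OF K] assms chom_of_rat[OF K e_chom[OF assms(2)]])
  finally show ?thesis .
qed

lemma coordinates_unique:
  fixes c c' :: "nat \<Rightarrow> rat"
  assumes b: "\<And>i. i < n \<Longrightarrow> b i \<in> K" "det (emb_mat b) \<noteq> 0"
    and eq: "(\<Sum>i<n. of_rat (c i) * b i) = (\<Sum>i<n. of_rat (c' i) * b i)" and "i < n"
  shows "c i = c' i"
proof -
  have "(\<Sum>i<n. e k (b i) * of_rat (c i - c' i)) = 0" if "k < n" for k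
  proof -
    have "(\<Sum>i<n. of_rat (c i - c' i) * b i) = 0"
      using eq by (simp add: of_rat_diff left_diff_distrib sum_subtractf)
    then show ?thesis
      using rat_combination[where b = b, OF b(1) that, where c = "\<lambda>i. c i - c' i"] chomD(2)[OF K e_chom[OF that]] by simp
  qed
  then have "of_rat (c i - c' i) = (0 :: complex)"
    by (rule emb_mat_kernel[OF b(2) _ assms(4), where c = "\<lambda>i. of_rat (c i - c' i)"])
  then show ?thesis by simp
qed

text \<open>A nonzero determinant makes the \<open>b i\<close> independent, and n independent
  elements span the n-dimensional field.\<close>

lemma coordinates:
  assumes b: "\<And>i. i < n \<Longrightarrow> b i \<in> K" "det (emb_mat b) \<noteq> 0" and y: "y \<in> K"
  obtains c :: "nat \<Rightarrow> rat" where "y = (\<Sum>i<n. of_rat (c i) * b i)"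
proof -
  obtain m where m: "Factorial_Ring.irreducible m" "qev m x = 0" using minimal_polynomial[OF alg] by blast
  have deg: "degree m = n"
    using card_roots_irreducible[OF m(1)] conjugates_eq_roots[OF m] by (simp add: n_eq)
  let ?B = "(\<lambda>i. x ^ i) ` {..<n}"
  have B: "qv.span ?B = K" "card ?B = n"
    using span_powers[OF m] simple_ext_basis(2)[OF m] by (simp_all add: deg K_eq)
  have inj: "inj_on b {..<n}"
  proof (rule inj_onI)
    fix i j assume ij: "i \<in> {..<n}" "j \<in> {..<n}" "b i = b j"
    have "(\<Sum>l<n. of_rat (of_bool (l = i)) * b l) = (\<Sum>l<n. of_rat (of_bool (l = j)) * b l)"
      using ij by (simp add: of_bool_def if_distrib[of of_rat] if_distrib[of "\<lambda>z. z * _"] cong: if_cong)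
    then have "(of_bool (i = i) :: rat) = of_bool (i = j)"
      using coordinates_unique[where b = b, OF b, of "\<lambda>l. of_bool (l = i)" "\<lambda>l. of_bool (l = j)" i] ij(1) by simp
    then show "i = j" by (simp add: of_bool_def split: if_splits)
  qed
  have "qv.independent (b ` {..<n})"
  proof (rule ccontr)
    assume "\<not> ?thesis"
    then obtain u v where uv: "v \<in> b ` {..<n}" "u v \<noteq> 0" "(\<Sum>v\<in>b ` {..<n}. of_rat (u v) * v) = 0"
      using qv.dependent_finite[of "b ` {..<n}"] by auto
    have "(\<Sum>i<n. of_rat (u (b i)) * b i) = (\<Sum>i<n. of_rat 0 * b i)"
      using uv(3) by (simp add: sum.reindex[OF inj])
    then have "u (b i) = 0" if "i < n" for i
      using coordinates_unique[where b = b, OF b, of "\<lambda>i. u (b i)" "\<lambda>_. 0" i] that by simp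
    then show False using uv(1,2) by auto
  qed
  then have "qv.span ?B \<subseteq> qv.span (b ` {..<n})"
    by (rule span_subset_if_card_le[rotated]) (use B b(1) card_image[OF inj] in auto)
  then have "y \<in> qv.span (b ` {..<n})" using B(1) y by auto
  then obtain u where "y = (\<Sum>v\<in>b ` {..<n}. of_rat (u v) * v)"
    using qv.span_finite[of "b ` {..<n}"] by auto
  then have "y = (\<Sum>i<n. of_rat (u (b i)) * b i)" by (simp add: sum.reindex[OF inj])
  then show ?thesis by (rule that)
qed

text \<open>The last entry is pinned to 1, so that reducing modulo \<int> means dropping the last
  coordinate.\<close>

definition integral_tuple :: "(nat \<Rightarrow> complex) \<Rightarrow> bool" where
  "integral_tuple b \<longleftrightarrow> (\<forall>i<n. b i \<in> K \<and> algebraic_int (b i)) \<and> b (n - 1) = 1 \<and> det (emb_mat b) \<noteq> 0"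

text \<open>Descending powers of an integral multiple y of the generator, so that 1 comes last. The
  determinant is of Vandermonde type: a kernel vector would be a nonzero polynomial of degree below
  n vanishing at the n distinct numbers \<open>e l y\<close>.\<close>

lemma integral_tuple_exists: "\<exists>b. integral_tuple b"
proof -
  obtain k where k: "k \<noteq> 0" "algebraic_int (of_int k * x)" using algebraic_imp_int_multiple[OF alg] by blast
  define y where "y = of_int k * x"
  have xK: "x \<in> K" by (simp add: K_eq)
  have kK: "of_int k \<in> K" using csubfield_Rats[OF K] by auto
  have yK: "y \<in> K" unfolding y_def by (intro csubfieldD(5)[OF K] kK xK)
  define b where "b = (\<lambda>i. y ^ (n - 1 - i))"
  have bK: "b i \<in> K" for i unfolding b_def by (rule csubfield_power[OF K yK])
  have e_y: "e l y = of_int k * e l x" if "l < n" for l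
    using chomD(5)[OF K e_chom[OF that] kK xK] chom_of_rat[OF K e_chom[OF that], of "of_int k"] by (simp add: y_def)
  have inj: "inj_on (\<lambda>l. e l y) {..<n}"
  proof (rule inj_onI)
    fix l l' assume l: "l \<in> {..<n}" "l' \<in> {..<n}" "e l y = e l' y"
    then have "e l x = e l' x" using e_y k(1) by simp
    then have "e l = e l'"
      using bij_betw_embeddings_conjugates[OF alg] e_in l by (auto simp: bij_betw_def K_eq inj_on_def)
    then show "l = l'" using enum l by (auto simp: bij_betw_def inj_on_def)
  qed
  have e_b: "e l (b i) = e l y ^ (n - 1 - i)" if "l < n" for l i
  proof -
    have "e l (y ^ m) = e l y ^ m" for m
      by (induction m) (simp_all add: chomD(1,5)[OF K e_chom[OF that]] yK csubfield_power[OF K yK])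
    then show ?thesis by (simp add: b_def)
  qed
  have "det (emb_mat b) \<noteq> 0"
  proof
    assume "det (emb_mat b) = 0"
    then obtain v where v: "v \<in> carrier_vec n" "v \<noteq> 0\<^sub>v n" "emb_mat b *\<^sub>v v = 0\<^sub>v n"
      using det_0_iff_vec_prod_zero_field[of "emb_mat b" n] by auto
    define P where "P = (\<Sum>j<n. monom (v $ (n - 1 - j)) j)"
    have co: "coeff P j = (if j < n then v $ (n - 1 - j) else 0)" for j
      by (simp add: P_def coeff_sum)
    have root: "poly P (e l y) = 0" if l: "l < n" for l
    proof -
      have "0 = (emb_mat b *\<^sub>v v) $ l" using v(3) l by simp
      also have "\<dots> = (\<Sum>j<n. e l (b j) * v $ j)"
        using l v(1) by (simp add: scalar_prod_def emb_mat_def atLeast0LessThan)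
      also have "\<dots> = (\<Sum>j<n. v $ j * e l y ^ (n - 1 - j))" by (simp add: e_b[OF l] mult.commute)
      also have "\<dots> = (\<Sum>j<n. v $ (n - Suc j) * e l y ^ (n - 1 - (n - Suc j)))"
        by (rule sum.nat_diff_reindex[symmetric])
      also have "\<dots> = poly P (e l y)"
        unfolding P_def poly_sum poly_monom by (intro sum.cong refl) auto
      finally show ?thesis by simp
    qed
    have "P = 0"
    proof (rule ccontr)
      assume "P \<noteq> 0"
      have "n = card ((\<lambda>l. e l y) ` {..<n})" using card_image[OF inj] by simp
      also have "\<dots> \<le> card {z. poly P z = 0}"
        by (rule card_mono[OF poly_roots_finite[OF \<open>P \<noteq> 0\<close>]]) (use root in auto)
      also have "\<dots> \<le> degree P" using card_poly_roots_bound[OF \<open>P \<noteq> 0\<close>] .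
      also have "\<dots> \<le> n - 1" by (rule degree_le) (use co in auto)
      finally show False using n_pos by simp
    qed
    have "v $ j = 0" if "j < n" for j
      using co[of "n - 1 - j"] that \<open>P = 0\<close> by simp
    then have "v = 0\<^sub>v n" using v(1) by (intro eq_vecI) auto
    with v(2) show False by simp
  qed
  then have "integral_tuple b"
    using bK algebraic_int_power[OF k(2)] by (auto simp: integral_tuple_def b_def y_def)
  then show ?thesis by blast
qed

text \<open>An integral tuple of minimal absolute discriminant spans the ring of integers: replacing
  \<open>b i\<close> by an integer \<open>y\<close> reduced modulo \<open>b i\<close> multiplies the
  discriminant by the square of the fractional part of a coordinate of \<open>y\<close>.\<close>

lemma integral_basis_tuple:
  obtains b where "integral_tuple b"
    "\<And>y. y \<in> K \<Longrightarrow> algebraic_int y \<Longrightarrow> \<exists>c :: nat \<Rightarrow> int. y = (\<Sum>i<n. of_int (c i) * b i)"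
proof -
  define f where "f = (\<lambda>b. nat \<lfloor>norm (disc b)\<rfloor>)"
  obtain b0 where "integral_tuple b0" using integral_tuple_exists by blast
  then obtain b where b: "integral_tuple b" and min: "\<And>b'. integral_tuple b' \<Longrightarrow> f b \<le> f b'"
    using ex_has_least_nat[of integral_tuple b0 f] by blast
  have bK: "\<And>i. i < n \<Longrightarrow> b i \<in> K" and bI: "\<And>i. i < n \<Longrightarrow> algebraic_int (b i)"
    and b1: "b (n - 1) = 1" and bdet: "det (emb_mat b) \<noteq> 0"
    using b by (auto simp: integral_tuple_def)
  have "\<exists>c :: nat \<Rightarrow> int. y = (\<Sum>i<n. of_int (c i) * b i)" if y: "y \<in> K" "algebraic_int y" for y
  proof -
    obtain c where c: "y = (\<Sum>i<n. of_rat (c i) * b i)" using coordinates[where b = b, OF bK bdet y(1)] by blast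
    have cI: "c i \<in> \<int>" if i: "i < n - 1" for i
    proof (rule ccontr)
      assume "c i \<notin> \<int>"
      then have frac: "frac (c i) > 0" by (simp add: frac_gt_0_iff)
      define c' where "c' = c(i := frac (c i))"
      define z where "z = y - of_int \<lfloor>c i\<rfloor> * b i"
      have z: "z = (\<Sum>j<n. of_rat (c' j) * b j)"
      proof -
        have "(\<Sum>j<n. of_rat (c' j) * b j) = (\<Sum>j<n. of_rat (c j) * b j - (if j = i then of_int \<lfloor>c i\<rfloor> * b i else 0))"
          by (intro sum.cong refl) (auto simp: c'_def frac_def of_rat_diff algebra_simps)
        also have "\<dots> = z" using i by (simp add: sum_subtractf z_def c)
        finally show ?thesis by simp
      qed
      define b' where "b' = b(i := z)"
      have "of_int \<lfloor>c i\<rfloor> \<in> K" using csubfield_Rats[OF K] by auto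
      then have zK: "z \<in> K" unfolding z_def using i bK y by (intro csubfieldD(4,5)[OF K]) auto
      have zI: "algebraic_int z" unfolding z_def using i bI y(2)
        by (intro algebraic_int_diff algebraic_int_plus_times(2)) auto
      have b'K: "\<And>j. j < n \<Longrightarrow> b' j \<in> K" using bK zK by (auto simp: b'_def)
      define v where "v = vec n (\<lambda>j. of_rat (c' j) :: complex)"
      \<comment> \<open>The new column is the old matrix applied to the coordinate vector of z, so
        Cramer's rule gives its i-th coordinate as the ratio of the determinants.\<close>
      have "emb_mat b' = replace_col (emb_mat b) (emb_mat b *\<^sub>v v) i"
        using rat_combination[where b = b and c = c', OF bK]
        by (intro eq_matI) (auto simp: emb_mat_def replace_col_def b'_def v_def z scalar_prod_def atLeast0LessThan)
      then have "det (emb_mat b') = v $ i * det (emb_mat b)"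
        using cramer_lemma_mat[of "emb_mat b" n v i] i by (simp add: v_def)
      also have "v $ i = of_rat (frac (c i))" using i by (simp add: v_def c'_def)
      finally have det': "det (emb_mat b') = of_rat (frac (c i)) * det (emb_mat b)" .
      have tup: "integral_tuple b'"
        using b'K bI zI b1 i det' bdet frac by (auto simp: integral_tuple_def b'_def)
      obtain d where d: "disc b = of_int d" using disc_Ints[where b = b, OF bK bI] by blast
      have "algebraic_int (b' j)" if "j < n" for j using tup that by (simp add: integral_tuple_def)
      then obtain d' where d': "disc b' = of_int d'" using disc_Ints[where b = b', OF b'K] by blast
      have "disc b' = of_rat ((frac (c i))\<^sup>2) * disc b"
        using disc_eq[where b = b, OF bK] disc_eq[where b = b', OF b'K] det' by (simp add: power_mult_distrib of_rat_power)
      then have "(of_rat (of_int d') :: complex) = of_rat ((frac (c i))\<^sup>2 * of_int d)"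
        by (simp add: d d' of_rat_mult)
      then have "of_int d' = (frac (c i))\<^sup>2 * of_int d" by (simp only: of_rat_eq_iff)
      then have "of_int \<bar>d'\<bar> = (frac (c i))\<^sup>2 * of_int \<bar>d\<bar>" by (simp add: abs_mult)
      moreover have "(frac (c i))\<^sup>2 < 1"
        using frac_lt_1[of "c i"] frac by (simp add: power_less_one_iff abs_square_less_1)
      moreover have "d \<noteq> 0" using disc_eq[where b = b, OF bK] bdet d by auto
      ultimately have "of_int \<bar>d'\<bar> < (of_int \<bar>d\<bar> :: rat)" by simp
      then have "\<bar>d'\<bar> < \<bar>d\<bar>" by (simp only: of_int_less_iff)
      moreover have "nat \<bar>d\<bar> \<le> nat \<bar>d'\<bar>" using min[OF tup] by (simp add: f_def d d' flip: of_int_abs)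
      ultimately show False by linarith
    qed
    define c0 where "c0 = (\<lambda>i. \<lfloor>c i\<rfloor>)"
    have c0: "of_rat (c i) = (of_int (c0 i) :: complex)" if "i < n - 1" for i
      using cI[OF that] by (auto simp: c0_def elim!: Ints_cases)
    have split: "(\<Sum>i<n. g i) = (\<Sum>i<n - 1. g i) + g (n - 1)" for g :: "nat \<Rightarrow> complex"
      using n_pos sum.lessThan_Suc[of g "n - 1"] by simp
    \<comment> \<open>The last entry has to stay 1, so its coordinate is not reduced like the
      others. Being rational and, by this equation, an algebraic integer, it is an integer all the
      same.\<close>
    have "of_rat (c (n - 1)) = y - (\<Sum>i<n - 1. of_int (c0 i) * b i)"
      using c c0 by (simp add: split b1[unfolded One_nat_def])
    moreover have "algebraic_int (y - (\<Sum>i<n - 1. of_int (c0 i) * b i))"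
      by (intro algebraic_int_diff y algebraic_int_sum algebraic_int_plus_times(2) bI) auto
    ultimately have "algebraic_int (of_rat (c (n - 1)) :: complex)" by simp
    then have "of_rat (c (n - 1)) \<in> (\<int> :: complex set)"
      by (rule rational_algebraic_int_is_int) (rule Rats_of_rat)
    then obtain k where k: "of_rat (c (n - 1)) = (of_int k :: complex)" by (auto elim: Ints_cases)
    have "y = (\<Sum>i<n. of_int ((c0(n - 1 := k)) i) * b i)"
      using c c0 k by (simp add: split b1[unfolded One_nat_def])
    then show ?thesis by blast
  qed
  with b that show ?thesis by blast
qed

end

section \<open>Independence of the discriminant from the integral basis\<close>

lemma integral_basis_nth:
  assumes "integral_basis K bs" "i < length bs"
  shows "bs ! i \<in> ring_of_integers K"
proof -
  define c :: "int list" where "c = map (\<lambda>j. of_bool (j = i)) [0..<length bs]"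
  have "length c = length bs" by (simp add: c_def)
  then have "(\<Sum>j<length bs. of_int (c ! j) * bs ! j) \<in> ring_of_integers K"
    using bij_betw_apply[OF assms(1)[unfolded integral_basis_def], of c] by simp
  also have "(\<Sum>j<length bs. of_int (c ! j) * bs ! j) = (\<Sum>j<length bs. if j = i then bs ! i else 0)"
    by (intro sum.cong refl) (auto simp: c_def)
  also have "\<dots> = bs ! i" using assms(2) by simp
  finally show ?thesis .
qed

context enumerated_number_field
begin

lemma integral_basis_tuple_list:
  assumes b: "integral_tuple b"
    and span: "\<And>y. y \<in> K \<Longrightarrow> algebraic_int y \<Longrightarrow> \<exists>c :: nat \<Rightarrow> int. y = (\<Sum>i<n. of_int (c i) * b i)"
  shows "integral_basis K (map b [0..<n])"
  unfolding integral_basis_def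
proof (rule bij_betwI')
  have bK: "\<And>i. i < n \<Longrightarrow> b i \<in> K" and bI: "\<And>i. i < n \<Longrightarrow> algebraic_int (b i)"
    and bdet: "det (emb_mat b) \<noteq> 0"
    using b by (auto simp: integral_tuple_def)
  have eq: "(\<Sum>i<length (map b [0..<n]). of_int (c ! i) * map b [0..<n] ! i) = (\<Sum>i<n. of_int (c ! i) * b i)"
    for c :: "int list"
    by (intro sum.cong) auto
  {
    fix c c' :: "int list"
    assume len: "c \<in> {c. length c = length (map b [0..<n])}" "c' \<in> {c. length c = length (map b [0..<n])}"
    have "c = c'" if "(\<Sum>i<n. of_int (c ! i) * b i) = (\<Sum>i<n. of_int (c' ! i) * b i)"
    proof (rule nth_equalityI)
      fix i assume "i < length c"
      then have "(of_int (c ! i) :: rat) = of_int (c' ! i)"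
        using coordinates_unique[where b = b, OF bK bdet, where c = "\<lambda>i. of_int (c ! i)" and c' = "\<lambda>i. of_int (c' ! i)"]
          that len by simp
      then show "c ! i = c' ! i" by simp
    qed (use len in simp)
    then show "((\<Sum>i<length (map b [0..<n]). of_int (c ! i) * map b [0..<n] ! i) =
      (\<Sum>i<length (map b [0..<n]). of_int (c' ! i) * map b [0..<n] ! i)) = (c = c')"
      unfolding eq by blast
  next
    fix c :: "int list"
    have "(\<Sum>i<n. of_int (c ! i) * b i) \<in> K"
      using bK csubfield_Rats[OF K] by (intro csubfield_sum[OF K] csubfieldD(5)[OF K]) auto
    moreover have "algebraic_int (\<Sum>i<n. of_int (c ! i) * b i)"
      by (intro algebraic_int_sum algebraic_int_plus_times(2) bI) auto
    ultimately show "(\<Sum>i<length (map b [0..<n]). of_int (c ! i) * map b [0..<n] ! i) \<in> ring_of_integers K"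
      unfolding eq by (simp add: ring_of_integers_def)
  next
    fix y assume "y \<in> ring_of_integers K"
    then obtain c :: "nat \<Rightarrow> int" where "y = (\<Sum>i<n. of_int (c i) * b i)"
      using span by (auto simp: ring_of_integers_def)
    then have "y = (\<Sum>i<n. of_int (map c [0..<n] ! i) * b i)" by simp
    then show "\<exists>c\<in>{c. length c = length (map b [0..<n])}.
        y = (\<Sum>i<length (map b [0..<n]). of_int (c ! i) * map b [0..<n] ! i)"
      unfolding eq by (intro bexI[of _ "map c [0..<n]"]) auto
  }
qed

text \<open>The definite description in \<open>field_discriminant\<close> ranges over all integral
  bases. Two of them are related by mutually inverse integer matrices, whose determinants are 1 or
  -1 and disappear on squaring.\<close>

lemma integral_basis_disc:
  assumes b: "integral_tuple b"
    and span: "\<And>y. y \<in> K \<Longrightarrow> algebraic_int y \<Longrightarrow> \<exists>c :: nat \<Rightarrow> int. y = (\<Sum>i<n. of_int (c i) * b i)"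
    and bs: "integral_basis K bs"
  shows "det (mat (length bs) (length bs) (\<lambda>(i, j). field_trace K (bs ! i * bs ! j))) = disc b"
proof -
  have bK: "\<And>i. i < n \<Longrightarrow> b i \<in> K" and bI: "\<And>i. i < n \<Longrightarrow> algebraic_int (b i)"
    and bdet: "det (emb_mat b) \<noteq> 0"
    using b by (auto simp: integral_tuple_def)
  define m where "m = length bs"
  note bij = bs[unfolded integral_basis_def, folded m_def]
  have bs_in: "bs ! i \<in> ring_of_integers K" if "i < m" for i
    using integral_basis_nth[OF bs] that by (simp add: m_def)
  have bs_unique: "c i = c' i" if "(\<Sum>i<m. of_int (c i) * bs ! i) = (\<Sum>i<m. of_int (c' i) * bs ! i)" "i < m"
    for c c' :: "nat \<Rightarrow> int" and i
  proof -
    have "(\<Sum>i<m. of_int (map c [0..<m] ! i) * bs ! i) = (\<Sum>i<m. of_int (map c' [0..<m] ! i) * bs ! i)"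
      using that(1) by simp
    then have "map c [0..<m] = map c' [0..<m]"
      by (rule inj_onD[OF bij_betw_imp_inj_on[OF bij]]) auto
    then show ?thesis using that(2) by simp
  qed
  have "\<exists>c :: nat \<Rightarrow> int. y = (\<Sum>i<m. of_int (c i) * bs ! i)" if "y \<in> ring_of_integers K" for y
  proof -
    have "y \<in> (\<lambda>c :: int list. \<Sum>i<m. of_int (c ! i) * bs ! i) ` {c. length c = m}"
      using bij that by (simp add: bij_betw_def)
    then show ?thesis by (auto intro: exI[of _ "\<lambda>i. _ ! i"])
  qed
  then have "\<forall>j. \<exists>c :: nat \<Rightarrow> int. j < n \<longrightarrow> b j = (\<Sum>i<m. of_int (c i) * bs ! i)"
    using bK bI by (simp add: ring_of_integers_def)
  from choice[OF this] obtain T' :: "nat \<Rightarrow> nat \<Rightarrow> int" where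
    T': "\<forall>j. j < n \<longrightarrow> b j = (\<Sum>i<m. of_int (T' j i) * bs ! i)" by blast
  define T where "T = (\<lambda>i j. T' j i)"
  have T: "b j = (\<Sum>i<m. of_int (T i j) * bs ! i)" if "j < n" for j
    unfolding T_def using T' that by blast
  have "\<forall>i. \<exists>c :: nat \<Rightarrow> int. i < m \<longrightarrow> bs ! i = (\<Sum>j<n. of_int (c j) * b j)"
    using bs_in span by (simp add: ring_of_integers_def)
  from choice[OF this] obtain S' :: "nat \<Rightarrow> nat \<Rightarrow> int" where
    S': "\<forall>i. i < m \<longrightarrow> bs ! i = (\<Sum>j<n. of_int (S' i j) * b j)" by blast
  define S where "S = (\<lambda>j i. S' i j)"
  have S: "bs ! i = (\<Sum>j<n. of_int (S j i) * b j)" if "i < m" for i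
    unfolding S_def using S' that by blast
  have ST: "(\<Sum>i<m. S j i * T i l) = of_bool (j = l)" if "j < n" "l < n" for j l
  proof -
    have "b l = (\<Sum>i<m. \<Sum>j<n. of_int (T i l) * (of_int (S j i) * b j))"
      using T[OF that(2)] by (simp add: S sum_distrib_left)
    also have "\<dots> = (\<Sum>j<n. \<Sum>i<m. of_int (T i l) * (of_int (S j i) * b j))" by (rule sum.swap)
    also have "\<dots> = (\<Sum>j<n. of_int (\<Sum>i<m. S j i * T i l) * b j)"
      by (simp add: sum_distrib_left sum_distrib_right mult_ac)
    also have "\<dots> = (\<Sum>j<n. of_rat (of_int (\<Sum>i<m. S j i * T i l)) * b j)"
      by (simp only: of_rat_of_int_eq)
    finally have "(\<Sum>j<n. of_rat (of_int (\<Sum>i<m. S j i * T i l)) * b j) = (\<Sum>j<n. of_rat (of_int (of_bool (j = l))) * b j)"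
      using that(2) by (simp add: of_bool_def if_distrib[of of_rat] if_distrib[of of_int] if_distrib[of "\<lambda>z. z * _"] cong: if_cong)
    then have "(of_int (\<Sum>i<m. S j i * T i l) :: rat) = of_int (of_bool (j = l))"
      using coordinates_unique[where b = b, OF bK bdet,
        where c = "\<lambda>j. of_int (\<Sum>i<m. S j i * T i l)" and c' = "\<lambda>j. of_int (of_bool (j = l))"] that(1) by blast
    then show ?thesis by (simp only: of_int_eq_iff)
  qed
  have TS: "(\<Sum>j<n. T l j * S j i) = of_bool (l = i)" if "i < m" "l < m" for i l
  proof -
    have "bs ! i = (\<Sum>j<n. \<Sum>l<m. of_int (S j i) * (of_int (T l j) * bs ! l))"
      using S[OF that(1)] by (simp add: T sum_distrib_left)
    also have "\<dots> = (\<Sum>l<m. \<Sum>j<n. of_int (S j i) * (of_int (T l j) * bs ! l))" by (rule sum.swap)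
    also have "\<dots> = (\<Sum>l<m. of_int (\<Sum>j<n. T l j * S j i) * bs ! l)"
      by (simp add: sum_distrib_left sum_distrib_right mult_ac)
    finally have "(\<Sum>l<m. of_int (\<Sum>j<n. T l j * S j i) * bs ! l) = (\<Sum>l<m. of_int (of_bool (l = i)) * bs ! l)"
      using that(1) by (simp add: of_bool_def if_distrib[of of_int] if_distrib[of "\<lambda>z. z * _"] cong: if_cong)
    then show ?thesis
      using bs_unique[where c = "\<lambda>l. \<Sum>j<n. T l j * S j i" and c' = "\<lambda>l. of_bool (l = i)"] that(2) by blast
  qed
  \<comment> \<open>The length of \<open>bs\<close> is not known in advance; the traces of S T and T
    S are n and m, and they agree.\<close>
  have "int n = (\<Sum>j<n. \<Sum>i<m. S j i * T i j)" by (simp add: ST)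
  also have "\<dots> = (\<Sum>i<m. \<Sum>j<n. T i j * S j i)" by (subst sum.swap) (simp add: mult.commute)
  also have "\<dots> = int m" by (simp add: TS)
  finally have mn: "m = n" by simp
  define MS where "MS = mat n n (\<lambda>(j, i). S j i)"
  define MT where "MT = mat n n (\<lambda>(i, j). T i j)"
  have carr: "MS \<in> carrier_mat n n" "MT \<in> carrier_mat n n" by (simp_all add: MS_def MT_def)
  have "MS * MT = 1\<^sub>m n"
    by (rule eq_matI) (auto simp: MS_def MT_def scalar_prod_def atLeast0LessThan ST mn[symmetric])
  then have "det MS * det MT = 1" using det_mult[OF carr] by simp
  then have "(det MS)\<^sup>2 = 1" by (auto simp: zmult_eq_1_iff)
  have bsK: "bs ! i \<in> K" if "i < n" for i using bs_in that mn by (auto simp: ring_of_integers_def)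
  have "emb_mat (nth bs) = emb_mat b * of_int_hom.mat_hom MS"
  proof (rule eq_matI)
    fix k i assume "k < dim_row (emb_mat b * of_int_hom.mat_hom MS)" "i < dim_col (emb_mat b * of_int_hom.mat_hom MS)"
    then have ki: "k < n" "i < n" by (simp_all add: MS_def)
    have "e k (bs ! i) = (\<Sum>j<n. e k (b j) * of_int (S j i))"
      using rat_combination[where b = b and c = "\<lambda>j. of_int (S j i)", OF bK ki(1)] S[of i] ki mn by simp
    then show "emb_mat (nth bs) $$ (k, i) = (emb_mat b * of_int_hom.mat_hom MS) $$ (k, i)"
      using ki by (simp add: emb_mat_def MS_def scalar_prod_def atLeast0LessThan)
  qed (simp_all add: MS_def)
  then have "det (emb_mat (nth bs)) = det (emb_mat b) * of_int (det MS)"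
    using det_mult[of "emb_mat b" n "of_int_hom.mat_hom MS"] carr by simp
  then have "disc (nth bs) = disc b * of_int ((det MS)\<^sup>2)"
    using disc_eq[where b = "nth bs", OF bsK] disc_eq[where b = b, OF bK] by (simp add: power_mult_distrib)
  also have "\<dots> = disc b" using \<open>(det MS)\<^sup>2 = 1\<close> by simp
  finally show ?thesis unfolding disc_def m_def[symmetric] mn .
qed

lemma field_discriminant_eq_disc:
  assumes b: "integral_tuple b"
    and span: "\<And>y. y \<in> K \<Longrightarrow> algebraic_int y \<Longrightarrow> \<exists>c :: nat \<Rightarrow> int. y = (\<Sum>i<n. of_int (c i) * b i)"
  shows "of_int (field_discriminant K) = disc b"
proof -
  have bK: "\<And>i. i < n \<Longrightarrow> b i \<in> K" and bI: "\<And>i. i < n \<Longrightarrow> algebraic_int (b i)"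
    using b by (auto simp: integral_tuple_def)
  obtain d where d: "disc b = of_int d" using disc_Ints[where b = b, OF bK bI] by blast
  have "field_discriminant K = d"
    unfolding field_discriminant_def
  proof (rule the_equality)
    have bs: "integral_basis K (map b [0..<n])" by (rule integral_basis_tuple_list[OF b span])
    show "\<exists>bs. integral_basis K bs \<and>
        of_int d = det (mat (length bs) (length bs) (\<lambda>(i, j). field_trace K (bs ! i * bs ! j)))"
      using integral_basis_disc[OF b span bs] bs d by metis
  next
    fix d' assume "\<exists>bs. integral_basis K bs \<and>
        of_int d' = det (mat (length bs) (length bs) (\<lambda>(i, j). field_trace K (bs ! i * bs ! j)))"
    then obtain bs where "integral_basis K bs"
      "of_int d' = det (mat (length bs) (length bs) (\<lambda>(i, j). field_trace K (bs ! i * bs ! j)))" by blast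
    then have "(of_int d' :: complex) = of_int d" using integral_basis_disc[OF b span] d by metis
    then show "d' = d" by simp
  qed
  then show ?thesis using d by simp
qed

text \<open>Composition with complex conjugation permutes the embeddings; this is what makes the
  Gram entries real.\<close>

lemma sum_embeddings_cnj:
  "(\<Sum>\<sigma>\<in>embeddings K. f \<sigma>) = (\<Sum>\<sigma>\<in>embeddings K. f (restrict (\<lambda>y. cnj (\<sigma> y)) K))"
proof -
  have "restrict (\<lambda>y. cnj (\<sigma> y)) K \<in> embeddings K" if "\<sigma> \<in> embeddings K" for \<sigma>
  proof -
    have "chom K (\<lambda>y. cnj (\<sigma> y))" using that by (simp add: embeddings_iff[OF K] chom_def)
    then show ?thesis
      using chom_cong[OF K, of "restrict (\<lambda>y. cnj (\<sigma> y)) K" "\<lambda>y. cnj (\<sigma> y)"] by (simp add: embeddings_iff[OF K])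
  qed
  moreover have "restrict (\<lambda>y. cnj (restrict (\<lambda>y. cnj (\<sigma> y)) K y)) K = \<sigma>" if "\<sigma> \<in> embeddings K" for \<sigma>
    using that by (auto simp: embeddings_iff[OF K] extensional_def fun_eq_iff)
  ultimately show ?thesis
    by (intro sum.reindex_bij_witness[where i = "\<lambda>\<sigma>. restrict (\<lambda>y. cnj (\<sigma> y)) K" and j = "\<lambda>\<sigma>. restrict (\<lambda>y. cnj (\<sigma> y)) K"]) auto
qed

text \<open>The bilinear form belonging to the sum of |\<sigma> y|^2 over all embeddings. Unlike the
  trace of y^2, which is indefinite when there are nonreal embeddings, it bounds all conjugates at
  once.\<close>

definition gram :: "(nat \<Rightarrow> complex) \<Rightarrow> nat \<Rightarrow> nat \<Rightarrow> real" where
  "gram b i j = Re (\<Sum>k<n. e k (b i) * cnj (e k (b j)))"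

lemma gram_complex:
  assumes "b i \<in> K" "b j \<in> K"
  shows "complex_of_real (gram b i j) = (\<Sum>k<n. e k (b i) * cnj (e k (b j)))"
proof -
  let ?G = "\<Sum>k<n. e k (b i) * cnj (e k (b j))"
  have G: "?G = (\<Sum>\<sigma>\<in>embeddings K. \<sigma> (b i) * cnj (\<sigma> (b j)))"
    by (rule sum.reindex_bij_betw[OF enum])
  have "cnj ?G = (\<Sum>\<sigma>\<in>embeddings K. cnj (\<sigma> (b i)) * \<sigma> (b j))" unfolding G by simp
  also have "\<dots> = ?G"
    unfolding G using assms by (subst (2) sum_embeddings_cnj) simp
  finally have "?G \<in> \<real>" by (simp add: Reals_cnj_iff)
  then show ?thesis unfolding gram_def by (rule of_real_Re)
qed

text \<open>The Gram matrix is the transpose of \<open>emb_mat b\<close> times its complex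
  conjugate, while the trace matrix has \<open>emb_mat b\<close> as second factor. Thus only the
  absolute value of the squared determinant remains.\<close>

lemma det_gram:
  assumes "\<And>i. i < n \<Longrightarrow> b i \<in> K"
  shows "det (mat n n (\<lambda>(i, j). gram b i j)) = norm (disc b)"
proof -
  interpret cnj_hom: comm_ring_hom cnj by unfold_locales auto
  have "of_real_hom.mat_hom (mat n n (\<lambda>(i, j). gram b i j)) = transpose_mat (emb_mat b) * map_mat cnj (emb_mat b)"
    using gram_complex assms
    by (intro eq_matI) (auto simp: emb_mat_def scalar_prod_def atLeast0LessThan intro!: sum.cong)
  then have "complex_of_real (det (mat n n (\<lambda>(i, j). gram b i j))) = det (emb_mat b) * cnj (det (emb_mat b))"
    using det_mult[of "transpose_mat (emb_mat b)" n "map_mat cnj (emb_mat b)"] det_transpose[of "emb_mat b" n]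
    by (metis of_real_hom.hom_det cnj_hom.hom_det emb_mat_carrier(1) map_carrier_mat transpose_carrier_mat)
  also have "\<dots> = complex_of_real ((norm (det (emb_mat b)))\<^sup>2)" by (rule complex_norm_square[symmetric])
  finally have "det (mat n n (\<lambda>(i, j). gram b i j)) = (norm (det (emb_mat b)))\<^sup>2" by (simp only: of_real_eq_iff)
  then show ?thesis using disc_eq[where b = b, OF assms] by (simp add: norm_power)
qed

lemma gram_form:
  "(\<Sum>i<n. \<Sum>j<n. gram b i j * c i * c j) = (\<Sum>k<n. (norm (\<Sum>i<n. e k (b i) * of_real (c i)))\<^sup>2)"
proof -
  have "(\<Sum>k<n. (norm (\<Sum>i<n. e k (b i) * of_real (c i)))\<^sup>2) =
      (\<Sum>k<n. Re ((\<Sum>i<n. e k (b i) * of_real (c i)) * cnj (\<Sum>i<n. e k (b i) * of_real (c i))))"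
    by (simp only: complex_norm_square[symmetric] Re_complex_of_real)
  also have "\<dots> = Re (\<Sum>k<n. \<Sum>i<n. \<Sum>j<n. (e k (b i) * of_real (c i)) * (cnj (e k (b j)) * of_real (c j)))"
    by (simp only: Re_sum cnj_sum complex_cnj_mult complex_cnj_complex_of_real sum_product)
  also have "(\<Sum>k<n. \<Sum>i<n. \<Sum>j<n. (e k (b i) * of_real (c i)) * (cnj (e k (b j)) * of_real (c j))) =
      (\<Sum>i<n. \<Sum>k<n. \<Sum>j<n. (e k (b i) * of_real (c i)) * (cnj (e k (b j)) * of_real (c j)))"
    by (rule sum.swap)
  also have "\<dots> = (\<Sum>i<n. \<Sum>j<n. \<Sum>k<n. (e k (b i) * of_real (c i)) * (cnj (e k (b j)) * of_real (c j)))"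
    by (intro sum.cong refl sum.swap)
  also have "\<dots> = (\<Sum>i<n. \<Sum>j<n. of_real (c i * c j) * (\<Sum>k<n. e k (b i) * cnj (e k (b j))))"
    by (simp add: sum_distrib_left mult_ac)
  also have "Re \<dots> = (\<Sum>i<n. \<Sum>j<n. gram b i j * c i * c j)"
    by (simp add: gram_def mult_ac del: of_real_mult)
  finally show ?thesis by simp
qed

section \<open>Short irrational integers\<close>

lemma field_discriminant_nonzero: "field_discriminant K \<noteq> 0"
proof -
  obtain b where b: "integral_tuple b"
    and span: "\<And>y. y \<in> K \<Longrightarrow> algebraic_int y \<Longrightarrow> \<exists>c :: nat \<Rightarrow> int. y = (\<Sum>i<n. of_int (c i) * b i)"
    by (rule integral_basis_tuple) blast
  have "disc b \<noteq> 0" using b disc_eq[where b = b] by (auto simp: integral_tuple_def)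
  then show ?thesis using field_discriminant_eq_disc[OF b span] by auto
qed

text \<open>The vector is sought modulo 1, the last entry of the tuple: a nonzero coordinate among
  the others is what makes y irrational. The exponent in t is chosen so that
  \<open>t ^ (2 * m)\<close> is |D|, and the hypothesis of \<open>short_vector\<close> then reads
  |D| < n |D|. The summand n / 4 is the cost of rounding the coefficient of 1.\<close>

lemma short_integer:
  assumes n: "n = Suc m" "m > 0" and t: "t = \<bar>of_int (field_discriminant K)\<bar> powr (1 / (2 * real m))"
  obtains y where "y \<in> K" "algebraic_int y" "y \<notin> \<rat>"
    "(\<Sum>k<n. (norm (e k y))\<^sup>2) \<le> real m * t\<^sup>2 + real n / 4"
proof -
  obtain b where b: "integral_tuple b"
    and span: "\<And>y. y \<in> K \<Longrightarrow> algebraic_int y \<Longrightarrow> \<exists>c :: nat \<Rightarrow> int. y = (\<Sum>i<n. of_int (c i) * b i)"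
    by (rule integral_basis_tuple) blast
  have bK: "\<And>i. i < n \<Longrightarrow> b i \<in> K" and bI: "\<And>i. i < n \<Longrightarrow> algebraic_int (b i)"
    and "b (n - 1) = 1" and bdet: "det (emb_mat b) \<noteq> 0"
    using b by (auto simp: integral_tuple_def)
  then have bm: "b m = 1" by (simp add: n(1))
  define D where "D = \<bar>of_int (field_discriminant K) :: real\<bar>"
  have D: "D > 0" using field_discriminant_nonzero by (simp add: D_def)
  have normD: "norm (disc b) = D"
    using field_discriminant_eq_disc[OF b span] by (simp add: D_def flip: field_discriminant_eq_disc[OF b span])
  have t0: "t > 0" using D by (simp add: t D_def)
  define g where "g = gram b"
  have gmm: "g m m = real n" using chomD(1)[OF K e_chom] by (simp add: g_def gram_def bm)
  have tm: "t ^ (2 * m) = D"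
    using D n(2) by (simp add: t D_def[symmetric] powr_realpow[symmetric] powr_powr)
  have pos: "(\<Sum>i<n. \<Sum>j<n. g i j * c i * c j) > 0" if c: "\<exists>i<n. c i \<noteq> 0" for c
  proof -
    have "\<exists>k<n. (\<Sum>i<n. e k (b i) * of_real (c i)) \<noteq> 0"
      using emb_mat_kernel[where b = b and c = "\<lambda>i. of_real (c i)"] bdet c by (metis of_real_eq_0_iff)
    then show ?thesis unfolding g_def gram_form by (auto intro!: sum_pos2)
  qed
  have sym: "g i j = g j i" for i j
    by (simp add: g_def gram_def mult_ac)
  have small: "det (mat (Suc m) (Suc m) (\<lambda>(i, j). g i j)) < g m m * t ^ (2 * m)"
  proof -
    have "det (mat n n (\<lambda>(i, j). g i j)) = D" using det_gram[where b = b, OF bK] normD by (simp add: g_def)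
    moreover have "D < real n * D" using D n by simp
    ultimately show ?thesis unfolding n(1)[symmetric] gmm tm by simp
  qed
  obtain c :: "nat \<Rightarrow> int" where c: "\<exists>i<m. c i \<noteq> 0"
    "(\<Sum>i<Suc m. \<Sum>j<Suc m. g i j * of_int (c i) * of_int (c j)) \<le> real m * t\<^sup>2 + g m m / 4"
    using short_vector[of g m t, OF sym pos[unfolded n(1)] t0 small] by blast
  define y where "y = (\<Sum>i<n. of_int (c i) * b i)"
  have "y \<in> K"
    unfolding y_def using bK csubfield_Rats[OF K] by (intro csubfield_sum[OF K] csubfieldD(5)[OF K]) auto
  moreover have "algebraic_int y"
    unfolding y_def by (intro algebraic_int_sum algebraic_int_plus_times(2) bI) auto
  moreover have "y \<notin> \<rat>"
  proof
    assume "y \<in> \<rat>"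
    then obtain q where q: "y = of_rat q" by (auto elim: Rats_cases)
    have "(\<Sum>i<n. of_rat (of_int (c i)) * b i) = (\<Sum>i<n. of_rat (if i = m then q else 0) * b i)"
      using q y_def bm n(1) by simp
    then have "(of_int (c i) :: rat) = (if i = m then q else 0)" if "i < n" for i
      using coordinates_unique[where b = b, OF bK bdet, where c = "\<lambda>i. of_int (c i)" and c' = "\<lambda>i. if i = m then q else 0"]
        that by blast
    then have "c i = 0" if "i < m" for i using that n(1) by (metis less_SucI nat_neq_iff of_int_eq_0_iff)
    with c(1) show False by blast
  qed
  moreover have "e k y = (\<Sum>i<n. e k (b i) * of_real (of_int (c i)))" if "k < n" for k
    using rat_combination[where b = b and c = "\<lambda>i. of_int (c i)", OF bK that] by (simp add: y_def)
  then have "(\<Sum>k<n. (norm (e k y))\<^sup>2) \<le> real m * t\<^sup>2 + real n / 4"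
    using c(2)[folded n(1)] gmm gram_form[of b "\<lambda>i. of_int (c i)"] by (simp add: g_def)
  ultimately show ?thesis using that by blast
qed

end

text \<open>In prime degree every irrational element generates, so it suffices that the short
  integer is irrational, and this survives the shift to trace zero.\<close>

lemma short_trace_zero_generator:
  assumes nf: "number_field K" and deg: "field_degree K = 5"
  shows "\<exists>x. K = simple_ext x \<and> algebraic_int x \<and> card (conjugates x) = 5 \<and> \<Sum>(conjugates x) = 0 \<and>
      (\<forall>z\<in>conjugates x. norm z \<le> 30 * \<bar>of_int (field_discriminant K)\<bar> powr (1 / 8))"
proof -
  have prime: "Factorial_Ring.prime (field_degree K)" by (simp add: deg)
  have cK: "csubfield K" using nf by (simp add: number_field_iff)
  have card5: "card (conjugates z) = 5" if "K = simple_ext z" "algebraic z" for z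
  proof -
    obtain m where m: "Factorial_Ring.irreducible m" "qev m z = 0" using minimal_polynomial[OF \<open>algebraic z\<close>] by blast
    then show ?thesis
      using field_degree_simple_ext[OF m] card_roots_irreducible[OF m(1)] conjugates_eq_roots[OF m] deg that(1) by simp
  qed
  have "K \<noteq> \<rat>"
  proof
    assume "K = \<rat>"
    have "qv.span {1} = \<rat>"
      by (auto simp: qv.span_singleton Rats_def)
    then have "field_degree K = 1"
      using field_degree_eq[of "{1}" K] \<open>K = \<rat>\<close> qv.independent_insert[of 1 "{}"] qv.independent_empty by simp
    then show False using deg by simp
  qed
  then obtain z where z: "z \<in> K" "z \<notin> \<rat>" using csubfield_Rats[OF cK] by blast
  have alg_z: "algebraic z" by (rule number_field_algebraic[OF nf z(1)])
  have Kz: "K = simple_ext z" by (rule simple_ext_eq_if_prime_degree[OF nf prime z])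
  have bij_z: "bij_betw (\<lambda>\<sigma>. \<sigma> z) (embeddings K) (conjugates z)"
    using bij_betw_embeddings_conjugates[OF alg_z] by (simp add: Kz)
  then have "finite (embeddings K)" "card (embeddings K) = 5"
    using finite_conjugates[OF alg_z] card5[OF Kz alg_z] bij_betw_finite bij_betw_same_card by metis+
  then obtain e :: "nat \<Rightarrow> complex \<Rightarrow> complex" where e: "bij_betw e {..<5} (embeddings K)"
    using ex_bij_betw_nat_finite[of "embeddings K"] by (auto simp: atLeast0LessThan)
  interpret enumerated_number_field z e 5 K
    by unfold_locales (use alg_z Kz card5[OF Kz alg_z] e in auto)
  have nz: "field_discriminant K \<noteq> 0" by (rule field_discriminant_nonzero)
  define D where "D = \<bar>of_int (field_discriminant K) :: real\<bar>"
  have D1: "D \<ge> 1" using nz by (simp add: D_def flip: of_int_abs)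
  define t where "t = D powr (1 / 8)"
  have t1: "t \<ge> 1" using D1 by (simp add: t_def ge_one_powr_ge_zero)
  obtain y where y: "y \<in> K" "algebraic_int y" "y \<notin> \<rat>" "(\<Sum>k<5. (norm (e k y))\<^sup>2) \<le> 4 * t\<^sup>2 + 5 / 4"
    by (rule short_integer[of 4 t]) (auto simp: t_def D_def)
  have norm_y: "norm (e k y) \<le> 3 * t" if "k < 5" for k
  proof -
    have "(norm (e k y))\<^sup>2 \<le> (\<Sum>k<5. (norm (e k y))\<^sup>2)"
      by (rule member_le_sum) (use that in auto)
    also have "\<dots> \<le> 4 * t\<^sup>2 + 5 / 4" by (rule y(4))
    \<comment> \<open>Here |D| \<ge> 1 enters through t \<ge> 1. The constant 3 leads to 15 for the
      trace, a sum of five conjugates, and to 5 * 3 + 15 = 30 for x.\<close>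
    also have "\<dots> \<le> 9 * t\<^sup>2" using one_le_power[OF t1, of 2] by linarith
    also have "\<dots> = (3 * t)\<^sup>2" by (simp add: power_mult_distrib)
    finally show ?thesis by (rule power2_le_imp_le) (use t1 in simp)
  qed
  define T where "T = field_trace K y"
  have T_eq: "T = (\<Sum>k<5. e k y)" by (simp add: T_def trace_eq)
  have T_int: "T \<in> \<int>" unfolding T_def by (rule trace_Ints[OF y(1,2)])
  have norm_T: "norm T \<le> 15 * t"
  proof -
    have "norm T \<le> (\<Sum>k<5. norm (e k y))" unfolding T_eq by (rule norm_sum)
    also have "\<dots> \<le> (\<Sum>k<(5::nat). 3 * t)" by (rule sum_mono) (use norm_y in auto)
    finally show ?thesis by simp
  qed
  \<comment> \<open>Taking five times y - T / 5 keeps x integral; its trace is 5 T - 5 T.\<close>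
  define x where "x = 5 * y - T"
  have TQ: "T \<in> \<rat>" using T_int by (auto elim: Ints_cases)
  have TK: "T \<in> K" using TQ csubfield_Rats[OF cK] by blast
  have fiveK: "5 \<in> K" using csubfield_of_nat[OF cK, of 5] by simp
  have xK: "x \<in> K" unfolding x_def using y(1) TK fiveK by (intro csubfieldD[OF cK])
  have xQ: "x \<notin> \<rat>"
  proof
    assume "x \<in> \<rat>"
    then have "(x + T) / 5 \<in> \<rat>" using TQ by simp
    then show False using y(3) by (simp add: x_def)
  qed
  have Kx: "K = simple_ext x" by (rule simple_ext_eq_if_prime_degree[OF nf prime xK xQ])
  have "algebraic_int T" using T_int by (auto elim: Ints_cases)
  moreover have "algebraic_int (5 * y)"
    using algebraic_int_plus_times(2)[OF algebraic_int_of_int[of 5] y(2)] by simp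
  ultimately have x_int: "algebraic_int x" unfolding x_def by (intro algebraic_int_diff)
  then have x_alg: "algebraic x" by blast
  have e_x: "e k x = 5 * e k y - T" if "k < 5" for k
  proof -
    obtain q where q: "T = of_rat q" using TQ by (auto elim: Rats_cases)
    have "e k 5 = 5" using chom_of_rat[OF cK e_chom[OF that], of 5] by simp
    moreover have "e k T = T" using chom_of_rat[OF cK e_chom[OF that], of q] q by simp
    ultimately show ?thesis
      using chomD(4,5)[OF cK e_chom[OF that]] y(1) TK fiveK csubfieldD(5)[OF cK] by (simp add: x_def)
  qed
  have bij_x: "bij_betw (\<lambda>k. e k x) {..<5} (conjugates x)"
    using bij_betw_trans[OF e bij_betw_embeddings_conjugates[OF x_alg, folded Kx]] by (simp add: o_def)
  have "\<Sum>(conjugates x) = (\<Sum>k<5. e k x)"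
    by (rule sum.reindex_bij_betw[OF bij_x, symmetric])
  also have "\<dots> = 0" using T_eq by (simp add: e_x sum_subtractf sum_distrib_left[symmetric])
  finally have "\<Sum>(conjugates x) = 0" .
  moreover have "norm w \<le> 30 * t" if "w \<in> conjugates x" for w
  proof -
    obtain k where k: "k < 5" "w = e k x" using \<open>w \<in> conjugates x\<close> bij_x by (auto simp: bij_betw_def)
    have "norm w \<le> norm (5 * e k y) + norm T" unfolding k(2) e_x[OF k(1)] by (rule norm_triangle_ineq4)
    also have "\<dots> \<le> 5 * (3 * t) + 15 * t" using norm_y[OF k(1)] norm_T by (simp add: norm_mult)
    finally show ?thesis by simp
  qed
  ultimately show ?thesis
    using Kx x_int card5[OF Kx x_alg] unfolding t_def D_def by blast
qed

section \<open>Isomorphic number fields\<close>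

lemma ring_iso_iff_chom:
  assumes "csubfield K"
  shows "f \<in> ring_iso (cring_on K) (cring_on K') \<longleftrightarrow> chom K f \<and> bij_betw f K K'"
proof
  assume f: "f \<in> ring_iso (cring_on K) (cring_on K')"
  show "chom K f \<and> bij_betw f K K'"
    using ring_iso_memE[OF f] by (simp add: chom_def)
next
  assume f: "chom K f \<and> bij_betw f K K'"
  show "f \<in> ring_iso (cring_on K) (cring_on K')"
    by (rule ring_iso_memI) (use f in \<open>auto simp: chom_def bij_betw_def\<close>)
qed

lemma ring_cring_on: "csubfield K \<Longrightarrow> ring (cring_on K)"
  using CR.subring_is_ring subfieldE(1) subfield_iff_csubfield by blast

lemma bij_betw_conj_map:
  assumes x: "algebraic x" and z: "z \<in> conjugates x"
  shows "bij_betw (conj_map x z) (simple_ext x) (simple_ext z)"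
proof -
  have "conj_map x z ` simple_ext x = simple_ext z"
    by (auto simp: simple_ext_def conj_map_qev[OF z] image_image)
  then show ?thesis
    using chomD(9)[OF csubfield_simple_ext[OF x] chom_conj_map[OF z]] by (simp add: bij_betw_def)
qed

lemma simple_ext_conjugate_iso:
  assumes x: "algebraic x" and z: "z \<in> conjugates x"
  shows "cring_on (simple_ext x) \<simeq> cring_on (simple_ext z)"
  using ring_iso_iff_chom[OF csubfield_simple_ext[OF x]] chom_conj_map[OF z] bij_betw_conj_map[OF x z]
  unfolding is_ring_iso_def by blast

lemma cring_on_iso_sym:
  assumes "csubfield K" "cring_on K \<simeq> cring_on K'" shows "cring_on K' \<simeq> cring_on K"
  using ring_iso_set_sym[OF ring_cring_on[OF assms(1)]] assms(2) unfolding is_ring_iso_def by blast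

text \<open>The embeddings of \<open>K'\<close> are those of \<open>K\<close> composed with the inverse isomorphism, so traces,
  rings of integers and integral bases correspond.\<close>

lemma discriminant_witness_transfer:
  assumes K: "csubfield K" and K': "csubfield K'" and \<phi>: "chom K \<phi>" "bij_betw \<phi> K K'"
    and bs: "integral_basis K bs"
  shows "integral_basis K' (map \<phi> bs)"
    and "det (mat (length bs) (length bs) (\<lambda>(i, j). field_trace K' (map \<phi> bs ! i * map \<phi> bs ! j))) =
      det (mat (length bs) (length bs) (\<lambda>(i, j). field_trace K (bs ! i * bs ! j)))"
proof -
  define \<psi> where "\<psi> = inv_into K \<phi>"
  have bij_\<psi>: "bij_betw \<psi> K' K" unfolding \<psi>_def by (rule bij_betw_inv_into[OF \<phi>(2)])
  have \<psi>\<phi>: "\<psi> (\<phi> y) = y" if "y \<in> K" for y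
    using bij_betw_inv_into_left[OF \<phi>(2) that] by (simp add: \<psi>_def)
  have \<phi>\<psi>: "\<phi> (\<psi> y) = y" if "y \<in> K'" for y
    using bij_betw_inv_into_right[OF \<phi>(2) that] by (simp add: \<psi>_def)
  have \<phi>_in: "\<phi> y \<in> K'" if "y \<in> K" for y using bij_betw_apply[OF \<phi>(2) that] .
  have \<psi>_in: "\<psi> y \<in> K" if "y \<in> K'" for y using bij_betw_apply[OF bij_\<psi> that] .
  have \<psi>: "chom K' \<psi>"
    unfolding chom_def
  proof (intro conjI ballI)
    show "\<psi> 1 = 1" using \<psi>\<phi>[OF csubfieldD(1)[OF K]] chomD(1)[OF K \<phi>(1)] by simp
    fix y z assume yz: "y \<in> K'" "z \<in> K'"
    show "\<psi> (y + z) = \<psi> y + \<psi> z"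
      using \<psi>\<phi>[of "\<psi> y + \<psi> z"] chomD(3)[OF K \<phi>(1), of "\<psi> y" "\<psi> z"] \<psi>_in yz \<phi>\<psi> csubfieldD(3)[OF K] by simp
    show "\<psi> (y * z) = \<psi> y * \<psi> z"
      using \<psi>\<phi>[of "\<psi> y * \<psi> z"] chomD(5)[OF K \<phi>(1), of "\<psi> y" "\<psi> z"] \<psi>_in yz \<phi>\<psi> csubfieldD(5)[OF K] by simp
  qed
  have comp: "restrict (\<lambda>y. \<tau> (f y)) F \<in> embeddings F"
    if "csubfield F" "csubfield F'" "chom F f" "\<And>y. y \<in> F \<Longrightarrow> f y \<in> F'" "\<tau> \<in> embeddings F'" for F F' f \<tau>
  proof -
    have "chom F' \<tau>" using that(5) embeddings_iff[OF that(2)] by blast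
    then have "chom F (\<lambda>y. \<tau> (f y))" using that(3,4) by (simp add: chom_def)
    then show ?thesis
      using chom_cong[OF that(1), of "restrict (\<lambda>y. \<tau> (f y)) F" "\<lambda>y. \<tau> (f y)"] embeddings_iff[OF that(1)] by simp
  qed
  have trace: "field_trace K' (\<phi> y) = field_trace K y" if y: "y \<in> K" for y
    unfolding field_trace_def
  proof (rule sum.reindex_bij_witness[where i = "\<lambda>\<sigma>. restrict (\<lambda>y. \<sigma> (\<psi> y)) K'" and j = "\<lambda>\<tau>. restrict (\<lambda>y. \<tau> (\<phi> y)) K"])
    fix \<tau> assume \<tau>: "\<tau> \<in> embeddings K'"
    show "restrict (\<lambda>y. \<tau> (\<phi> y)) K \<in> embeddings K" by (rule comp[OF K K' \<phi>(1) \<phi>_in \<tau>])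
    show "restrict (\<lambda>y. restrict (\<lambda>y. \<tau> (\<phi> y)) K (\<psi> y)) K' = \<tau>"
      using \<tau> \<psi>_in \<phi>\<psi> by (auto simp: embeddings_iff[OF K'] extensional_def fun_eq_iff)
    show "restrict (\<lambda>y. \<tau> (\<phi> y)) K y = \<tau> (\<phi> y)" using y by simp
  next
    fix \<sigma> assume \<sigma>: "\<sigma> \<in> embeddings K"
    show "restrict (\<lambda>y. \<sigma> (\<psi> y)) K' \<in> embeddings K'" by (rule comp[OF K' K \<psi> \<psi>_in \<sigma>])
    show "restrict (\<lambda>y. restrict (\<lambda>y. \<sigma> (\<psi> y)) K' (\<phi> y)) K = \<sigma>"
      using \<sigma> \<phi>_in \<psi>\<phi> by (auto simp: embeddings_iff[OF K] extensional_def fun_eq_iff)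
  qed
  have int_\<phi>: "\<phi> y \<in> ring_of_integers K'" if "y \<in> ring_of_integers K" for y
    using that \<phi>_in algebraic_int_conjugate[OF _ chom_conjugate[OF K \<phi>(1)]] by (auto simp: ring_of_integers_def)
  have int_\<psi>: "\<psi> y \<in> ring_of_integers K" if "y \<in> ring_of_integers K'" for y
    using that \<psi>_in algebraic_int_conjugate[OF _ chom_conjugate[OF K' \<psi>]] by (auto simp: ring_of_integers_def)
  have bij_int: "bij_betw \<phi> (ring_of_integers K) (ring_of_integers K')"
    by (rule bij_betw_byWitness[where f' = \<psi>])
       (use int_\<phi> int_\<psi> \<psi>\<phi> \<phi>\<psi> in \<open>auto simp: ring_of_integers_def\<close>)
  define m where "m = length bs"
  note bij = bs[unfolded integral_basis_def, folded m_def]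
  have bsK: "bs ! i \<in> K" if "i < m" for i
    using integral_basis_nth[OF bs] that by (simp add: m_def ring_of_integers_def)
  have intK: "of_int k \<in> K" for k using csubfield_Rats[OF K] by auto
  have \<phi>_int: "\<phi> (of_int k) = of_int k" for k using chom_of_rat[OF K \<phi>(1), of "of_int k"] by simp
  have sum_eq: "(\<Sum>i<m. of_int (c ! i) * map \<phi> bs ! i) = \<phi> (\<Sum>i<m. of_int (c ! i) * bs ! i)" for c :: "int list"
  proof -
    have "\<phi> (\<Sum>i<m. of_int (c ! i) * bs ! i) = (\<Sum>i<m. \<phi> (of_int (c ! i) * bs ! i))"
      by (rule chom_sum[OF K \<phi>(1)]) (use bsK intK in \<open>auto intro: csubfieldD(5)[OF K]\<close>)
    also have "\<dots> = (\<Sum>i<m. of_int (c ! i) * map \<phi> bs ! i)"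
      using bsK intK by (intro sum.cong refl) (simp add: chomD(5)[OF K \<phi>(1)] \<phi>_int m_def)
    finally show ?thesis by simp
  qed
  have "bij_betw (\<phi> \<circ> (\<lambda>c :: int list. \<Sum>i<m. of_int (c ! i) * bs ! i)) {c. length c = m} (ring_of_integers K')"
    by (rule bij_betw_trans[OF bij bij_int])
  then show "integral_basis K' (map \<phi> bs)"
    unfolding integral_basis_def length_map m_def[symmetric] sum_eq by (simp add: o_def)
  have "mat m m (\<lambda>(i, j). field_trace K' (map \<phi> bs ! i * map \<phi> bs ! j)) =
      mat m m (\<lambda>(i, j). field_trace K (bs ! i * bs ! j))"
  proof (rule eq_matI)
    fix i j assume "i < dim_row (mat m m (\<lambda>(i, j). field_trace K (bs ! i * bs ! j)))"
      "j < dim_col (mat m m (\<lambda>(i, j). field_trace K (bs ! i * bs ! j)))"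
    then have ij: "i < m" "j < m" by simp_all
    have "map \<phi> bs ! i * map \<phi> bs ! j = \<phi> (bs ! i * bs ! j)"
      using ij bsK by (simp add: chomD(5)[OF K \<phi>(1)] m_def)
    then show "mat m m (\<lambda>(i, j). field_trace K' (map \<phi> bs ! i * map \<phi> bs ! j)) $$ (i, j) =
      mat m m (\<lambda>(i, j). field_trace K (bs ! i * bs ! j)) $$ (i, j)"
      using ij trace[OF csubfieldD(5)[OF K bsK bsK]] by simp
  qed simp_all
  then show "det (mat (length bs) (length bs) (\<lambda>(i, j). field_trace K' (map \<phi> bs ! i * map \<phi> bs ! j))) =
      det (mat (length bs) (length bs) (\<lambda>(i, j). field_trace K (bs ! i * bs ! j)))"
    by (simp add: m_def)
qed

text \<open>Witnessing bases are carried over by the isomorphism and back by its inverse, so the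
  predicates inside the two definite descriptions coincide.\<close>

lemma field_discriminant_iso:
  assumes K: "csubfield K" and K': "csubfield K'" and iso: "cring_on K \<simeq> cring_on K'"
  shows "field_discriminant K = field_discriminant K'"
proof -
  define P where "P = (\<lambda>K (d :: int). \<exists>bs. integral_basis K bs \<and>
     of_int d = det (mat (length bs) (length bs) (\<lambda>(i, j). field_trace K (bs ! i * bs ! j))))"
  have step: "P F' d" if FF': "csubfield F" "csubfield F'" "cring_on F \<simeq> cring_on F'" "P F d" for F F' d
  proof -
    obtain \<phi> where \<phi>: "chom F \<phi>" "bij_betw \<phi> F F'"
      using FF'(3) ring_iso_iff_chom[OF FF'(1)] unfolding is_ring_iso_def by blast
    obtain bs where bs: "integral_basis F bs"
      "of_int d = det (mat (length bs) (length bs) (\<lambda>(i, j). field_trace F (bs ! i * bs ! j)))"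
      using FF'(4) unfolding P_def by blast
    show ?thesis
      unfolding P_def
      using discriminant_witness_transfer[OF FF'(1,2) \<phi> bs(1)] bs(2)
      by (intro exI[of _ "map \<phi> bs"]) simp
  qed
  have "P K = P K'"
    using step[OF K K' iso] step[OF K' K cring_on_iso_sym[OF K iso]] by (intro ext) blast
  then show ?thesis unfolding field_discriminant_def P_def[symmetric, THEN fun_cong, THEN fun_cong]
    by (simp add: P_def fun_eq_iff)
qed

section \<open>The Galois group\<close>

lemma galois_over_rationals_simple_ext:
  assumes "algebraic \<psi>" "conjugates \<psi> \<subseteq> simple_ext \<psi>"
  shows "galois_over_rationals (simple_ext \<psi>)"
  unfolding galois_over_rationals_def
proof (intro conjI allI impI)
  show "number_field (simple_ext \<psi>)" by (rule number_field_simple_ext[OF assms(1)])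
  fix p and y :: complex
  assume p: "Factorial_Ring.irreducible p \<and> (\<exists>x\<in>simple_ext \<psi>. poly (map_poly of_rat p) x = 0)"
    and y: "poly (map_poly of_rat p) y = 0"
  then obtain x where "x \<in> simple_ext \<psi>" "qev p x = 0" by (auto simp: qev_def)
  with p y show "y \<in> simple_ext \<psi>"
    using normal_simple_ext[OF assms, of x] conjugates_eq_roots[of p x] by (auto simp: qev_def)
qed

lemma galois_closure_simple_ext:
  assumes x: "algebraic x" and \<psi>: "algebraic \<psi>" "conjugates x \<subseteq> simple_ext \<psi>" "conjugates \<psi> \<subseteq> simple_ext \<psi>"
    "\<forall>F. csubfield F \<longrightarrow> conjugates x \<subseteq> F \<longrightarrow> \<psi> \<in> F"
  shows "galois_closure (simple_ext x) = simple_ext \<psi>"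
proof
  have "x \<in> simple_ext \<psi>" using \<psi>(2) self_conjugate by blast
  then have "simple_ext x \<subseteq> simple_ext \<psi>"
    using simple_ext_subset[OF csubfield_simple_ext[OF \<psi>(1)]] by blast
  then show "galois_closure (simple_ext x) \<subseteq> simple_ext \<psi>"
    unfolding galois_closure_def using galois_over_rationals_simple_ext[OF \<psi>(1,3)] by blast
  show "simple_ext \<psi> \<subseteq> galois_closure (simple_ext x)"
    unfolding galois_closure_def
  proof (intro Inter_greatest)
    fix L assume "L \<in> {L. galois_over_rationals L \<and> simple_ext x \<subseteq> L}"
    then have L: "galois_over_rationals L" "x \<in> L" using simple_ext_self[of x] by blast+
    have cL: "csubfield L" using L(1) by (simp add: galois_over_rationals_def number_field_iff)
    obtain m where m: "Factorial_Ring.irreducible m" "qev m x = 0" using minimal_polynomial[OF x] by blast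
    then have "conjugates x \<subseteq> L"
      using L conjugates_eq_roots[OF m] unfolding galois_over_rationals_def qev_def by blast
    then show "simple_ext \<psi> \<subseteq> L" using \<psi>(4) cL simple_ext_subset[OF cL] by blast
  qed
qed

section \<open>Automorphisms of the Galois closure\<close>

lemma galois_group_iff:
  assumes "csubfield L"
  shows "g \<in> carrier (galois_group L) \<longleftrightarrow> g \<in> extensional L \<and> chom L g \<and> bij_betw g L L"
proof -
  have "g q = q" if "chom L g" "q \<in> \<rat>" for q
    using that chom_of_rat[OF assms that(1)] by (auto elim!: Rats_cases)
  then show ?thesis
    by (auto simp: galois_group_def Bij_def ring_iso_iff_chom[OF assms])
qed

lemma galois_group_mult:
  assumes "csubfield L" "g \<in> carrier (galois_group L)" "h \<in> carrier (galois_group L)"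
  shows "g \<otimes>\<^bsub>galois_group L\<^esub> h = compose L g h" "compose L g h \<in> carrier (galois_group L)"
proof -
  have gh: "g \<in> Bij L" "h \<in> Bij L" using assms(2,3) by (simp_all add: galois_group_def)
  then show "g \<otimes>\<^bsub>galois_group L\<^esub> h = compose L g h" by (simp add: galois_group_def BijGroup_def)
  have g: "chom L g" "bij_betw g L L" and h: "chom L h" "bij_betw h L L"
    using assms galois_group_iff by blast+
  have "h y \<in> L" if "y \<in> L" for y using bij_betw_apply[OF h(2) that] .
  then have "chom L (compose L g h)"
    using g(1) h(1) csubfieldD[OF assms(1)] by (simp add: chom_def compose_def)
  then show "compose L g h \<in> carrier (galois_group L)"
    using galois_group_iff[OF assms(1)] compose_Bij[OF gh] by (simp add: Bij_def)
qed

text \<open>\<open>simple_ext_fixed\<close> speaks about all substitution maps into the complex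
  numbers. Normality gives \<open>simple_ext z = simple_ext \<psi>\<close> for each conjugate z, so
  every such map restricts to an automorphism and belongs to the group.\<close>

lemma galois_group_fixed:
  assumes \<psi>: "algebraic \<psi>" "conjugates \<psi> \<subseteq> simple_ext \<psi>" and y: "y \<in> simple_ext \<psi>"
    and fixed: "\<And>g. g \<in> carrier (galois_group (simple_ext \<psi>)) \<Longrightarrow> g y = y"
  shows "y \<in> \<rat>"
proof (rule simple_ext_fixed[OF \<psi>(1) y])
  fix z assume z: "z \<in> conjugates \<psi>"
  note L = csubfield_simple_ext[OF \<psi>(1)]
  let ?g = "restrict (conj_map \<psi> z) (simple_ext \<psi>)"
  have alg_z: "algebraic z" by (rule algebraic_conjugate[OF \<psi>(1) z])
  have "\<psi> \<in> conjugates z" using conjugates_eq[OF \<psi>(1) z] by simp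
  have "conjugates z \<subseteq> simple_ext z"
  proof
    fix w assume "w \<in> conjugates z"
    then have "w \<in> conjugates \<psi>" using conjugates_eq[OF \<psi>(1) z] by simp
    define \<tau> where "\<tau> = conj_map \<psi> z"
    have \<tau>: "chom (simple_ext \<psi>) \<tau>" unfolding \<tau>_def by (rule chom_conj_map[OF z])
    have "inj_on \<tau> (conjugates \<psi>)" using chomD(9)[OF L \<tau>] \<psi>(2) by (rule inj_on_subset)
    moreover have "\<tau> ` conjugates \<psi> \<subseteq> conjugates \<psi>"
      using chom_conjugate[OF L \<tau>] \<psi>(2) conjugates_eq[OF \<psi>(1)] by blast
    ultimately have "\<tau> ` conjugates \<psi> = conjugates \<psi>"
      using endo_inj_surj[OF finite_conjugates[OF \<psi>(1)]] by blast
    then obtain v where "v \<in> conjugates \<psi>" "w = \<tau> v" using \<open>w \<in> conjugates \<psi>\<close> by blast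
    then show "w \<in> simple_ext z"
      using \<psi>(2) bij_betw_conj_map[OF \<psi>(1) z] unfolding \<tau>_def bij_betw_def by blast
  qed
  then have "\<psi> \<in> simple_ext z" using \<open>\<psi> \<in> conjugates z\<close> by blast
  then have "simple_ext z = simple_ext \<psi>"
    using simple_ext_subset[OF csubfield_simple_ext[OF alg_z]] simple_ext_subset[OF L] z \<psi>(2) by blast
  then have "bij_betw (conj_map \<psi> z) (simple_ext \<psi>) (simple_ext \<psi>)"
    using bij_betw_conj_map[OF \<psi>(1) z] by simp
  then have "bij_betw ?g (simple_ext \<psi>) (simple_ext \<psi>)"
    by (rule bij_betw_cong[THEN iffD2, rotated]) simp
  moreover have "chom (simple_ext \<psi>) ?g"
    using chom_conj_map[OF z] chom_cong[OF L, of ?g "conj_map \<psi> z"] by simp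
  ultimately have "?g \<in> carrier (galois_group (simple_ext \<psi>))" using galois_group_iff[OF L] by simp
  then have "?g y = y" by (rule fixed)
  then show "conj_map \<psi> z y = y" using y by simp
qed

text \<open>The map \<open>g a e\<close> is the automorphism matched with the pair (a, e). The
  relations are stated pointwise, so that later arguments deal with two maps on L and with no group.
  The last conclusion holds because r and s generate everything.\<close>

lemma dihedral_generators:
  assumes L: "csubfield L" and iso: "galois_group L \<cong> dihedral_group 5"
    and fixed: "\<And>y. y \<in> L \<Longrightarrow> (\<And>g. g \<in> carrier (galois_group L) \<Longrightarrow> g y = y) \<Longrightarrow> y \<in> \<rat>"
  obtains r s where "chom L r" "bij_betw r L L" "chom L s" "bij_betw s L L"
    "\<And>y. y \<in> L \<Longrightarrow> r (r (r (r (r y)))) = y" "\<And>y. y \<in> L \<Longrightarrow> s (s y) = y"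
    "\<And>y. y \<in> L \<Longrightarrow> s (r y) = r (r (r (r (s y))))"
    "\<And>y. y \<in> L \<Longrightarrow> r y = y \<Longrightarrow> s y = y \<Longrightarrow> y \<in> \<rat>"
proof -
  let ?G = "galois_group L" and ?D = "dihedral_group 5"
  obtain h where h: "h \<in> hom ?G ?D" "bij_betw h (carrier ?G) (carrier ?D)"
    using iso unfolding is_iso_def Group.iso_def by blast
  have cD: "carrier ?D = {0..<5} \<times> UNIV" by (simp add: dihedral_group_def)
  have mD: "(a, e) \<otimes>\<^bsub>?D\<^esub> (b, f) = ((if e then a - b else a + b) mod 5, e \<noteq> f)" for a b e f
    by (simp add: dihedral_group_def)
  define g where "g = (\<lambda>a e. inv_into (carrier ?G) h (a, e))"
  have gG: "g a e \<in> carrier ?G" if "a \<in> {0..<5}" for a e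
    using bij_betw_apply[OF bij_betw_inv_into[OF h(2)], of "(a, e)"] that by (simp add: g_def cD)
  have hg: "h (g a e) = (a, e)" if "a \<in> {0..<5}" for a e
    using bij_betw_inv_into_right[OF h(2), of "(a, e)"] that by (simp add: g_def cD)
  have g_mult: "g ((if e then a - b else a + b) mod 5) (e \<noteq> f) y = g a e (g b f y)"
    if ab: "a \<in> {0..<5}" "b \<in> {0..<5}" and y: "y \<in> L" for a b e f y
  proof -
    have "h (compose L (g a e) (g b f)) = h (g a e) \<otimes>\<^bsub>?D\<^esub> h (g b f)"
      using hom_mult[OF h(1) gG gG] galois_group_mult(1)[OF L gG gG] ab by metis
    also have "\<dots> = h (g ((if e then a - b else a + b) mod 5) (e \<noteq> f))"
      using ab by (simp add: hg mD)
    finally have "compose L (g a e) (g b f) = g ((if e then a - b else a + b) mod 5) (e \<noteq> f)"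
      using bij_betw_imp_inj_on[OF h(2)] galois_group_mult(2)[OF L gG gG] gG ab
      by (auto simp: inj_on_def)
    then show ?thesis using y by (metis compose_eq)
  qed
  have bij: "bij_betw (g a e) L L" and hom: "chom L (g a e)" if "a \<in> {0..<5}" for a e
    using gG[OF that] galois_group_iff[OF L] by blast+
  have gL: "g a e y \<in> L" if "a \<in> {0..<5}" "y \<in> L" for a e y
    using bij_betw_apply[OF bij] that by blast
  define r where "r = g 1 False"
  define s where "s = g 0 True"
  have rL: "r y \<in> L" and sL: "s y \<in> L" if "y \<in> L" for y
    using gL that by (simp_all add: r_def s_def)
  \<comment> \<open>The pair (0, False) is idempotent, hence so is this map; as it is injective, it
    is the identity.\<close>
  have id: "g 0 False y = y" if y: "y \<in> L" for y
  proof -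
    have "g 0 False (g 0 False y) = g 0 False y" using g_mult[of 0 0 y False False] y by simp
    then show ?thesis
      using bij_betw_imp_inj_on[OF bij[of 0 False]] gL[of 0 y False] y by (auto simp: inj_on_def)
  qed
  have g2: "g 2 False y = r (r y)" if "y \<in> L" for y
    using g_mult[of 1 1 y False False] that by (simp add: r_def)
  have g3: "g 3 False y = r (r (r y))" if "y \<in> L" for y
    using g_mult[of 2 1 y False False] that g2[OF rL[OF that]] by (simp add: r_def)
  have g4: "g 4 False y = r (r (r (r y)))" if "y \<in> L" for y
    using g_mult[of 3 1 y False False] that g3[OF rL[OF that]] by (simp add: r_def)
  have r5: "r (r (r (r (r y)))) = y" if "y \<in> L" for y
    using g_mult[of 4 1 y False False] that g4[OF rL[OF that]] id[OF that] by (simp add: r_def)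
  have s2: "s (s y) = y" if "y \<in> L" for y
    using g_mult[of 0 0 y True True] that id[OF that] by (simp add: s_def)
  have gT: "g a True y = g a False (s y)" if "a \<in> {0..<5}" "y \<in> L" for a y
    using g_mult[of a 0 y False True] that by (simp add: s_def)
  have sr: "s (r y) = r (r (r (r (s y))))" if "y \<in> L" for y
    using g_mult[of 0 1 y True False] that gT[of 4 y] g4[OF sL[OF that]] by (simp add: s_def r_def)
  have "y \<in> \<rat>" if y: "y \<in> L" "r y = y" "s y = y" for y
  proof (rule fixed[OF y(1)])
    fix k assume k: "k \<in> carrier ?G"
    obtain a e where ae: "h k = (a, e)" by (cases "h k")
    then have a: "a \<in> {0..<5}" using bij_betw_apply[OF h(2) k] by (simp add: cD)
    have "k = g a e"
      using bij_betw_inv_into_left[OF h(2) k] ae by (simp add: g_def)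
    moreover have "g a False y = y"
    proof -
      have "a = 0 \<or> a = 1 \<or> a = 2 \<or> a = 3 \<or> a = 4" using a by auto
      then show ?thesis using id[OF y(1)] g2[OF y(1)] g3[OF y(1)] g4[OF y(1)] y(2) by (auto simp: r_def)
    qed
    ultimately show "k y = y" using gT[OF a y(1)] y(3) by (cases e) simp_all
  qed
  then show ?thesis
    using that[of r s] r5 s2 sr bij[of 1 False] bij[of 0 True] hom[of 1 False] hom[of 0 True]
    by (simp add: r_def[symmetric] s_def[symmetric])
qed

text \<open>Everything that is used of the Galois group from here on: a field L containing the
  conjugates, a rotation r, a reflection s fixing x0, and the rationality of whatever both of them
  fix.\<close>

definition d5_conjugates :: "complex \<Rightarrow> complex \<Rightarrow> complex \<Rightarrow> complex \<Rightarrow> complex \<Rightarrow> complex \<Rightarrow> bool" where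
  "d5_conjugates x x0 x1 x2 x3 x4 \<longleftrightarrow>
     conjugates x = {x0, x1, x2, x3, x4} \<and> distinct [x0, x1, x2, x3, x4] \<and>
     (\<exists>L r s. csubfield L \<and> {x0, x1, x2, x3, x4} \<subseteq> L \<and> chom L r \<and> chom L s \<and>
        r x0 = x1 \<and> r x1 = x2 \<and> r x2 = x3 \<and> r x3 = x4 \<and> r x4 = x0 \<and>
        s x0 = x0 \<and> s x1 = x4 \<and> s x2 = x3 \<and> s x3 = x2 \<and> s x4 = x1 \<and>
        (\<forall>y\<in>L. r y = y \<longrightarrow> s y = y \<longrightarrow> y \<in> \<rat>))"

lemma degree_le_imp_card_conjugates_le:
  assumes "p \<noteq> 0" "qev p y = 0" shows "card (conjugates y) \<le> degree p"
proof -
  have alg: "algebraic y" using assms algebraic_iff_qev by blast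
  obtain m where m: "Factorial_Ring.irreducible m" "qev m y = 0" using minimal_polynomial[OF alg] by blast
  have "m dvd p" by (rule irreducible_root_imp_dvd[OF m assms(2)])
  then have "degree m \<le> degree p" using assms(1) by (rule dvd_imp_degree_le)
  then show ?thesis using card_roots_irreducible[OF m(1)] conjugates_eq_roots[OF m] by simp
qed

text \<open>A map of order 5 without fixed points makes the five conjugates a single orbit. On a
  5-cycle each dihedral reflection fixes one point, and that point is taken as x0.\<close>

lemma d5_conjugates_exist:
  assumes x: "algebraic x" and card: "card (conjugates x) = 5"
    and iso: "galois_group (galois_closure (simple_ext x)) \<cong> dihedral_group 5"
  obtains x0 x1 x2 x3 x4 where "d5_conjugates x x0 x1 x2 x3 x4"
proof -
  obtain \<psi> where \<psi>: "algebraic \<psi>" "conjugates x \<subseteq> simple_ext \<psi>" "conjugates \<psi> \<subseteq> simple_ext \<psi>"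
    "\<forall>F. csubfield F \<longrightarrow> conjugates x \<subseteq> F \<longrightarrow> \<psi> \<in> F"
    by (rule splitting_field[OF x]) blast
  define L where "L = simple_ext \<psi>"
  have L: "csubfield L" unfolding L_def by (rule csubfield_simple_ext[OF \<psi>(1)])
  have iso': "galois_group L \<cong> dihedral_group 5"
    using iso galois_closure_simple_ext[OF x \<psi>] by (simp add: L_def)
  obtain r s where r: "chom L r" "bij_betw r L L" and s: "chom L s" "bij_betw s L L"
    and r5: "\<And>y. y \<in> L \<Longrightarrow> r (r (r (r (r y)))) = y" and s2: "\<And>y. y \<in> L \<Longrightarrow> s (s y) = y"
    and sr: "\<And>y. y \<in> L \<Longrightarrow> s (r y) = r (r (r (r (s y))))"
    and fixed: "\<And>y. y \<in> L \<Longrightarrow> r y = y \<Longrightarrow> s y = y \<Longrightarrow> y \<in> \<rat>"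
    using dihedral_generators[OF L iso'] galois_group_fixed[OF \<psi>(1,3)] unfolding L_def by blast
  define R where "R = conjugates x"
  have RL: "y \<in> L" if "y \<in> R" for y using that \<psi>(2) by (auto simp: R_def L_def)
  have conj_R: "conjugates y = R" if "y \<in> R" for y
    using conjugates_eq[OF x that[unfolded R_def]] by (simp add: R_def)
  have rR: "r y \<in> R" and sR: "s y \<in> R" if "y \<in> R" for y
    using chom_conjugate[OF L r(1) RL[OF that]] chom_conjugate[OF L s(1) RL[OF that]] conj_R[OF that]
    by blast+
  \<comment> \<open>If r fixed y it would fix \<open>s y\<close> too. The sum and product of y and
    \<open>s y\<close> would then be fixed by both maps, hence rational, and y would have at most
    two conjugates.\<close>
  have no_fix: "r y \<noteq> y" if y: "y \<in> R" for y
  proof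
    assume ry: "r y = y"
    let ?z = "s y"
    have yL: "y \<in> L" "?z \<in> L" using RL sR y by blast+
    have "r (r (r (r ?z))) = ?z" using sr[OF yL(1)] ry by simp
    then have rz: "r ?z = ?z" using r5[OF yL(2)] by simp
    have "y + ?z \<in> \<rat>"
      by (rule fixed) (use yL rz ry s2 csubfieldD(3)[OF L] in \<open>simp_all add: chomD(3)[OF L r(1)] chomD(3)[OF L s(1)]\<close>)
    moreover have "y * ?z \<in> \<rat>"
      by (rule fixed) (use yL rz ry s2 csubfieldD(5)[OF L] in \<open>simp_all add: chomD(5)[OF L r(1)] chomD(5)[OF L s(1)]\<close>)
    ultimately obtain a b where ab: "y + ?z = of_rat a" "y * ?z = of_rat b" by (auto elim!: Rats_cases)
    let ?p = "[:b, - a, 1:] :: rat poly"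
    have "qev ?p y = 0"
      by (simp add: of_rat_minus algebra_simps flip: ab)
    then have "card (conjugates y) \<le> degree ?p" by (intro degree_le_imp_card_conjugates_le) auto
    then show False using conj_R[OF y] card by (simp add: R_def)
  qed
  have r2: "r (r y) \<noteq> y" if y: "y \<in> R" for y
    using no_fix[OF y] r5[OF RL[OF y]] by metis
  have r3: "r (r (r y)) \<noteq> y" if y: "y \<in> R" for y
    using no_fix[OF y] r5[OF RL[OF y]] by metis
  have r4: "r (r (r (r y))) \<noteq> y" if y: "y \<in> R" for y
    using no_fix[OF y] r5[OF RL[OF y]] by metis
  define orb where "orb = (\<lambda>y. {y, r y, r (r y), r (r (r y)), r (r (r (r y)))})"
  have dist: "distinct [y, r y, r (r y), r (r (r y)), r (r (r (r y)))]" if y: "y \<in> R" for y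
  proof -
    note y1 = rR[OF y] and y2 = rR[OF rR[OF y]] and y3 = rR[OF rR[OF rR[OF y]]]
    show ?thesis
      using no_fix[OF y] no_fix[OF y1] no_fix[OF y2] no_fix[OF y3] r2[OF y] r2[OF y1] r2[OF y2]
        r3[OF y] r3[OF y1] r4[OF y] by auto
  qed
  have orb: "orb y = R" if y: "y \<in> R" for y
  proof (rule card_subset_eq)
    show "finite R" using finite_conjugates[OF x] by (simp add: R_def)
    show "orb y \<subseteq> R" using rR y by (auto simp: orb_def)
    have "card (orb y) = 5" using distinct_card[OF dist[OF y]] by (simp add: orb_def)
    then show "card (orb y) = card R" using card by (simp add: R_def)
  qed
  have rL: "r y \<in> L" and sL: "s y \<in> L" if "y \<in> L" for y
    using bij_betw_apply[OF r(2) that] bij_betw_apply[OF s(2) that] by blast+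
  \<comment> \<open>If s x = r^k x, then s sends r^j x to r^(k-j) x, so a fixed point arises when 2
    j = k modulo 5: j = 3, 1, 4, 2 for k = 1, 2, 3, 4.\<close>
  obtain x0 where x0: "x0 \<in> R" "s x0 = x0"
  proof -
    have xR: "x \<in> R" by (simp add: R_def)
    then have xL: "x \<in> L" by (rule RL)
    have "s x \<in> orb x" using orb[OF xR] sR[OF xR] by simp
    then consider "s x = x" | "s x = r x" | "s x = r (r x)" | "s x = r (r (r x))" | "s x = r (r (r (r x)))"
      by (auto simp: orb_def)
    then show ?thesis
    proof cases
      case 1
      then show ?thesis using that xR by blast
    next
      case 2
      have "s (r (r (r x))) = r (r (r x))"
        using xL rL sL 2 by (simp add: sr r5)
      then show ?thesis using that[of "r (r (r x))"] rR xR by blast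
    next
      case 3
      have "s (r x) = r x" using xL rL sL 3 by (simp add: sr r5)
      then show ?thesis using that rR xR by blast
    next
      case 4
      have "s (r (r (r (r x)))) = r (r (r (r x)))" using xL rL sL 4 by (simp add: sr r5)
      then show ?thesis using that[of "r (r (r (r x)))"] rR xR by blast
    next
      case 5
      have "s (r (r x)) = r (r x)" using xL rL sL 5 by (simp add: sr r5)
      then show ?thesis using that[of "r (r x)"] rR xR by blast
    qed
  qed
  have x0L: "x0 \<in> L" by (rule RL[OF x0(1)])
  have s_orb: "s (r x0) = r (r (r (r x0)))" "s (r (r x0)) = r (r (r x0))" "s (r (r (r x0))) = r (r x0)"
      "s (r (r (r (r x0)))) = r x0"
    using x0(2) x0L rL by (simp_all add: sr r5)
  have "\<forall>y\<in>L. r y = y \<longrightarrow> s y = y \<longrightarrow> y \<in> \<rat>" using fixed by blast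
  moreover have "{x0, r x0, r (r x0), r (r (r x0)), r (r (r (r x0)))} \<subseteq> L" using x0L rL by simp
  moreover have "conjugates x = {x0, r x0, r (r x0), r (r (r x0)), r (r (r (r x0)))}"
    using orb[OF x0(1)] by (simp add: orb_def R_def)
  ultimately have "d5_conjugates x x0 (r x0) (r (r x0)) (r (r (r x0))) (r (r (r (r x0))))"
    unfolding d5_conjugates_def using L r(1) s(1) x0(2) r5[OF x0L] s_orb dist[OF x0(1)] by blast
  then show ?thesis by (rule that)
qed

section \<open>The quadratic field generated by the square root of 5\<close>

lemma qsqrt5_conj_mult:
  assumes "x \<in> qsqrt5" "y \<in> qsqrt5"
  shows "qsqrt5_conj (x * y) = qsqrt5_conj x * qsqrt5_conj y" "x * y \<in> qsqrt5"
proof -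
  obtain a b c d where xy: "x = of_rat a + of_rat b * sqrt 5" "y = of_rat c + of_rat d * sqrt 5"
    using assms by (auto simp: qsqrt5_def)
  have sq: "sqrt 5 * (sqrt 5 * z) = 5 * z" for z :: real by (simp flip: mult.assoc)
  have "x * y = of_rat (a * c + 5 * b * d) + of_rat (a * d + b * c) * sqrt 5"
    unfolding xy by (simp add: of_rat_add of_rat_mult algebra_simps sq)
  moreover have "(of_rat a - of_rat b * sqrt 5) * (of_rat c - of_rat d * sqrt 5) =
      of_rat (a * c + 5 * b * d) - of_rat (a * d + b * c) * sqrt 5"
    by (simp add: of_rat_add of_rat_mult algebra_simps sq)
  ultimately show "qsqrt5_conj (x * y) = qsqrt5_conj x * qsqrt5_conj y" "x * y \<in> qsqrt5"
    unfolding xy qsqrt5_conj_eq by (auto simp: qsqrt5_conj_eq qsqrt5_def simp del: of_rat_add of_rat_mult)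
qed

lemma qsqrt5_conj_diff:
  assumes "x \<in> qsqrt5" "y \<in> qsqrt5"
  shows "qsqrt5_conj (x - y) = qsqrt5_conj x - qsqrt5_conj y"
proof -
  obtain a b c d where xy: "x = of_rat a + of_rat b * sqrt 5" "y = of_rat c + of_rat d * sqrt 5"
    using assms by (auto simp: qsqrt5_def)
  have "x - y = of_rat (a - c) + of_rat (b - d) * sqrt 5"
    unfolding xy by (simp add: of_rat_diff algebra_simps)
  then have "qsqrt5_conj (x - y) = of_rat (a - c) - of_rat (b - d) * sqrt 5"
    by (simp only: qsqrt5_conj_eq)
  then show ?thesis unfolding xy qsqrt5_conj_eq by (simp add: of_rat_diff algebra_simps)
qed

lemma qsqrt5_conj_in:
  assumes "x \<in> qsqrt5" shows "qsqrt5_conj x \<in> qsqrt5" "qsqrt5_conj (qsqrt5_conj x) = x"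
proof -
  obtain a b where x: "x = of_rat a + of_rat b * sqrt 5" using assms by (auto simp: qsqrt5_def)
  have c: "qsqrt5_conj x = of_rat a + of_rat (- b) * sqrt 5" unfolding x qsqrt5_conj_eq by (simp add: of_rat_minus)
  then show "qsqrt5_conj x \<in> qsqrt5" unfolding qsqrt5_def by blast
  show "qsqrt5_conj (qsqrt5_conj x) = x" unfolding c qsqrt5_conj_eq by (simp add: x of_rat_minus)
qed

lemma qsqrt5_numeral: "numeral k \<in> qsqrt5" "qsqrt5_conj (numeral k) = numeral k"
proof -
  have "numeral k = of_rat (numeral k) + of_rat 0 * sqrt 5" by simp
  then show "numeral k \<in> qsqrt5" unfolding qsqrt5_def by blast
  show "qsqrt5_conj (numeral k) = numeral k" using qsqrt5_conj_eq[of "numeral k" 0] by simp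
qed

text \<open>This is 2 cos(2 pi / 5), the reciprocal of the number usually called the golden ratio.
  Together with \<open>golden'\<close> it gives the two roots of t^2 + t - 1.\<close>

definition golden :: real where "golden = (sqrt 5 - 1) / 2"
definition golden' :: real where "golden' = (- sqrt 5 - 1) / 2"

text \<open>A and B arise as integer combinations of 1, \<zeta> + \<zeta>^4 and \<zeta>^2 +
  \<zeta>^3. In this redundant form integrality is evident and conjugation merely exchanges the last
  two numbers.\<close>

lemma golden_integers:
  fixes u v w :: int
  defines "z \<equiv> of_int u + of_int v * golden + of_int w * golden'"
  shows "z \<in> qsqrt5_integers" "qsqrt5_conj z = of_int u + of_int v * golden' + of_int w * golden"
proof -
  have rats: "of_rat (of_int u - of_int v / 2 - of_int w / 2) = (of_int u - of_int v / 2 - of_int w / 2 :: real)"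
    "of_rat ((of_int v - of_int w) / 2) = ((of_int v - of_int w) / 2 :: real)"
    by (simp_all add: of_rat_diff of_rat_divide)
  have z: "z = of_rat (of_int u - of_int v / 2 - of_int w / 2) + of_rat ((of_int v - of_int w) / 2) * sqrt 5"
    unfolding rats by (simp add: z_def golden_def golden'_def field_simps)
  then have "z \<in> qsqrt5" unfolding qsqrt5_def by blast
  have root: "algebraic_int (complex_of_real t)" if "t * t + t - 1 = 0" for t
  proof (rule algebraic_int.intros[of "[:-1, 1, 1:]"])
    have "complex_of_real (t * t + t - 1) = 0" using that by simp
    then show "poly [:- 1, 1, 1:] (complex_of_real t) = 0" by (simp add: algebra_simps)
  qed (auto simp: coeff_pCons split: nat.splits)
  have "golden * golden + golden - 1 = 0" "golden' * golden' + golden' - 1 = 0"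
    by (simp_all add: golden_def golden'_def field_simps)
  then have "algebraic_int (complex_of_real golden)" "algebraic_int (complex_of_real golden')"
    using root by blast+
  then have "algebraic_int (of_int u + of_int v * complex_of_real golden + of_int w * complex_of_real golden')"
    by (intro algebraic_int_plus_times algebraic_int_of_int)
  then have "algebraic_int (complex_of_real z)" by (simp add: z_def)
  with \<open>z \<in> qsqrt5\<close> show "z \<in> qsqrt5_integers" by (simp add: qsqrt5_integers_def)
  show "qsqrt5_conj z = of_int u + of_int v * golden' + of_int w * golden"
    unfolding z qsqrt5_conj_eq unfolding rats by (simp add: golden_def golden'_def field_simps)
qed

section \<open>Lagrange resolvents\<close>

definition zeta :: complex where "zeta = cis (2 * pi / 5)"

lemma zeta_pow5: "zeta ^ 5 = 1"
  unfolding zeta_def by (simp add: DeMoivre)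

lemma zeta_sum: "1 + zeta + zeta ^ 2 + zeta ^ 3 + zeta ^ 4 = 0"
proof -
  have "sin (2 * pi / 5) > 0" by (rule sin_gt_zero) (auto simp: pi_gt_zero)
  then have "Im zeta \<noteq> 0" by (simp add: zeta_def)
  then have "zeta - 1 \<noteq> 0" by auto
  moreover have "(zeta - 1) * (1 + zeta + zeta ^ 2 + zeta ^ 3 + zeta ^ 4) = zeta ^ 5 - 1"
    by (simp add: algebra_simps eval_nat_numeral)
  ultimately show ?thesis using zeta_pow5 by simp
qed

lemma norm_zeta [simp]: "norm zeta = 1"
  by (simp add: zeta_def)

text \<open>The number c = \<zeta> + 1/\<zeta> satisfies c^2 + c - 1 = 0, and positivity of the
  cosine selects the root.\<close>

lemma zeta_golden: "zeta + zeta ^ 4 = of_real golden" "zeta ^ 2 + zeta ^ 3 = of_real golden'"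
proof -
  have "zeta * cnj zeta = zeta * zeta ^ 4"
    using zeta_pow5 complex_norm_square[of zeta] by (simp add: eval_nat_numeral)
  then have cnj: "zeta ^ 4 = cnj zeta" by (metis mult_cancel_left norm_zeta norm_zero zero_neq_one)
  define c where "c = 2 * cos (2 * pi / 5)"
  have c: "zeta + zeta ^ 4 = of_real c"
    unfolding cnj by (simp add: c_def zeta_def complex_eq_iff)
  have other: "zeta ^ 2 + zeta ^ 3 = - 1 - of_real c"
  proof -
    have "zeta ^ 2 + zeta ^ 3 = (1 + zeta + zeta ^ 2 + zeta ^ 3 + zeta ^ 4) - 1 - (zeta + zeta ^ 4)" by simp
    then show ?thesis unfolding zeta_sum c by simp
  qed
  have "(zeta + zeta ^ 4) * (zeta + zeta ^ 4) = zeta ^ 2 + 2 * zeta ^ 5 + zeta ^ 5 * zeta ^ 3"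
    by (simp add: algebra_simps eval_nat_numeral)
  also have "\<dots> = 2 + (zeta ^ 2 + zeta ^ 3)" using zeta_pow5 by simp
  finally have "complex_of_real (c * c) = of_real (1 - c)" unfolding c other by simp
  then have "c * c = 1 - c" by (simp only: of_real_eq_iff)
  then have "(2 * c + 1)\<^sup>2 = 5" by (simp add: power2_eq_square algebra_simps)
  moreover have "c > 0" unfolding c_def using cos_gt_zero[of "2 * pi / 5"] pi_gt_zero by (simp add: field_simps)
  ultimately have "2 * c + 1 = sqrt 5" using real_sqrt_unique[of "2 * c + 1" 5] by simp
  then have "c = golden" by (simp add: golden_def field_simps)
  have g: "golden' = - 1 - golden" by (simp add: golden_def golden'_def field_simps)
  show "zeta + zeta ^ 4 = of_real golden" using c \<open>c = golden\<close> by simp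
  show "zeta ^ 2 + zeta ^ 3 = of_real golden'" unfolding other g \<open>c = golden\<close> by simp
qed

lemma golden_irrational:
  "of_real golden \<notin> (\<rat> :: complex set)" "of_real golden' \<notin> (\<rat> :: complex set)"
proof -
  have "t \<in> \<rat>" if "complex_of_real t \<in> \<rat>" for t
  proof -
    obtain a b where ab: "complex_of_real t = of_int a / of_int b" using \<open>complex_of_real t \<in> \<rat>\<close> by (auto elim!: Rats_cases')
    then have "complex_of_real t = of_real (of_int a / of_int b)" by simp
    then have "t = of_int a / of_int b" by (simp only: of_real_eq_iff)
    then show ?thesis by simp
  qed
  moreover have "golden \<notin> \<rat>"
  proof
    assume "golden \<in> \<rat>"
    then have "2 * golden + 1 \<in> \<rat>" by simp
    then show False using sqrt5_irrational by (simp add: golden_def)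
  qed
  moreover have "golden' \<notin> \<rat>"
  proof
    assume "golden' \<in> \<rat>"
    then have "- (2 * golden' + 1) \<in> \<rat>" by (simp del: minus_add_distrib)
    then show False using sqrt5_irrational by (simp add: golden'_def)
  qed
  ultimately show "of_real golden \<notin> (\<rat> :: complex set)" "of_real golden' \<notin> (\<rat> :: complex set)" by blast+
qed

text \<open>The polynomial X^5 - 1 is split explicitly, inverse roots being paired into quadratic
  factors.\<close>

lemma fifth_root_cases:
  assumes "\<eta> ^ 5 = (1 :: complex)"
  shows "\<eta> = 1 \<or> \<eta> = zeta \<or> \<eta> = zeta ^ 2 \<or> \<eta> = zeta ^ 3 \<or> \<eta> = zeta ^ 4"
proof -
  have z5: "zeta * zeta ^ 4 = 1" "zeta ^ 2 * zeta ^ 3 = 1"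
    using zeta_pow5 by (simp_all add: eval_nat_numeral mult_ac)
  define a b where "a = zeta + zeta ^ 4" and "b = zeta ^ 2 + zeta ^ 3"
  have ab: "a + b = - 1" using zeta_sum by (simp add: a_def b_def algebra_simps add_eq_0_iff)
  have "a * b = zeta ^ 3 + zeta ^ 4 + zeta ^ 5 * zeta + zeta ^ 5 * zeta ^ 2"
    by (simp add: a_def b_def algebra_simps eval_nat_numeral)
  then have ab': "a * b = - 1" using zeta_pow5 ab by (simp add: a_def b_def algebra_simps)
  have "(\<eta> - zeta) * (\<eta> - zeta ^ 4) = \<eta> ^ 2 - a * \<eta> + zeta * zeta ^ 4"
    "(\<eta> - zeta ^ 2) * (\<eta> - zeta ^ 3) = \<eta> ^ 2 - b * \<eta> + zeta ^ 2 * zeta ^ 3"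
    by (simp_all add: a_def b_def algebra_simps power2_eq_square)
  then have "(\<eta> - zeta) * (\<eta> - zeta ^ 4) * ((\<eta> - zeta ^ 2) * (\<eta> - zeta ^ 3)) =
      (\<eta> ^ 2 - a * \<eta> + 1) * (\<eta> ^ 2 - b * \<eta> + 1)" unfolding z5 by simp
  also have "\<dots> = \<eta> ^ 4 - (a + b) * \<eta> ^ 3 + (2 + a * b) * \<eta> ^ 2 - (a + b) * \<eta> + 1"
    by (simp add: algebra_simps eval_nat_numeral)
  also have "\<dots> = \<eta> ^ 4 + \<eta> ^ 3 + \<eta> ^ 2 + \<eta> + 1" unfolding ab ab' by simp
  finally have "(\<eta> - 1) * ((\<eta> - zeta) * (\<eta> - zeta ^ 4) * ((\<eta> - zeta ^ 2) * (\<eta> - zeta ^ 3))) = \<eta> ^ 5 - 1"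
    by (simp add: algebra_simps eval_nat_numeral)
  then show ?thesis using assms by auto
qed

section \<open>Resolvents as a Fourier transform on five points\<close>

definition resolvent :: "complex \<Rightarrow> complex \<Rightarrow> complex \<Rightarrow> complex \<Rightarrow> complex \<Rightarrow> complex \<Rightarrow> complex" where
  "resolvent t x0 x1 x2 x3 x4 = x0 + x1 * t + x2 * t ^ 2 + x3 * t ^ 3 + x4 * t ^ 4"

text \<open>Multiplication in the group ring of the cyclic group of order 5: coefficients are
  convolved cyclically, and the two sides differ by an explicit multiple of t^5 - 1.\<close>

lemma cyclic_product:
  assumes "t ^ 5 = 1"
  shows "resolvent t c0 c1 c2 c3 c4 * resolvent t d0 d1 d2 d3 d4 = resolvent t
    (c0 * d0 + c1 * d4 + c2 * d3 + c3 * d2 + c4 * d1) (c0 * d1 + c1 * d0 + c2 * d4 + c3 * d3 + c4 * d2)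
    (c0 * d2 + c1 * d1 + c2 * d0 + c3 * d4 + c4 * d3) (c0 * d3 + c1 * d2 + c2 * d1 + c3 * d0 + c4 * d4)
    (c0 * d4 + c1 * d3 + c2 * d2 + c3 * d1 + c4 * d0)"
    (is "?lhs = ?rhs")
proof -
  have "?lhs = ?rhs + (t ^ 5 - 1) * ((c1 * d4 + c2 * d3 + c3 * d2 + c4 * d1) + (c2 * d4 + c3 * d3 + c4 * d2) * t +
      (c3 * d4 + c4 * d3) * t ^ 2 + c4 * d4 * t ^ 3)"
    by (simp add: resolvent_def algebra_simps eval_nat_numeral)
  then show ?thesis using assms by simp
qed

lemma fifth_root_powers:
  assumes "t ^ 5 = (1 :: complex)"
  shows "t ^ 6 = t" "t ^ 8 = t ^ 3" "t ^ 9 = t ^ 4" "t ^ 12 = t ^ 2" "t ^ 16 = t"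
proof -
  have "t ^ (k + 5) = t ^ k" for k using assms by (simp add: power_add)
  from this[of 1] this[of 3] this[of 4] this[of 2] this[of 7] this[of 6] this[of 11]
  show "t ^ 6 = t" "t ^ 8 = t ^ 3" "t ^ 9 = t ^ 4" "t ^ 12 = t ^ 2" "t ^ 16 = t" by simp_all
qed

lemma resolvent_power:
  assumes "t ^ 5 = 1"
  shows "resolvent (t ^ 2) x0 x1 x2 x3 x4 = resolvent t x0 x3 x1 x4 x2"
    and "resolvent (t ^ 3) x0 x1 x2 x3 x4 = resolvent t x0 x2 x4 x1 x3"
    and "resolvent (t ^ 4) x0 x1 x2 x3 x4 = resolvent t x0 x4 x3 x2 x1"
  unfolding resolvent_def by (simp_all flip: power_mult add: fifth_root_powers[OF assms])

lemma resolvent_shift: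
  assumes "t ^ 5 = 1"
  shows "t * resolvent t x0 x1 x2 x3 x4 = resolvent t x4 x0 x1 x2 x3"
proof -
  have "t * resolvent t x0 x1 x2 x3 x4 = resolvent t x4 x0 x1 x2 x3 + x4 * (t ^ 5 - 1)"
    by (simp add: resolvent_def algebra_simps eval_nat_numeral)
  then show ?thesis using assms by simp
qed

abbreviation res :: "nat \<Rightarrow> complex \<Rightarrow> complex \<Rightarrow> complex \<Rightarrow> complex \<Rightarrow> complex \<Rightarrow> complex" where
  "res k \<equiv> resolvent (zeta ^ k)"

lemma zeta_pow_pow5: "(zeta ^ k) ^ 5 = 1"
  using power_mult[of zeta 5 k] power_mult[of zeta k 5] zeta_pow5 by (simp add: mult.commute)

lemma resolvent_inversion:
  assumes "x0 + x1 + x2 + x3 + x4 = 0"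
  shows "res 1 x0 x1 x2 x3 x4 + res 2 x0 x1 x2 x3 x4 + res 3 x0 x1 x2 x3 x4 + res 4 x0 x1 x2 x3 x4 = 5 * x0"
proof -
  have "res 1 x0 x1 x2 x3 x4 + res 2 x0 x1 x2 x3 x4 + res 3 x0 x1 x2 x3 x4 + res 4 x0 x1 x2 x3 x4 =
      5 * x0 - (x0 + x1 + x2 + x3 + x4) + (x1 + x2 + x3 + x4) * (1 + zeta + zeta ^ 2 + zeta ^ 3 + zeta ^ 4)"
    unfolding resolvent_power[OF zeta_pow5] power_one_right unfolding resolvent_def by (simp add: algebra_simps)
  then show ?thesis using assms zeta_sum by simp
qed

text \<open>Multiplying the j-th resolvent by \<zeta>^(k j) gives the resolvent of the rotated
  sequence starting with x_(-k), so the inversion formula returns that element.\<close>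

lemma resolvent_inversion_power:
  assumes "x0 + x1 + x2 + x3 + x4 = 0"
  defines "f \<equiv> (\<lambda>\<eta>. \<eta> ^ 1 * res 1 x0 x1 x2 x3 x4 + \<eta> ^ 2 * res 2 x0 x1 x2 x3 x4 +
      \<eta> ^ 3 * res 3 x0 x1 x2 x3 x4 + \<eta> ^ 4 * res 4 x0 x1 x2 x3 x4)"
  shows "f 1 = 5 * x0" "f zeta = 5 * x4" "f (zeta ^ 2) = 5 * x3" "f (zeta ^ 3) = 5 * x2" "f (zeta ^ 4) = 5 * x1"
proof -
  note sh = resolvent_shift[OF zeta_pow_pow5]
  have iter: "(zeta ^ 2) ^ k * w = zeta ^ k * (zeta ^ k * w)"
    "(zeta ^ 3) ^ k * w = zeta ^ k * (zeta ^ k * (zeta ^ k * w))"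
    "(zeta ^ 4) ^ k * w = zeta ^ k * (zeta ^ k * (zeta ^ k * (zeta ^ k * w)))" for k w
    by (simp_all add: power2_eq_square power3_eq_cube power4_eq_xxxx power_mult_distrib mult.assoc)
  show "f 1 = 5 * x0" using resolvent_inversion[OF assms(1)] by (simp add: f_def)
  show "f zeta = 5 * x4"
    unfolding f_def sh by (rule resolvent_inversion) (use assms(1) in \<open>simp add: algebra_simps\<close>)
  show "f (zeta ^ 2) = 5 * x3"
    unfolding f_def iter sh by (rule resolvent_inversion) (use assms(1) in \<open>simp add: algebra_simps\<close>)
  show "f (zeta ^ 3) = 5 * x2"
    unfolding f_def iter sh by (rule resolvent_inversion) (use assms(1) in \<open>simp add: algebra_simps\<close>)
  show "f (zeta ^ 4) = 5 * x1"
    unfolding f_def iter sh by (rule resolvent_inversion) (use assms(1) in \<open>simp add: algebra_simps\<close>)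
qed

text \<open>\<open>quad_sum m\<close> collects the products \<open>x\<^sub>i x\<^sub>j\<close> with \<open>j - i = m\<close>, every \<open>m > 2\<close> being read as 2. With \<open>p\<^sub>k\<close> the sum of the
  \<open>x\<^sub>i x\<^sub>j x\<^sub>l\<close> over \<open>i + j + 3 l = k\<close> (indices modulo 5), \<open>cubic0\<close> is \<open>p\<^sub>0\<close> and \<open>cubic1\<close> is \<open>p\<^sub>1\<close>;
  \<open>p\<^sub>m\<close> is \<open>cubic1\<close> applied to the \<open>x\<^sub>m\<^sub>i\<close>.\<close>

definition quad_sum :: "nat \<Rightarrow> complex \<Rightarrow> complex \<Rightarrow> complex \<Rightarrow> complex \<Rightarrow> complex \<Rightarrow> complex" where
  "quad_sum m x0 x1 x2 x3 x4 =
    (if m = 0 then x0 * x0 + x1 * x1 + x2 * x2 + x3 * x3 + x4 * x4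
     else if m = 1 then x0 * x1 + x1 * x2 + x2 * x3 + x3 * x4 + x4 * x0
     else x0 * x2 + x1 * x3 + x2 * x4 + x3 * x0 + x4 * x1)"

definition cubic0 :: "complex \<Rightarrow> complex \<Rightarrow> complex \<Rightarrow> complex \<Rightarrow> complex \<Rightarrow> complex" where
  "cubic0 x0 x1 x2 x3 x4 = (x0 * x0 + 2 * x1 * x4 + 2 * x2 * x3) * x0 + (2 * x0 * x1 + 2 * x2 * x4 + x3 * x3) * x3 +
    (x1 * x1 + 2 * x0 * x2 + 2 * x3 * x4) * x1 + (2 * x0 * x3 + 2 * x1 * x2 + x4 * x4) * x4 +
    (x2 * x2 + 2 * x0 * x4 + 2 * x1 * x3) * x2"

definition cubic1 :: "complex \<Rightarrow> complex \<Rightarrow> complex \<Rightarrow> complex \<Rightarrow> complex \<Rightarrow> complex" where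
  "cubic1 x0 x1 x2 x3 x4 = (x0 * x0 + 2 * x1 * x4 + 2 * x2 * x3) * x2 + (2 * x0 * x1 + 2 * x2 * x4 + x3 * x3) * x0 +
    (x1 * x1 + 2 * x0 * x2 + 2 * x3 * x4) * x3 + (2 * x0 * x3 + 2 * x1 * x2 + x4 * x4) * x1 +
    (x2 * x2 + 2 * x0 * x4 + 2 * x1 * x3) * x4"

lemma resolvent_quadratic:
  assumes "t ^ 5 = 1"
  shows "resolvent t x0 x1 x2 x3 x4 * resolvent (t ^ 4) x0 x1 x2 x3 x4 =
    quad_sum 0 x0 x1 x2 x3 x4 + quad_sum 1 x0 x1 x2 x3 x4 * (t + t ^ 4) + quad_sum 2 x0 x1 x2 x3 x4 * (t ^ 2 + t ^ 3)"
  unfolding resolvent_power[OF assms] cyclic_product[OF assms]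
  by (simp add: resolvent_def quad_sum_def algebra_simps)

lemma resolvent_cubic:
  assumes "t ^ 5 = 1"
  shows "resolvent t x0 x1 x2 x3 x4 * resolvent t x0 x1 x2 x3 x4 * resolvent (t ^ 3) x0 x1 x2 x3 x4 =
    cubic0 x0 x1 x2 x3 x4 + cubic1 x0 x1 x2 x3 x4 * t + cubic1 x0 x2 x4 x1 x3 * t ^ 2 +
    cubic1 x0 x3 x1 x4 x2 * t ^ 3 + cubic1 x0 x4 x3 x2 x1 * t ^ 4"
proof -
  have "resolvent t x0 x1 x2 x3 x4 * resolvent t x0 x1 x2 x3 x4 * resolvent (t ^ 3) x0 x1 x2 x3 x4 =
    resolvent t (cubic0 x0 x1 x2 x3 x4) (cubic1 x0 x1 x2 x3 x4) (cubic1 x0 x2 x4 x1 x3)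
      (cubic1 x0 x3 x1 x4 x2) (cubic1 x0 x4 x3 x2 x1)"
    unfolding resolvent_power[OF assms] cyclic_product[OF assms]
    by (intro cong[OF cong[OF cong[OF cong[OF cong[OF refl[of "resolvent t"]]]]]])
       (simp_all add: cubic0_def cubic1_def algebra_simps)
  then show ?thesis by (simp add: resolvent_def)
qed

lemma quad_sum_symmetric:
  "quad_sum m x1 x2 x3 x4 x0 = quad_sum m x0 x1 x2 x3 x4"
  "quad_sum m x0 x4 x3 x2 x1 = quad_sum m x0 x1 x2 x3 x4"
  by (auto simp: quad_sum_def algebra_simps)

lemma cubic_symmetric:
  "cubic0 x1 x2 x3 x4 x0 = cubic0 x0 x1 x2 x3 x4" "cubic0 x0 x4 x3 x2 x1 = cubic0 x0 x1 x2 x3 x4"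
  "cubic1 x1 x2 x3 x4 x0 = cubic1 x0 x1 x2 x3 x4"
  by (simp_all add: cubic0_def cubic1_def algebra_simps)

lemma chom_cubic:
  assumes L: "csubfield L" and \<sigma>: "chom L \<sigma>" and x: "x0 \<in> L" "x1 \<in> L" "x2 \<in> L" "x3 \<in> L" "x4 \<in> L"
  shows "quad_sum m x0 x1 x2 x3 x4 \<in> L" "cubic0 x0 x1 x2 x3 x4 \<in> L" "cubic1 x0 x1 x2 x3 x4 \<in> L"
    "\<sigma> (quad_sum m x0 x1 x2 x3 x4) = quad_sum m (\<sigma> x0) (\<sigma> x1) (\<sigma> x2) (\<sigma> x3) (\<sigma> x4)"
    "\<sigma> (cubic0 x0 x1 x2 x3 x4) = cubic0 (\<sigma> x0) (\<sigma> x1) (\<sigma> x2) (\<sigma> x3) (\<sigma> x4)"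
    "\<sigma> (cubic1 x0 x1 x2 x3 x4) = cubic1 (\<sigma> x0) (\<sigma> x1) (\<sigma> x2) (\<sigma> x3) (\<sigma> x4)"
proof -
  have 2: "2 \<in> L" "\<sigma> 2 = 2"
    using csubfield_of_nat[OF L, of 2] chom_of_rat[OF L \<sigma>, of 2] by simp_all
  note closed = csubfieldD(3,5)[OF L] x 2(1)
  note hom = chomD(3,5)[OF L \<sigma>]
  show "quad_sum m x0 x1 x2 x3 x4 \<in> L" by (simp add: quad_sum_def closed)
  show "cubic0 x0 x1 x2 x3 x4 \<in> L" by (simp add: cubic0_def closed)
  show "cubic1 x0 x1 x2 x3 x4 \<in> L" by (simp add: cubic1_def closed)
  show "\<sigma> (quad_sum m x0 x1 x2 x3 x4) = quad_sum m (\<sigma> x0) (\<sigma> x1) (\<sigma> x2) (\<sigma> x3) (\<sigma> x4)"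
    by (simp add: quad_sum_def closed hom)
  show "\<sigma> (cubic0 x0 x1 x2 x3 x4) = cubic0 (\<sigma> x0) (\<sigma> x1) (\<sigma> x2) (\<sigma> x3) (\<sigma> x4)"
    by (simp add: cubic0_def closed hom 2(2))
  show "\<sigma> (cubic1 x0 x1 x2 x3 x4) = cubic1 (\<sigma> x0) (\<sigma> x1) (\<sigma> x2) (\<sigma> x3) (\<sigma> x4)"
    by (simp add: cubic1_def closed hom 2(2))
qed

lemma algebraic_int_cubic:
  assumes "algebraic_int x0" "algebraic_int x1" "algebraic_int x2" "algebraic_int x3" "algebraic_int (x4 :: complex)"
  shows "algebraic_int (quad_sum m x0 x1 x2 x3 x4)" "algebraic_int (cubic0 x0 x1 x2 x3 x4)"
    "algebraic_int (cubic1 x0 x1 x2 x3 x4)"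
  using assms algebraic_int_of_int[of 2]
  by (simp_all add: quad_sum_def cubic0_def cubic1_def algebraic_int_plus_times)

text \<open>The equations for the conjugates of A and B are part of the relation. They are checked
  by explicit computation, so conjugation never has to be extended to a field containing
  \<zeta>.\<close>

definition resolvent_triple ::
  "real \<Rightarrow> real \<Rightarrow> int \<Rightarrow> complex \<Rightarrow> complex \<Rightarrow> complex \<Rightarrow> complex \<Rightarrow> complex \<Rightarrow> bool" where
  "resolvent_triple A B C x0 x1 x2 x3 x4 \<longleftrightarrow>
    (let v = (\<lambda>k. res k x0 x1 x2 x3 x4) in
      A \<in> qsqrt5_integers \<and> B \<in> qsqrt5_integers \<and>
      of_real A = v 1 * v 4 \<and> of_real (qsqrt5_conj A) = v 2 * v 3 \<and>
      of_real B = (v 1)\<^sup>2 * v 3 + (v 4)\<^sup>2 * v 2 \<and>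
      of_real (qsqrt5_conj B) = (v 2)\<^sup>2 * v 1 + (v 3)\<^sup>2 * v 4 \<and>
      of_real (sqrt 5) * of_int C = ((v 1)\<^sup>2 * v 3 - (v 4)\<^sup>2 * v 2) * ((v 2)\<^sup>2 * v 1 - (v 3)\<^sup>2 * v 4))"

section \<open>Construction and size of the invariants\<close>

lemma d5_conjugates_fixed_int:
  assumes "\<forall>y\<in>L. r y = y \<longrightarrow> s y = y \<longrightarrow> y \<in> \<rat>" "y \<in> L" "r y = y" "s y = y" "algebraic_int y"
  obtains k :: int where "y = of_int k"
proof -
  have "y \<in> \<rat>" using assms by blast
  then have "y \<in> \<int>" using assms(5) rational_algebraic_int_is_int by blast
  then show ?thesis using that by (auto elim: Ints_cases)
qed

text \<open>The quadratic sums are fixed by r and s, hence integers, and give A. The cubic sums p0,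
  ..., p4 are fixed by r, while s exchanges p1 with p4 and p2 with p3. So p0, p1 + p4 and p2 + p3
  are integers and give B; the differences only change sign under s, so quadratic expressions in
  them are integers and give C.\<close>

lemma resolvent_triple_exists:
  assumes d5: "d5_conjugates x x0 x1 x2 x3 x4" and x: "algebraic_int x"
  obtains A B C where "resolvent_triple A B C x0 x1 x2 x3 x4"
proof -
  obtain L r s where conj: "conjugates x = {x0, x1, x2, x3, x4}" and L: "csubfield L"
    and xL: "{x0, x1, x2, x3, x4} \<subseteq> L" and r: "chom L r" and s: "chom L s"
    and rx: "r x0 = x1" "r x1 = x2" "r x2 = x3" "r x3 = x4" "r x4 = x0"
    and sx: "s x0 = x0" "s x1 = x4" "s x2 = x3" "s x3 = x2" "s x4 = x1"
    and fixed: "\<forall>y\<in>L. r y = y \<longrightarrow> s y = y \<longrightarrow> y \<in> \<rat>"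
    using d5 unfolding d5_conjugates_def by blast
  have xL': "x0 \<in> L" "x1 \<in> L" "x2 \<in> L" "x3 \<in> L" "x4 \<in> L" using xL by auto
  have int: "algebraic_int x0" "algebraic_int x1" "algebraic_int x2" "algebraic_int x3" "algebraic_int x4"
    using algebraic_int_conjugate[OF x] conj by auto
  note L_ops = csubfieldD(3,4,5)[OF L]
  note r_ops = chomD(3,4,5)[OF L r] and s_ops = chomD(3,4,5)[OF L s]
  have e_int: "\<exists>k :: int. quad_sum m x0 x1 x2 x3 x4 = of_int k" for m
  proof -
    obtain k :: int where "quad_sum m x0 x1 x2 x3 x4 = of_int k"
    proof (rule d5_conjugates_fixed_int[OF fixed])
      show "quad_sum m x0 x1 x2 x3 x4 \<in> L" by (rule chom_cubic(1)[OF L r xL'])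
      show "r (quad_sum m x0 x1 x2 x3 x4) = quad_sum m x0 x1 x2 x3 x4"
        unfolding chom_cubic(4)[OF L r xL'] rx by (rule quad_sum_symmetric)
      show "s (quad_sum m x0 x1 x2 x3 x4) = quad_sum m x0 x1 x2 x3 x4"
        unfolding chom_cubic(4)[OF L s xL'] sx by (rule quad_sum_symmetric)
      show "algebraic_int (quad_sum m x0 x1 x2 x3 x4)" by (rule algebraic_int_cubic(1)[OF int])
    qed
    then show ?thesis by blast
  qed
  then obtain E :: "nat \<Rightarrow> int" where E: "\<And>m. quad_sum m x0 x1 x2 x3 x4 = of_int (E m)" by metis
  define p0 where "p0 = cubic0 x0 x1 x2 x3 x4"
  define p1 where "p1 = cubic1 x0 x1 x2 x3 x4"
  define p2 where "p2 = cubic1 x0 x2 x4 x1 x3"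
  define p3 where "p3 = cubic1 x0 x3 x1 x4 x2"
  define p4 where "p4 = cubic1 x0 x4 x3 x2 x1"
  have pL: "p0 \<in> L" "p1 \<in> L" "p2 \<in> L" "p3 \<in> L" "p4 \<in> L"
    unfolding p0_def p1_def p2_def p3_def p4_def by (intro chom_cubic(2,3)[OF L r] xL')+
  have p_int: "algebraic_int p0" "algebraic_int p1" "algebraic_int p2" "algebraic_int p3" "algebraic_int p4"
    unfolding p0_def p1_def p2_def p3_def p4_def by (intro algebraic_int_cubic int)+
  have rp: "r p0 = p0" "r p1 = p1" "r p2 = p2" "r p3 = p3" "r p4 = p4"
    unfolding p0_def p1_def p2_def p3_def p4_def
    by (simp_all add: chom_cubic(5,6)[OF L r] xL' rx cubic_symmetric(1),
        simp_all only: cubic_symmetric(3)[of x1 x2 x3 x4 x0] cubic_symmetric(3)[of x0 x1 x2 x3 x4]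
          cubic1_def algebra_simps)
  have sp: "s p0 = p0" "s p1 = p4" "s p2 = p3" "s p3 = p2" "s p4 = p1"
    unfolding p0_def p1_def p2_def p3_def p4_def
    by (simp_all add: chom_cubic(5,6)[OF L s] xL' sx cubic_symmetric(2))
  obtain F0 :: int where F0: "p0 = of_int F0"
    by (rule d5_conjugates_fixed_int[OF fixed pL(1) rp(1) sp(1) p_int(1)])
  obtain F1 :: int where F1: "p1 + p4 = of_int F1"
    by (rule d5_conjugates_fixed_int[OF fixed, of "p1 + p4"])
       (simp_all add: L_ops pL r_ops s_ops rp sp p_int algebraic_int_plus_times add.commute)
  obtain F2 :: int where F2: "p2 + p3 = of_int F2"
    by (rule d5_conjugates_fixed_int[OF fixed, of "p2 + p3"])
       (simp_all add: L_ops pL r_ops s_ops rp sp p_int algebraic_int_plus_times add.commute)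
  define f1 where "f1 = p1 - p4"
  define f2 where "f2 = p2 - p3"
  have f: "f1 \<in> L" "f2 \<in> L" "r f1 = f1" "r f2 = f2" "s f1 = - f1" "s f2 = - f2" "algebraic_int f1" "algebraic_int f2"
    unfolding f1_def f2_def by (simp_all add: L_ops pL r_ops s_ops rp sp p_int algebraic_int_diff)
  \<comment> \<open>With a = \<zeta> - \<zeta>^4 and b = \<zeta>^2 - \<zeta>^3 the two factors
    behind C are f1 a + f2 b and f1 b - f2 a. As a b = - sqrt 5 and b^2 - a^2 = sqrt 5, their
    product is sqrt 5 times this expression.\<close>
  obtain C :: int where C: "f1 * f2 - f1 * f1 + f2 * f2 = of_int C"
    by (rule d5_conjugates_fixed_int[OF fixed, of "f1 * f2 - f1 * f1 + f2 * f2"])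
       (simp_all add: L_ops r_ops s_ops f algebraic_int_plus_times algebraic_int_diff)
  define v where "v = (\<lambda>k. res k x0 x1 x2 x3 x4)"
  note zp = fifth_root_powers[OF zeta_pow5]
  have ind: "(zeta ^ 2) ^ 2 = zeta ^ 4" "(zeta ^ 2) ^ 3 = zeta" "(zeta ^ 2) ^ 4 = zeta ^ 3"
    "(zeta ^ 3) ^ 2 = zeta" "(zeta ^ 3) ^ 3 = zeta ^ 4" "(zeta ^ 3) ^ 4 = zeta ^ 2"
    "(zeta ^ 4) ^ 2 = zeta ^ 3" "(zeta ^ 4) ^ 3 = zeta ^ 2" "(zeta ^ 4) ^ 4 = zeta"
    by (simp_all add: zp flip: power_mult)
  have v14: "v 1 * v 4 = of_int (E 0) + of_int (E 1) * (zeta + zeta ^ 4) + of_int (E 2) * (zeta ^ 2 + zeta ^ 3)"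
    using resolvent_quadratic[OF zeta_pow5, of x0 x1 x2 x3 x4] by (simp add: v_def E)
  have v23: "v 2 * v 3 = of_int (E 0) + of_int (E 1) * (zeta ^ 2 + zeta ^ 3) + of_int (E 2) * (zeta + zeta ^ 4)"
    using resolvent_quadratic[OF zeta_pow_pow5[of 2], of x0 x1 x2 x3 x4] by (simp add: v_def E ind zp add.commute)
  have P: "(v 1)\<^sup>2 * v 3 = p0 + p1 * zeta + p2 * zeta ^ 2 + p3 * zeta ^ 3 + p4 * zeta ^ 4"
    using resolvent_cubic[OF zeta_pow5, of x0 x1 x2 x3 x4]
    by (simp add: v_def power2_eq_square[of "resolvent _ _ _ _ _ _"] p0_def p1_def p2_def p3_def p4_def)
  have Q: "(v 2)\<^sup>2 * v 1 = p0 + p1 * zeta ^ 2 + p2 * zeta ^ 4 + p3 * zeta + p4 * zeta ^ 3"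
    using resolvent_cubic[OF zeta_pow_pow5[of 2], of x0 x1 x2 x3 x4]
    by (simp add: v_def power2_eq_square[of "resolvent _ _ _ _ _ _"] p0_def p1_def p2_def p3_def p4_def ind zp)
  have Q': "(v 3)\<^sup>2 * v 4 = p0 + p1 * zeta ^ 3 + p2 * zeta + p3 * zeta ^ 4 + p4 * zeta ^ 2"
    using resolvent_cubic[OF zeta_pow_pow5[of 3], of x0 x1 x2 x3 x4]
    by (simp add: v_def power2_eq_square[of "resolvent _ _ _ _ _ _"] p0_def p1_def p2_def p3_def p4_def ind zp)
  have P': "(v 4)\<^sup>2 * v 2 = p0 + p1 * zeta ^ 4 + p2 * zeta ^ 3 + p3 * zeta ^ 2 + p4 * zeta"
    using resolvent_cubic[OF zeta_pow_pow5[of 4], of x0 x1 x2 x3 x4]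
    by (simp add: v_def power2_eq_square[of "resolvent _ _ _ _ _ _"] p0_def p1_def p2_def p3_def p4_def ind zp)
  define A where "A = of_int (E 0) + of_int (E 1) * golden + of_int (E 2) * golden'"
  \<comment> \<open>The factor 2 is there because p0 occurs in both summands of B.\<close>
  define B where "B = of_int (2 * F0) + of_int F1 * golden + of_int F2 * golden'"
  note A_facts = golden_integers[of "E 0" "E 1" "E 2", folded A_def]
  note B_facts = golden_integers[of "2 * F0" F1 F2, folded B_def]
  have "of_real A = v 1 * v 4" unfolding v14 zeta_golden by (simp add: A_def)
  moreover have "of_real (qsqrt5_conj A) = v 2 * v 3" unfolding v23 zeta_golden A_facts(2) by simp
  moreover have "of_real B = (v 1)\<^sup>2 * v 3 + (v 4)\<^sup>2 * v 2"
  proof -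
    have "(v 1)\<^sup>2 * v 3 + (v 4)\<^sup>2 * v 2 = 2 * p0 + (p1 + p4) * (zeta + zeta ^ 4) + (p2 + p3) * (zeta ^ 2 + zeta ^ 3)"
      unfolding P P' by (simp add: algebra_simps)
    then show ?thesis unfolding F0 F1 F2 zeta_golden by (simp add: B_def)
  qed
  moreover have "of_real (qsqrt5_conj B) = (v 2)\<^sup>2 * v 1 + (v 3)\<^sup>2 * v 4"
  proof -
    have "(v 2)\<^sup>2 * v 1 + (v 3)\<^sup>2 * v 4 = 2 * p0 + (p1 + p4) * (zeta ^ 2 + zeta ^ 3) + (p2 + p3) * (zeta + zeta ^ 4)"
      unfolding Q Q' by (simp add: algebra_simps)
    then show ?thesis unfolding F0 F1 F2 zeta_golden B_facts(2) by simp
  qed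
  moreover have "of_real (sqrt 5) * of_int C = ((v 1)\<^sup>2 * v 3 - (v 4)\<^sup>2 * v 2) * ((v 2)\<^sup>2 * v 1 - (v 3)\<^sup>2 * v 4)"
  proof -
    define a b where "a = zeta - zeta ^ 4" and "b = zeta ^ 2 - zeta ^ 3"
    have P_diff: "(v 1)\<^sup>2 * v 3 - (v 4)\<^sup>2 * v 2 = f1 * a + f2 * b"
      unfolding P P' by (simp add: a_def b_def f1_def f2_def algebra_simps)
    have Q_diff: "(v 2)\<^sup>2 * v 1 - (v 3)\<^sup>2 * v 4 = f1 * b - f2 * a"
      unfolding Q Q' by (simp add: a_def b_def f1_def f2_def algebra_simps)
    have "zeta + zeta ^ 4 - (zeta ^ 2 + zeta ^ 3) = of_real (golden - golden')"
      unfolding zeta_golden by simp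
    then have root: "zeta + zeta ^ 4 - (zeta ^ 2 + zeta ^ 3) = of_real (sqrt 5)" by (simp add: golden_def golden'_def field_simps)
    have "a * b = - (zeta + zeta ^ 4 - (zeta ^ 2 + zeta ^ 3)) + (zeta ^ 5 - 1) * (zeta ^ 2 - zeta)"
      by (simp add: a_def b_def algebra_simps eval_nat_numeral)
    then have ab: "a * b = - of_real (sqrt 5)" unfolding root using zeta_pow5 by simp
    have "b * b - a * a = (zeta + zeta ^ 4 - (zeta ^ 2 + zeta ^ 3)) + (zeta ^ 5 - 1) * (zeta - zeta ^ 3)"
      by (simp add: a_def b_def algebra_simps eval_nat_numeral)
    then have bb: "b * b - a * a = of_real (sqrt 5)" unfolding root using zeta_pow5 by simp
    have "(f1 * a + f2 * b) * (f1 * b - f2 * a) = (f1 * f1 - f2 * f2) * (a * b) + f1 * f2 * (b * b - a * a)"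
      by (simp add: algebra_simps)
    also have "\<dots> = of_real (sqrt 5) * (f1 * f2 - f1 * f1 + f2 * f2)"
      unfolding ab bb by (simp add: algebra_simps)
    finally show ?thesis unfolding P_diff Q_diff C by simp
  qed
  ultimately have "resolvent_triple A B C x0 x1 x2 x3 x4"
    using A_facts(1) B_facts(1) by (simp add: resolvent_triple_def v_def Let_def)
  then show ?thesis by (rule that)
qed

text \<open>With P and P' the two summands of B, the argument of the norm is (P + P')^2 - 4 P P' =
  (P - P')^2, because P P' = A^2 A'. The same holds for the conjugates, and the product of the two
  squares is the square of sqrt 5 * C.\<close>

lemma resolvent_triple_norm:
  assumes "resolvent_triple A B C x0 x1 x2 x3 x4"
  shows "qsqrt5_norm (B\<^sup>2 - 4 * qsqrt5_conj A * A\<^sup>2) = 5 * (of_int C)\<^sup>2"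
proof -
  define v where "v = (\<lambda>k. res k x0 x1 x2 x3 x4)"
  have AB: "A \<in> qsqrt5" "B \<in> qsqrt5"
    and A: "of_real A = v 1 * v 4" "of_real (qsqrt5_conj A) = v 2 * v 3"
    and B: "of_real B = (v 1)\<^sup>2 * v 3 + (v 4)\<^sup>2 * v 2" "of_real (qsqrt5_conj B) = (v 2)\<^sup>2 * v 1 + (v 3)\<^sup>2 * v 4"
    and C: "of_real (sqrt 5) * of_int C = ((v 1)\<^sup>2 * v 3 - (v 4)\<^sup>2 * v 2) * ((v 2)\<^sup>2 * v 1 - (v 3)\<^sup>2 * v 4)"
    using assms by (simp_all add: resolvent_triple_def v_def Let_def qsqrt5_integers_def)
  let ?z = "B\<^sup>2 - 4 * qsqrt5_conj A * A\<^sup>2"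
  have z: "?z = B * B - 4 * (qsqrt5_conj A * (A * A))" by (simp add: power2_eq_square mult.assoc)
  have conj_z: "qsqrt5_conj ?z = qsqrt5_conj B * qsqrt5_conj B - 4 * (A * (qsqrt5_conj A * qsqrt5_conj A))"
    unfolding z using AB
    by (simp add: qsqrt5_conj_diff qsqrt5_conj_mult qsqrt5_conj_in qsqrt5_numeral)
  have "complex_of_real ?z = ((v 1)\<^sup>2 * v 3 - (v 4)\<^sup>2 * v 2)\<^sup>2"
    unfolding z by (simp add: A B power2_eq_square algebra_simps)
  moreover have "complex_of_real (qsqrt5_conj ?z) = ((v 2)\<^sup>2 * v 1 - (v 3)\<^sup>2 * v 4)\<^sup>2"
    unfolding conj_z by (simp add: A B power2_eq_square algebra_simps)
  ultimately have "complex_of_real (qsqrt5_norm ?z) = (of_real (sqrt 5) * of_int C)\<^sup>2"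
    unfolding C qsqrt5_norm_def of_real_mult by (simp add: power_mult_distrib)
  also have "\<dots> = of_real ((sqrt 5 * of_int C)\<^sup>2)" by simp
  finally have "qsqrt5_norm ?z = (sqrt 5 * of_int C)\<^sup>2" by (simp only: of_real_eq_iff)
  then show ?thesis by (simp add: power_mult_distrib)
qed

lemma norm_resolvent_le:
  assumes "norm x0 \<le> H" "norm x1 \<le> H" "norm x2 \<le> H" "norm x3 \<le> H" "norm x4 \<le> H"
  shows "norm (res k x0 x1 x2 x3 x4) \<le> 5 * H"
proof -
  have "norm (res k x0 x1 x2 x3 x4) \<le> norm x0 + norm x1 + norm x2 + norm x3 + norm x4"
    unfolding resolvent_def
    by (rule order_trans[OF norm_triangle_ineq] add_mono order_refl | simp add: norm_mult norm_power)+
  then show ?thesis using assms by simp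
qed

text \<open>A resolvent has five terms of size at most H, and A, B and C have degrees 2, 3 and 6 in
  the resolvents. The factors 2 and 4 count monomials; for C the factor sqrt 5 \<ge> 1 is
  dropped.\<close>

lemma resolvent_triple_bounds:
  assumes T: "resolvent_triple A B C x0 x1 x2 x3 x4"
    and H: "norm x0 \<le> H" "norm x1 \<le> H" "norm x2 \<le> H" "norm x3 \<le> H" "norm x4 \<le> H"
  shows "\<bar>A\<bar> \<le> (5 * H) ^ 2" "\<bar>qsqrt5_conj A\<bar> \<le> (5 * H) ^ 2"
    "\<bar>B\<bar> \<le> 2 * (5 * H) ^ 3" "\<bar>qsqrt5_conj B\<bar> \<le> 2 * (5 * H) ^ 3"
    "\<bar>of_int C\<bar> \<le> 4 * (5 * H) ^ 6"
proof -
  define v where "v = (\<lambda>k. res k x0 x1 x2 x3 x4)"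
  define M where "M = 5 * H"
  have v: "norm (v k) \<le> M" for k unfolding v_def M_def by (rule norm_resolvent_le[OF H])
  have M0: "M \<ge> 0" using v[of 1] norm_ge_zero order_trans by blast
  have A: "of_real A = v 1 * v 4" "of_real (qsqrt5_conj A) = v 2 * v 3"
    and B: "of_real B = (v 1)\<^sup>2 * v 3 + (v 4)\<^sup>2 * v 2" "of_real (qsqrt5_conj B) = (v 2)\<^sup>2 * v 1 + (v 3)\<^sup>2 * v 4"
    and C: "of_real (sqrt 5) * of_int C = ((v 1)\<^sup>2 * v 3 - (v 4)\<^sup>2 * v 2) * ((v 2)\<^sup>2 * v 1 - (v 3)\<^sup>2 * v 4)"
    using T by (simp_all add: resolvent_triple_def v_def Let_def)
  have two: "norm (v j * v k) \<le> M ^ 2" for j k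
    unfolding norm_mult power2_eq_square using v M0 by (intro mult_mono) auto
  have three: "norm ((v j)\<^sup>2 * v k) \<le> M ^ 3" for j k
    using mult_mono[OF two[of j j] v[of k]] M0 by (simp add: norm_mult power2_eq_square power3_eq_cube mult.assoc)
  have abs: "\<bar>t\<bar> = norm (complex_of_real t)" for t by simp
  show "\<bar>A\<bar> \<le> (5 * H) ^ 2" "\<bar>qsqrt5_conj A\<bar> \<le> (5 * H) ^ 2"
    unfolding abs A M_def[symmetric] by (rule two)+
  show "\<bar>B\<bar> \<le> 2 * (5 * H) ^ 3" "\<bar>qsqrt5_conj B\<bar> \<le> 2 * (5 * H) ^ 3"
    unfolding abs B M_def[symmetric]
    using order_trans[OF norm_triangle_ineq add_mono[OF three three]] by (metis mult_2)+
  have diff: "norm ((v i)\<^sup>2 * v j - (v k)\<^sup>2 * v l) \<le> 2 * M ^ 3" for i j k l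
    using order_trans[OF norm_triangle_ineq4 add_mono[OF three three]] by (metis mult_2)
  have "\<bar>of_int C\<bar> \<le> sqrt 5 * \<bar>of_int C\<bar>"
    using mult_right_mono[of 1 "sqrt 5" "\<bar>of_int C\<bar>"] by simp
  also have "\<dots> = norm (of_real (sqrt 5) * of_int C :: complex)" by (simp add: norm_mult)
  also have "\<dots> \<le> (2 * M ^ 3) * (2 * M ^ 3)"
    unfolding C norm_mult[of "_ - _"] using diff M0 by (intro mult_mono) auto
  also have "\<dots> = 4 * (5 * H) ^ 6" by (simp add: M_def eval_nat_numeral)
  finally show "\<bar>of_int C\<bar> \<le> 4 * (5 * H) ^ 6" .
qed

text \<open>If \<open>A\<close> vanished then, by conjugating the equations for \<open>A\<close> and \<open>B\<close>, at most one resolvent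
  would be nonzero, so the \<open>x\<^sub>i\<close> would form a geometric progression modulo 5 whose ratio \<open>t\<close>
  is a fifth root of unity; but then the irrational number \<open>t + 1/t\<close> is fixed by the group.\<close>

lemma resolvent_triple_nonzero:
  assumes d5: "d5_conjugates x x0 x1 x2 x3 x4" and sum0: "x0 + x1 + x2 + x3 + x4 = 0"
    and T: "resolvent_triple A B C x0 x1 x2 x3 x4"
  shows "A \<noteq> 0" "qsqrt5_conj A \<noteq> 0"
proof -
  define v where "v = (\<lambda>k. res k x0 x1 x2 x3 x4)"
  have AB: "A \<in> qsqrt5" "B \<in> qsqrt5"
    and A: "of_real A = v 1 * v 4" "of_real (qsqrt5_conj A) = v 2 * v 3"
    and B: "of_real B = (v 1)\<^sup>2 * v 3 + (v 4)\<^sup>2 * v 2" "of_real (qsqrt5_conj B) = (v 2)\<^sup>2 * v 1 + (v 3)\<^sup>2 * v 4"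
    using T by (simp_all add: resolvent_triple_def v_def Let_def qsqrt5_integers_def)
  have "0 = of_rat 0 + of_rat 0 * sqrt 5" by simp
  then have "qsqrt5_conj 0 = 0" using qsqrt5_conj_eq[of 0 0] by simp
  then have zero_iff: "qsqrt5_conj z = 0 \<longleftrightarrow> z = 0" if "z \<in> qsqrt5" for z
    using qsqrt5_conj_in[OF that] by metis
  show "A \<noteq> 0"
  proof
    assume "A = 0"
    then have "v 1 * v 4 = 0" "v 2 * v 3 = 0" using A zero_iff[OF AB(1)] by auto
    \<comment> \<open>Two nonzero resolvents, one from each vanishing product, would leave exactly
      one of B and its conjugate equal to zero.\<close>
    moreover have "of_real B = (0 :: complex) \<longleftrightarrow> of_real (qsqrt5_conj B) = (0 :: complex)"
      using zero_iff[OF AB(2)] by simp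
    ultimately have cases: "(v 2 = 0 \<and> v 3 = 0 \<and> v 4 = 0) \<or> (v 1 = 0 \<and> v 3 = 0 \<and> v 4 = 0) \<or>
        (v 1 = 0 \<and> v 2 = 0 \<and> v 4 = 0) \<or> (v 1 = 0 \<and> v 2 = 0 \<and> v 3 = 0)"
      unfolding B by auto
    note zp = fifth_root_powers[OF zeta_pow5]
    have inv': "v 1 + v 2 + v 3 + v 4 = 5 * x0"
      "zeta * v 1 + zeta ^ 2 * v 2 + zeta ^ 3 * v 3 + zeta ^ 4 * v 4 = 5 * x4"
      "zeta ^ 3 * v 1 + zeta * v 2 + zeta ^ 4 * v 3 + zeta ^ 2 * v 4 = 5 * x2"
      "zeta ^ 4 * v 1 + zeta ^ 3 * v 2 + zeta ^ 2 * v 3 + zeta * v 4 = 5 * x1"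
      using resolvent_inversion_power[OF sum0] by (simp_all add: v_def zp flip: power_mult)
    obtain t where t: "t + t ^ 4 = of_real golden \<or> t + t ^ 4 = of_real golden'" "t ^ 5 = 1"
      "x1 = t * x0" "x2 = t ^ 2 * x0" "x4 = t ^ 4 * x0"
    proof -
      note gold = zeta_golden
      have tt: "(zeta ^ 4) + (zeta ^ 4) ^ 4 = of_real golden" "zeta ^ 3 + (zeta ^ 3) ^ 4 = of_real golden'"
        "zeta ^ 2 + (zeta ^ 2) ^ 4 = of_real golden'"
        unfolding gold[symmetric] by (simp_all add: zp add.commute flip: power_mult)
      consider "v 2 = 0" "v 3 = 0" "v 4 = 0" | "v 1 = 0" "v 3 = 0" "v 4 = 0"
        | "v 1 = 0" "v 2 = 0" "v 4 = 0" | "v 1 = 0" "v 2 = 0" "v 3 = 0" using cases by blast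
      then show ?thesis
      proof cases
        case 1
        show ?thesis
          by (rule that[of "zeta ^ 4"]) (use tt(1) zeta_pow_pow5[of 4] inv' 1 in \<open>auto simp: zp simp flip: power_mult\<close>)
      next
        case 2
        show ?thesis
          by (rule that[of "zeta ^ 3"]) (use tt(2) zeta_pow_pow5[of 3] inv' 2 in \<open>auto simp: zp simp flip: power_mult\<close>)
      next
        case 3
        show ?thesis
          by (rule that[of "zeta ^ 2"]) (use tt(3) zeta_pow_pow5[of 2] inv' 3 in \<open>auto simp: zp simp flip: power_mult\<close>)
      next
        case 4
        show ?thesis
          by (rule that[of zeta]) (use gold(1) zeta_pow5 inv' 4 in \<open>auto simp: zp simp flip: power_mult\<close>)
      qed
    qed
    obtain L r s where dist: "distinct [x0, x1, x2, x3, x4]" and L: "csubfield L"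
      and xL: "{x0, x1, x2, x3, x4} \<subseteq> L" and r: "chom L r" and s: "chom L s"
      and rx: "r x0 = x1" "r x1 = x2" "r x2 = x3" "r x3 = x4" "r x4 = x0"
      and sx: "s x0 = x0" "s x1 = x4" "s x2 = x3" "s x3 = x2" "s x4 = x1"
      and fixed: "\<forall>y\<in>L. r y = y \<longrightarrow> s y = y \<longrightarrow> y \<in> \<rat>"
      using d5 unfolding d5_conjugates_def by blast
    have x0: "x0 \<noteq> 0" using dist t(3) by auto
    have t0: "t \<noteq> 0" using t(2) by auto
    have x14: "(x1 + x4) / x0 = t + t ^ 4" using x0 t by (simp add: field_simps)
    have "(x1 + x4) / x0 \<in> \<rat>"
    proof (rule fixed[rule_format])
      show "(x1 + x4) / x0 \<in> L" using xL by (intro csubfieldD[OF L]) auto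
      have xs: "x1 + x4 \<in> L" "x1 \<in> L" "x4 \<in> L" "x0 \<in> L" using xL csubfieldD(3)[OF L] by auto
      have "r ((x1 + x4) / x0) = (x2 + x0) / x1"
        using xs by (simp add: chomD(3,8)[OF L r] rx)
      also have "\<dots> = (x1 + x4) / x0"
      proof -
        have "(x2 + x0) * x0 = (x1 + x4) * x1"
          using t(2) unfolding t(3-5) by (simp add: algebra_simps eval_nat_numeral)
        then show ?thesis using x0 t0 t(3) by (simp add: frac_eq_eq)
      qed
      finally show "r ((x1 + x4) / x0) = (x1 + x4) / x0" .
      show "s ((x1 + x4) / x0) = (x1 + x4) / x0"
        using xs by (simp add: chomD(3,8)[OF L s] sx add.commute)
    qed
    then show False using t(1) golden_irrational x14 by auto
  qed
  then show "qsqrt5_conj A \<noteq> 0" using zero_iff[OF AB(1)] by simp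
qed

section \<open>Recovering the conjugates from the invariants\<close>

lemma resolvents_determined:
  fixes v1 v2 v3 v4 u1 u2 u3 u4 :: complex
  assumes "v1 * v4 = u1 * u4" "v2 * v3 = u2 * u3" "v1 * v4 \<noteq> 0" "v2 * v3 \<noteq> 0"
    and "v1\<^sup>2 * v3 = u1\<^sup>2 * u3" "v2\<^sup>2 * v1 = u2\<^sup>2 * u1"
  obtains \<eta> where "\<eta> ^ 5 = 1" "u1 = \<eta> * v1" "u2 = \<eta> ^ 2 * v2" "u3 = \<eta> ^ 3 * v3" "u4 = \<eta> ^ 4 * v4"
proof -
  have nz: "v1 \<noteq> 0" "v2 \<noteq> 0" "v3 \<noteq> 0" "v4 \<noteq> 0" "u1 \<noteq> 0" "u2 \<noteq> 0" "u3 \<noteq> 0" "u4 \<noteq> 0"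
    using assms by auto
  define \<eta> where "\<eta> = u1 / v1"
  have u1: "u1 = \<eta> * v1" using nz by (simp add: \<eta>_def)
  have e0: "\<eta> \<noteq> 0" using nz by (simp add: \<eta>_def)
  \<comment> \<open>The fifth power of the first resolvent is expressed through the given data, so
    \<eta> is a fifth root of unity. The other resolvents then follow by cancelling nonzero
    factors.\<close>
  have "u1 ^ 5 * (u2 * u3)\<^sup>2 = (u1\<^sup>2 * u3)\<^sup>2 * (u2\<^sup>2 * u1)" by (simp add: eval_nat_numeral mult_ac)
  also have "\<dots> = (v1\<^sup>2 * v3)\<^sup>2 * (v2\<^sup>2 * v1)" using assms(5,6) by simp
  also have "\<dots> = v1 ^ 5 * (v2 * v3)\<^sup>2" by (simp add: eval_nat_numeral mult_ac)
  finally have "u1 ^ 5 = v1 ^ 5" using assms(2,4) by simp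
  then have e5: "\<eta> ^ 5 = 1" using nz by (simp add: \<eta>_def power_divide)
  have "v1\<^sup>2 * v3 = v1\<^sup>2 * (\<eta> ^ 2 * u3)" using assms(5) unfolding u1 by (simp add: power_mult_distrib mult_ac)
  then have v3: "v3 = \<eta> ^ 2 * u3" using nz(1) by simp
  have "\<eta> ^ 3 * v3 = \<eta> ^ 5 * u3" unfolding v3 by (simp add: eval_nat_numeral mult_ac)
  then have u3: "u3 = \<eta> ^ 3 * v3" using e5 by simp
  have "v1 * v4 = v1 * (\<eta> * u4)" using assms(1) unfolding u1 by (simp add: mult_ac)
  then have v4: "v4 = \<eta> * u4" using nz(1) by simp
  have "\<eta> ^ 4 * v4 = \<eta> ^ 5 * u4" unfolding v4 by (simp add: eval_nat_numeral mult_ac)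
  then have u4: "u4 = \<eta> ^ 4 * v4" using e5 by simp
  have "v2 * v3 = (\<eta> ^ 3 * u2) * v3" using assms(2) unfolding u3 by (simp add: mult_ac)
  then have v2: "v2 = \<eta> ^ 3 * u2" using nz(3) by simp
  have "\<eta> ^ 2 * v2 = \<eta> ^ 5 * u2" unfolding v2 by (simp add: eval_nat_numeral mult_ac)
  then have u2: "u2 = \<eta> ^ 2 * v2" using e5 by simp
  show ?thesis by (rule that[OF e5 u1 u2 u3 u4])
qed

text \<open>Replacing each v_j by \<eta>^j v_j rotates the underlying sequence, so inversion at
  index 0 lands on one of the \<open>x\<close> values.\<close>

lemma resolvents_determine_root:
  assumes sums: "x0 + x1 + x2 + x3 + x4 = 0" "y0 + y1 + y2 + y3 + y4 = 0"
  defines "v \<equiv> \<lambda>k. res k x0 x1 x2 x3 x4" and "u \<equiv> \<lambda>k. res k y0 y1 y2 y3 y4"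
  assumes eqs: "v 1 * v 4 = u 1 * u 4" "v 2 * v 3 = u 2 * u 3" "v 1 * v 4 \<noteq> 0" "v 2 * v 3 \<noteq> 0"
    "(v 1)\<^sup>2 * v 3 = (u 1)\<^sup>2 * u 3" "(v 2)\<^sup>2 * v 1 = (u 2)\<^sup>2 * u 1"
  shows "y0 \<in> {x0, x1, x2, x3, x4}"
proof -
  obtain \<eta> where \<eta>: "\<eta> ^ 5 = 1" "u 1 = \<eta> * v 1" "u 2 = \<eta> ^ 2 * v 2" "u 3 = \<eta> ^ 3 * v 3" "u 4 = \<eta> ^ 4 * v 4"
    using resolvents_determined[OF eqs] by blast
  have "5 * y0 = u 1 + u 2 + u 3 + u 4" unfolding u_def by (rule resolvent_inversion[OF sums(2), symmetric])
  also have "\<dots> = \<eta> ^ 1 * v 1 + \<eta> ^ 2 * v 2 + \<eta> ^ 3 * v 3 + \<eta> ^ 4 * v 4" unfolding \<eta>(2-5) by simp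
  finally have "5 * y0 = \<eta> ^ 1 * v 1 + \<eta> ^ 2 * v 2 + \<eta> ^ 3 * v 3 + \<eta> ^ 4 * v 4" .
  then show ?thesis
    using fifth_root_cases[OF \<eta>(1)] resolvent_inversion_power[OF sums(1)] unfolding v_def by fastforce
qed

lemma resolvent_reflect:
  "res 1 x0 x4 x3 x2 x1 = res 4 x0 x1 x2 x3 x4" "res 2 x0 x4 x3 x2 x1 = res 3 x0 x1 x2 x3 x4"
  "res 3 x0 x4 x3 x2 x1 = res 2 x0 x1 x2 x3 x4" "res 4 x0 x4 x3 x2 x1 = res 1 x0 x1 x2 x3 x4"
  by (simp_all only: power_one_right resolvent_power[OF zeta_pow5])

text \<open>Sum and product are known for each of the pairs P, P' and Q, Q', so each pair is
  determined up to order, and C couples the two orders. The case in which both are swapped reduces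
  to the other one by listing the conjugates backwards.\<close>

lemma resolvent_triple_determines_root:
  assumes sums: "x0 + x1 + x2 + x3 + x4 = 0" "y0 + y1 + y2 + y3 + y4 = 0"
    and Tx: "resolvent_triple A B C x0 x1 x2 x3 x4" and Ty: "resolvent_triple A B C y0 y1 y2 y3 y4"
    and nz: "A \<noteq> 0" "qsqrt5_conj A \<noteq> 0"
  shows "y0 \<in> {x0, x1, x2, x3, x4}"
proof -
  define v where "v = (\<lambda>k. res k x0 x1 x2 x3 x4)"
  define u where "u = (\<lambda>k. res k y0 y1 y2 y3 y4)"
  define P P' Q Q' where "P = (v 1)\<^sup>2 * v 3" and "P' = (v 4)\<^sup>2 * v 2" and "Q = (v 2)\<^sup>2 * v 1" and "Q' = (v 3)\<^sup>2 * v 4"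
  define R R' S S' where "R = (u 1)\<^sup>2 * u 3" and "R' = (u 4)\<^sup>2 * u 2" and "S = (u 2)\<^sup>2 * u 1" and "S' = (u 3)\<^sup>2 * u 4"
  have A: "of_real A = v 1 * v 4" "of_real A = u 1 * u 4"
    "of_real (qsqrt5_conj A) = v 2 * v 3" "of_real (qsqrt5_conj A) = u 2 * u 3"
    and B: "of_real B = P + P'" "of_real B = R + R'" "of_real (qsqrt5_conj B) = Q + Q'" "of_real (qsqrt5_conj B) = S + S'"
    and C: "of_real (sqrt 5) * of_int C = (P - P') * (Q - Q')" "of_real (sqrt 5) * of_int C = (R - R') * (S - S')"
    using Tx Ty
    by (simp_all add: resolvent_triple_def v_def u_def Let_def P_def P'_def Q_def Q'_def R_def R'_def S_def S'_def)
  have sums_eq: "P + P' = R + R'" "Q + Q' = S + S'" using B by metis+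
  have v14: "v 1 * v 4 = u 1 * u 4" "v 2 * v 3 = u 2 * u 3" using A by metis+
  have nz': "v 1 * v 4 \<noteq> 0" "v 2 * v 3 \<noteq> 0" using A nz by (metis of_real_eq_0_iff)+
  have prods_eq: "P * P' = R * R'" "Q * Q' = S * S'"
  proof -
    have "P * P' = (v 1 * v 4)\<^sup>2 * (v 2 * v 3)" "R * R' = (u 1 * u 4)\<^sup>2 * (u 2 * u 3)"
      "Q * Q' = (v 2 * v 3)\<^sup>2 * (v 1 * v 4)" "S * S' = (u 2 * u 3)\<^sup>2 * (u 1 * u 4)"
      by (simp_all add: P_def P'_def Q_def Q'_def R_def R'_def S_def S'_def power2_eq_square mult_ac)
    then show "P * P' = R * R'" "Q * Q' = S * S'" using v14 by simp_all
  qed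
  have swap: "(a = c \<and> b = d) \<or> (a = d \<and> b = c)" if "a + b = c + d" "a * b = c * d" for a b c d :: complex
  proof -
    have b: "b = c + d - a" using that(1) by (simp add: algebra_simps)
    have "(a - c) * (a - d) = 0" using that(2) unfolding b by (simp add: algebra_simps)
    then show ?thesis using that(1) by auto
  qed
  have C': "(P - P') * (Q - Q') = (R - R') * (S - S')" using C by simp
  \<comment> \<open>Swapping one pair only would change the sign of the product, so the equality in
    \<open>C'\<close> makes the members of one pair equal. A swap of that pair changes nothing, and
    the two alternatives kept below are still exhaustive.\<close>
  have degenerate: "R = R' \<or> S = S'"
    if "(R - R') * (S' - S) = (R - R') * (S - S') \<or> (R' - R) * (S - S') = (R - R') * (S - S')"
  proof -
    have "2 * ((R - R') * (S - S')) = 0" using that by (auto simp: algebra_simps)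
    then show ?thesis by simp
  qed
  have "(P = R \<and> Q = S) \<or> (P = R' \<and> P' = R \<and> Q = S' \<and> Q' = S)"
    using swap[OF sums_eq(1) prods_eq(1)] swap[OF sums_eq(2) prods_eq(2)] C' degenerate by metis
  then consider "P = R" "Q = S" | "P = R'" "P' = R" "Q = S'" "Q' = S" by blast
  then show ?thesis
  proof cases
    case 1
    then show ?thesis
      using resolvents_determine_root[OF sums] v14 nz' unfolding P_def R_def Q_def S_def v_def u_def by blast
  next
    case 2
    have reflect: "res 1 x0 x4 x3 x2 x1 = res 4 x0 x1 x2 x3 x4" "res 2 x0 x4 x3 x2 x1 = res 3 x0 x1 x2 x3 x4"
      "res 3 x0 x4 x3 x2 x1 = res 2 x0 x1 x2 x3 x4" "res 4 x0 x4 x3 x2 x1 = res 1 x0 x1 x2 x3 x4"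
      by (rule resolvent_reflect)+
    have "y0 \<in> {x0, x4, x3, x2, x1}"
    proof (rule resolvents_determine_root[OF _ sums(2)])
      show "x0 + x4 + x3 + x2 + x1 = 0" using sums(1) by (simp add: algebra_simps)
      show "res 1 x0 x4 x3 x2 x1 * res 4 x0 x4 x3 x2 x1 = res 1 y0 y1 y2 y3 y4 * res 4 y0 y1 y2 y3 y4"
        "res 1 x0 x4 x3 x2 x1 * res 4 x0 x4 x3 x2 x1 \<noteq> 0"
        unfolding reflect using v14(1) nz'(1) by (simp_all add: v_def u_def mult.commute)
      show "res 2 x0 x4 x3 x2 x1 * res 3 x0 x4 x3 x2 x1 = res 2 y0 y1 y2 y3 y4 * res 3 y0 y1 y2 y3 y4"
        "res 2 x0 x4 x3 x2 x1 * res 3 x0 x4 x3 x2 x1 \<noteq> 0"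
        unfolding reflect using v14(2) nz'(2) by (simp_all add: v_def u_def mult.commute)
      show "(res 1 x0 x4 x3 x2 x1)\<^sup>2 * res 3 x0 x4 x3 x2 x1 = (res 1 y0 y1 y2 y3 y4)\<^sup>2 * res 3 y0 y1 y2 y3 y4"
        unfolding reflect using 2(2) by (simp add: P'_def R_def v_def u_def)
      show "(res 2 x0 x4 x3 x2 x1)\<^sup>2 * res 1 x0 x4 x3 x2 x1 = (res 2 y0 y1 y2 y3 y4)\<^sup>2 * res 1 y0 y1 y2 y3 y4"
        unfolding reflect using 2(4) by (simp add: Q'_def S_def v_def u_def)
    qed
    then show ?thesis by blast
  qed
qed

section \<open>The parametrisation\<close>

text \<open>A relation and not a function, since generator and numbering are chosen. The size of the
  conjugates is stored so that the bounds on the triple follow from the relation alone.\<close>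

definition d5_invariants :: "complex set \<Rightarrow> real \<times> real \<times> int \<Rightarrow> bool" where
  "d5_invariants K = (\<lambda>(A, B, C). \<exists>x x0 x1 x2 x3 x4. K = simple_ext x \<and> algebraic x \<and>
     d5_conjugates x x0 x1 x2 x3 x4 \<and> x0 + x1 + x2 + x3 + x4 = 0 \<and>
     (\<forall>z\<in>{x0, x1, x2, x3, x4}. norm z \<le> 30 * \<bar>of_int (field_discriminant K)\<bar> powr (1 / 8)) \<and>
     resolvent_triple A B C x0 x1 x2 x3 x4)"

lemma d5_invariants_exist:
  assumes "D5_quintic_field K"
  obtains T where "d5_invariants K T"
proof -
  have K: "number_field K" "field_degree K = 5" and iso: "galois_group (galois_closure K) \<cong> dihedral_group 5"
    using assms by (simp_all add: D5_quintic_field_def)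
  obtain x where x: "K = simple_ext x" "algebraic_int x" "card (conjugates x) = 5" "\<Sum>(conjugates x) = 0"
    "\<forall>z\<in>conjugates x. norm z \<le> 30 * \<bar>of_int (field_discriminant K)\<bar> powr (1 / 8)"
    using short_trace_zero_generator[OF K] by blast
  have alg: "algebraic x" using x(2) by blast
  obtain x0 x1 x2 x3 x4 where d5: "d5_conjugates x x0 x1 x2 x3 x4"
    using d5_conjugates_exist[OF alg x(3)] iso x(1) by blast
  then have conj: "conjugates x = {x0, x1, x2, x3, x4}" and dist: "distinct [x0, x1, x2, x3, x4]"
    unfolding d5_conjugates_def by blast+
  have sum: "x0 + x1 + x2 + x3 + x4 = 0"
    using x(4) dist unfolding conj by (simp add: add.assoc)
  obtain A B C where T: "resolvent_triple A B C x0 x1 x2 x3 x4"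
    using resolvent_triple_exists[OF d5 x(2)] by blast
  have "d5_invariants K (A, B, C)"
    unfolding d5_invariants_def prod.case using x(1,5) alg d5 sum T unfolding conj by blast
  then show ?thesis by (rule that)
qed

text \<open>The constant 150 is 5 * 30: five terms in a resolvent, each at most 30
  |D|^(1/8).\<close>

lemma d5_invariants_bounds:
  assumes "d5_invariants K (A, B, C)"
  defines "D \<equiv> \<bar>of_int (field_discriminant K)\<bar> :: real"
  shows "\<bar>A\<bar> \<le> 150 ^ 2 * D powr (1 / 4)" "\<bar>qsqrt5_conj A\<bar> \<le> 150 ^ 2 * D powr (1 / 4)"
    "\<bar>B\<bar> \<le> (2 * 150 ^ 3) * D powr (3 / 8)" "\<bar>qsqrt5_conj B\<bar> \<le> (2 * 150 ^ 3) * D powr (3 / 8)"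
    "\<bar>of_int C\<bar> \<le> (4 * 150 ^ 6) * D powr (3 / 4)"
proof -
  obtain x x0 x1 x2 x3 x4 where H: "\<forall>z\<in>{x0, x1, x2, x3, x4}. norm z \<le> 30 * D powr (1 / 8)"
    and T: "resolvent_triple A B C x0 x1 x2 x3 x4"
    using assms(1) unfolding d5_invariants_def prod.case D_def by blast
  have pow: "(5 * (30 * D powr (1 / 8))) ^ k = 150 ^ k * D powr (real k / 8)" if "k > 0" for k
  proof -
    have "(D powr (1 / 8)) ^ k = D powr (real k / 8)"
      using that by (cases "D = 0") (simp_all add: powr_powr D_def flip: powr_realpow)
    then show ?thesis by (simp add: power_mult_distrib flip: mult.assoc)
  qed
  have "(5 * (30 * D powr (1 / 8))) ^ 2 = 150 ^ 2 * D powr (1 / 4)"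
    "(5 * (30 * D powr (1 / 8))) ^ 3 = 150 ^ 3 * D powr (3 / 8)"
    "(5 * (30 * D powr (1 / 8))) ^ 6 = 150 ^ 6 * D powr (3 / 4)"
    using pow[of 2] pow[of 3] pow[of 6] by simp_all
  then show "\<bar>A\<bar> \<le> 150 ^ 2 * D powr (1 / 4)" "\<bar>qsqrt5_conj A\<bar> \<le> 150 ^ 2 * D powr (1 / 4)"
    "\<bar>B\<bar> \<le> (2 * 150 ^ 3) * D powr (3 / 8)" "\<bar>qsqrt5_conj B\<bar> \<le> (2 * 150 ^ 3) * D powr (3 / 8)"
    "\<bar>of_int C\<bar> \<le> (4 * 150 ^ 6) * D powr (3 / 4)"
    using resolvent_triple_bounds[OF T, of "30 * D powr (1 / 8)"] H by (simp_all del: power_mult_distrib)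
qed

text \<open>One common number \<open>y0\<close> suffices: it is conjugate to both generators, so
  both fields are isomorphic to \<rat>(y0).\<close>

lemma d5_invariants_injective:
  assumes "d5_invariants K T" "d5_invariants K' T"
  shows "cring_on K \<simeq> cring_on K'"
proof -
  obtain A B C where T: "T = (A, B, C)" by (cases T)
  obtain x x0 x1 x2 x3 x4 where x: "K = simple_ext x" "algebraic x" "d5_conjugates x x0 x1 x2 x3 x4"
    "x0 + x1 + x2 + x3 + x4 = 0" "resolvent_triple A B C x0 x1 x2 x3 x4"
    using assms(1) unfolding T d5_invariants_def prod.case by blast
  obtain y y0 y1 y2 y3 y4 where y: "K' = simple_ext y" "algebraic y" "d5_conjugates y y0 y1 y2 y3 y4"
    "y0 + y1 + y2 + y3 + y4 = 0" "resolvent_triple A B C y0 y1 y2 y3 y4"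
    using assms(2) unfolding T d5_invariants_def prod.case by blast
  have "y0 \<in> {x0, x1, x2, x3, x4}"
    by (rule resolvent_triple_determines_root[OF x(4) y(4) x(5) y(5) resolvent_triple_nonzero[OF x(3,4,5)]])
  then have y0x: "y0 \<in> conjugates x" using x(3) unfolding d5_conjugates_def by blast
  have y0y: "y0 \<in> conjugates y" using y(3) unfolding d5_conjugates_def by blast
  have "cring_on K \<simeq> cring_on (simple_ext y0)"
    unfolding x(1) by (rule simple_ext_conjugate_iso[OF x(2) y0x])
  moreover have "cring_on K' \<simeq> cring_on (simple_ext y0)"
    unfolding y(1) by (rule simple_ext_conjugate_iso[OF y(2) y0y])
  then have "cring_on (simple_ext y0) \<simeq> cring_on K'"
    by (rule cring_on_iso_sym[rotated]) (use csubfield_simple_ext[OF y(2)] y(1) in simp)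
  ultimately show ?thesis by (rule ring_iso_trans)
qed

text \<open>Choosing a triple separately for each K could separate isomorphic fields. Isomorphic
  fields satisfy the same predicate under the choice operator here, so they receive the same
  representative and thereby the same triple.\<close>

definition d5_representative :: "complex set \<Rightarrow> complex set" where
  "d5_representative K = (SOME K'. D5_quintic_field K' \<and> cring_on K \<simeq> cring_on K')"

lemma D5_quintic_field_csubfield: "D5_quintic_field K \<Longrightarrow> csubfield K"
  by (simp add: D5_quintic_field_def number_field_iff)

lemma d5_representative:
  assumes "D5_quintic_field K"
  shows "D5_quintic_field (d5_representative K)" "cring_on K \<simeq> cring_on (d5_representative K)"
  using someI[of "\<lambda>K'. D5_quintic_field K' \<and> cring_on K \<simeq> cring_on K'" K] assms ring_iso_refl
  unfolding d5_representative_def by blast+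

lemma d5_representative_eq:
  assumes "D5_quintic_field K" "D5_quintic_field K'" "cring_on K \<simeq> cring_on K'"
  shows "d5_representative K = d5_representative K'"
proof -
  have "cring_on K \<simeq> cring_on L \<longleftrightarrow> cring_on K' \<simeq> cring_on L" for L
    using ring_iso_trans assms(3) cring_on_iso_sym[OF D5_quintic_field_csubfield[OF assms(1)] assms(3)] by blast
  then show ?thesis by (simp add: d5_representative_def)
qed

theorem theorem1p1:
  shows "\<exists>(c1::real) (c2::real) (c3::real)
      (A :: complex set \<Rightarrow> real) (B :: complex set \<Rightarrow> real) (C :: complex set \<Rightarrow> int).
    c1 > 0 \<and> c2 > 0 \<and> c3 > 0 \<and>
    (\<forall>K. D5_quintic_field K \<longrightarrow>
       A K \<in> qsqrt5_integers \<and> B K \<in> qsqrt5_integers \<and>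
       qsqrt5_norm ((B K)\<^sup>2 - 4 * qsqrt5_conj (A K) * (A K)\<^sup>2) = 5 * (of_int (C K))\<^sup>2 \<and>
       (\<forall>\<sigma>\<in>{id, qsqrt5_conj}.
          \<bar>\<sigma> (A K)\<bar> \<le> c1 * \<bar>of_int (field_discriminant K)\<bar> powr (1/4) \<and>
          \<bar>\<sigma> (B K)\<bar> \<le> c2 * \<bar>of_int (field_discriminant K)\<bar> powr (3/8)) \<and>
       \<bar>of_int (C K)\<bar> \<le> c3 * \<bar>of_int (field_discriminant K)\<bar> powr (3/4)) \<and>
    (\<forall>K K'. D5_quintic_field K \<and> D5_quintic_field K' \<longrightarrow>
       ((A K, B K, C K) = (A K', B K', C K') \<longleftrightarrow> cring_on K \<simeq> cring_on K'))"
proof -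
  define T where "T = (\<lambda>K. SOME t. d5_invariants (d5_representative K) t)"
  define A where "A = (\<lambda>K. fst (T K))"
  define B where "B = (\<lambda>K. fst (snd (T K)))"
  define C where "C = (\<lambda>K. snd (snd (T K)))"
  have T_eq: "T K = (A K, B K, C K)" for K by (simp add: A_def B_def C_def)
  have T: "d5_invariants (d5_representative K) (T K)" if "D5_quintic_field K" for K
    using d5_invariants_exist[OF d5_representative(1)[OF that]] unfolding T_def by (metis someI_ex)
  have disc: "field_discriminant (d5_representative K) = field_discriminant K" if "D5_quintic_field K" for K
    using field_discriminant_iso[OF _ _ d5_representative(2)[OF that]] D5_quintic_field_csubfield that
      d5_representative(1)[OF that] by metis
  have eqs: "A K \<in> qsqrt5_integers \<and> B K \<in> qsqrt5_integers \<and>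
      qsqrt5_norm ((B K)\<^sup>2 - 4 * qsqrt5_conj (A K) * (A K)\<^sup>2) = 5 * (of_int (C K))\<^sup>2"
    if K: "D5_quintic_field K" for K
  proof -
    obtain x0 x1 x2 x3 x4 where "resolvent_triple (A K) (B K) (C K) x0 x1 x2 x3 x4"
      using T[OF K] unfolding T_eq d5_invariants_def prod.case by blast
    then show ?thesis using resolvent_triple_norm by (simp add: resolvent_triple_def Let_def)
  qed
  have bounds: "\<forall>\<sigma>\<in>{id, qsqrt5_conj}.
          \<bar>\<sigma> (A K)\<bar> \<le> 150 ^ 2 * \<bar>of_int (field_discriminant K)\<bar> powr (1/4) \<and>
          \<bar>\<sigma> (B K)\<bar> \<le> (2 * 150 ^ 3) * \<bar>of_int (field_discriminant K)\<bar> powr (3/8)"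
      "(\<bar>of_int (C K)\<bar> :: real) \<le> (4 * 150 ^ 6) * \<bar>of_int (field_discriminant K)\<bar> powr (3/4)"
    if K: "D5_quintic_field K" for K
    using d5_invariants_bounds[OF T[OF K, unfolded T_eq]] unfolding disc[OF K] by simp_all
  have iff: "(A K, B K, C K) = (A K', B K', C K') \<longleftrightarrow> cring_on K \<simeq> cring_on K'"
    if K: "D5_quintic_field K" "D5_quintic_field K'" for K K'
  proof
    assume "(A K, B K, C K) = (A K', B K', C K')"
    then have "T K = T K'" by (simp add: T_eq)
    then have "cring_on (d5_representative K) \<simeq> cring_on (d5_representative K')"
      using d5_invariants_injective T K by metis
    moreover have "cring_on (d5_representative K') \<simeq> cring_on K'"
      by (rule cring_on_iso_sym[OF D5_quintic_field_csubfield[OF K(2)] d5_representative(2)[OF K(2)]])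
    ultimately show "cring_on K \<simeq> cring_on K'"
      using ring_iso_trans d5_representative(2)[OF K(1)] by blast
  next
    assume "cring_on K \<simeq> cring_on K'"
    then have "d5_representative K = d5_representative K'" by (rule d5_representative_eq[OF K])
    then have "T K = T K'" by (simp add: T_def)
    then show "(A K, B K, C K) = (A K', B K', C K')" by (simp add: T_eq)
  qed
  show ?thesis
    by (rule exI[of _ "150 ^ 2"], rule exI[of _ "2 * 150 ^ 3"], rule exI[of _ "4 * 150 ^ 6"],
        rule exI[of _ A], rule exI[of _ B], rule exI[of _ C])
       (use eqs bounds iff in auto)
qed

end
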